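(* Let $\alpha>1$, $\beta>1/2$, $\gamma>1/2$ and $C_1>1$ be given constants. Let $\mathcal{E}$ be an $L^2(I)$-valued Gaussian random variable with $\mathrm{E}(\langle f,\mathcal{E}\rangle)=0$ and $\mathrm{E}(\langle f,\mathcal{E}\rangle^2)>0$ for all $f\in L^2(I)$ with $\|f\|=1$. Let $R(s,t)=\mathrm{E}\{\mathcal{E}(s)\mathcal{E}(t)\}$ be its covariance function, with spectral expansion $R(s,t)=\sum_{j=1}^\infty\lambda_j\phi_j(s)\phi_j(t)$, where $\lambda_1\ge\lambda_2\ge\cdots>0$ and $\{\phi_j\}_{j=1}^\infty$ is an orthonormal basis of $L^2(I)$. Let $X=\sum_{k=1}^\infty k^{-\alpha/2}U_k\phi_k$, where $U_1,U_2,\dots$ are independent uniform random variables on $[-3^{1/2},3^{1/2}]$, independent of $\mathcal{E}$, and, for $b\in L^2(I^2)$, let $$Y(\cdot)=\int_I b(\cdot,t)X(t)\,dt+\mathcal{E}(\cdot).$$ Define $$\mathcal{B}(\beta,\gamma,C_1)=\Big\{b=\sum_{j,k}b_{j,k}\,\phi_j\otimes\phi_k:\ |b_{j,k}|\le C_1j^{-\gamma}k^{-\beta}\ \text{for all } j,k\ge1\Big\}.$$ Then there exists a constant $c>0$ such that $$\liminf_{n\to\infty}\ \inf_{\overline b^n}\ \sup_{b\in\mathcal{B}(\beta,\gamma,C_1)}\mathrm{P}_b\left\{|||\overline b^n-b|||^2\ge c\,n^{-(2\beta-1)/(\alpha+2\beta)}\right\}>0,$$ where $\mathrm{P}_b$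 denotes the probability under $b$, and $\inf_{\overline b^n}$ is taken over all estimators $\overline b^n$ of $b$ based on $(X_1,Y_1),\dots,(X_n,Y_n)$, independent copies of $(X,Y)$.
   Context: Here $I=[0,1]$; $\langle f,g\rangle=\int_I f(t)g(t)\,dt$ and $\|f\|=\langle f,f\rangle^{1/2}$ on $L^2(I)$; $|||R|||=\{\iint_{I^2}R^2(s,t)\,ds\,dt\}^{1/2}$ on $L^2(I^2)$; $(f\otimes g)(s,t)=f(s)g(t)$. An $L^2(I)$-valued random variable $Z$ is Gaussian if $\langle f,Z\rangle$ is normally distributed for each $f\in L^2(I)$. An estimator of $b$ based on the sample is a measurable function of $(X_1,Y_1),\dots,(X_n,Y_n)$ with values in $L^2(I^2)$. *)

theory Defs
  imports "HOL-Probability.Probability"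
begin

section \<open>Square-integrable functions\<close>

text \<open>
  Elements of \<open>L\<^sup>2\<close> are represented by functions; functions that agree almost everywhere represent
  the same element. Every notion below is insensitive to the choice of representative.
\<close>

definition L2 :: "'a measure \<Rightarrow> ('a \<Rightarrow> real) set" where
  "L2 N = {f \<in> borel_measurable N. integrable N (\<lambda>x. (f x)\<^sup>2)}"

definition L2_inner :: "'a measure \<Rightarrow> ('a \<Rightarrow> real) \<Rightarrow> ('a \<Rightarrow> real) \<Rightarrow> real" where
  "L2_inner N f g = (\<integral>x. f x * g x \<partial>N)"

definition L2_norm :: "'a measure \<Rightarrow> ('a \<Rightarrow> real) \<Rightarrow> real" where
  "L2_norm N f = sqrt (L2_inner N f f)"

definition L2_open :: "'a measure \<Rightarrow> ('a \<Rightarrow> real) set \<Rightarrow> bool" where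
  "L2_open N G \<longleftrightarrow> G \<subseteq> L2 N \<and>
     (\<forall>f\<in>G. \<exists>e>0. \<forall>g\<in>L2 N. L2_norm N (\<lambda>x. g x - f x) < e \<longrightarrow> g \<in> G)"

text \<open>
  Open sets are unions of classes modulo almost everywhere equality, so this is the pullback of
  the Borel \<open>\<sigma>\<close>-algebra of the Hilbert space \<open>L\<^sup>2\<close> to its representatives.
\<close>

definition L2_borel :: "'a measure \<Rightarrow> ('a \<Rightarrow> real) measure" where
  "L2_borel N = sigma (L2 N) {G. L2_open N G}"

text \<open>Unordered convergence in norm, as for \<^const>\<open>has_sum\<close>.\<close>

definition has_L2_sum ::
    "'a measure \<Rightarrow> ('i \<Rightarrow> 'a \<Rightarrow> real) \<Rightarrow> 'i set \<Rightarrow> ('a \<Rightarrow> real) \<Rightarrow> bool" where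
  "has_L2_sum N f A s \<longleftrightarrow> s \<in> L2 N \<and> (\<forall>i\<in>A. f i \<in> L2 N) \<and>
     ((\<lambda>F. L2_norm N (\<lambda>x. (\<Sum>i\<in>F. f i x) - s x)) \<longlongrightarrow> 0) (finite_subsets_at_top A)"

text \<open>Sequences are indexed by the positive integers; the value at index \<open>0\<close> is irrelevant.\<close>

definition L2_orthonormal_basis :: "'a measure \<Rightarrow> (nat \<Rightarrow> 'a \<Rightarrow> real) \<Rightarrow> bool" where
  "L2_orthonormal_basis N \<phi> \<longleftrightarrow>
     (\<forall>j\<ge>1. \<phi> j \<in> L2 N) \<and>
     (\<forall>j\<ge>1. \<forall>k\<ge>1. L2_inner N (\<phi> j) (\<phi> k) = (if j = k then 1 else 0)) \<and>
     (\<forall>f\<in>L2 N. has_L2_sum N (\<lambda>j x. L2_inner N f (\<phi> j) * \<phi> j x) {1..} f)"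

definition tensor :: "('a \<Rightarrow> real) \<Rightarrow> ('b \<Rightarrow> real) \<Rightarrow> 'a \<times> 'b \<Rightarrow> real" (infixr "\<otimes>\<^sub>t" 75) where
  "f \<otimes>\<^sub>t g = (\<lambda>(s, t). f s * g t)"

abbreviation unit_meas :: "real measure" where
  "unit_meas \<equiv> restrict_space lborel {0..1}"

abbreviation unit_meas2 :: "(real \<times> real) measure" where
  "unit_meas2 \<equiv> unit_meas \<Otimes>\<^sub>M unit_meas"


section \<open>Gaussian random functions\<close>

text \<open>Point masses count as normal distributions.\<close>

definition normally_distributed :: "'w measure \<Rightarrow> ('w \<Rightarrow> real) \<Rightarrow> bool" where
  "normally_distributed M Z \<longleftrightarrow> Z \<in> borel_measurable M \<and>
     (\<exists>\<mu> \<sigma>. 0 \<le> \<sigma> \<and> distr M borel Z =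
        (if \<sigma> = 0 then return borel \<mu> else density lborel (normal_density \<mu> \<sigma>)))"

definition L2_gaussian :: "'w measure \<Rightarrow> ('w \<Rightarrow> real \<Rightarrow> real) \<Rightarrow> bool" where
  "L2_gaussian M Z \<longleftrightarrow> Z \<in> M \<rightarrow>\<^sub>M L2_borel unit_meas \<and>
     (\<forall>f\<in>L2 unit_meas. normally_distributed M (\<lambda>\<omega>. L2_inner unit_meas f (Z \<omega>)))"

text \<open>
  The point evaluations \<open>Z(s)\<close> of an \<open>L\<^sup>2\<close>-valued random variable only make sense for a
  jointly measurable version \<open>V\<close> of \<open>Z\<close>. Such a version always exists, and \<open>R(s,t) = E(Z(s) Z(t))\<close>
  does not depend on its choice, up to null sets of \<open>(s,t)\<close>.
\<close>

definition covariance_function ::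
    "'w measure \<Rightarrow> ('w \<Rightarrow> real \<Rightarrow> real) \<Rightarrow> (real \<times> real \<Rightarrow> real) \<Rightarrow> bool" where
  "covariance_function M Z R \<longleftrightarrow>
     (\<exists>V. (\<lambda>(\<omega>, t). V \<omega> t) \<in> borel_measurable (M \<Otimes>\<^sub>M unit_meas) \<and>
          (AE \<omega> in M. AE t in unit_meas. V \<omega> t = Z \<omega> t) \<and>
          (AE (s, t) in unit_meas2. has_bochner_integral M (\<lambda>\<omega>. V \<omega> s * V \<omega> t) (R (s, t))))"


section \<open>The functional linear model\<close>

text \<open>\<^const>\<open>prob_space.indep_var\<close> requires both variables to have the same range type.\<close>

definition indep_pair ::
    "'w measure \<Rightarrow> 'b measure \<Rightarrow> ('w \<Rightarrow> 'b) \<Rightarrow> 'c measure \<Rightarrow> ('w \<Rightarrow> 'c) \<Rightarrow> bool" where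
  "indep_pair M N\<^sub>1 Z\<^sub>1 N\<^sub>2 Z\<^sub>2 \<longleftrightarrow> Z\<^sub>1 \<in> M \<rightarrow>\<^sub>M N\<^sub>1 \<and> Z\<^sub>2 \<in> M \<rightarrow>\<^sub>M N\<^sub>2 \<and>
     prob_space.indep_set M {Z\<^sub>1 -` A \<inter> space M | A. A \<in> sets N\<^sub>1}
       {Z\<^sub>2 -` A \<inter> space M | A. A \<in> sets N\<^sub>2}"

definition response ::
    "(real \<times> real \<Rightarrow> real) \<Rightarrow> (real \<Rightarrow> real) \<Rightarrow> (real \<Rightarrow> real) \<Rightarrow> real \<Rightarrow> real" where
  "response b x e = (\<lambda>s. (\<integral>t. b (s, t) * x t \<partial>unit_meas) + e s)"

definition coefficient_class ::
    "(nat \<Rightarrow> real \<Rightarrow> real) \<Rightarrow> real \<Rightarrow> real \<Rightarrow> real \<Rightarrow> (real \<times> real \<Rightarrow> real) set" where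
  "coefficient_class \<phi> \<beta> \<gamma> C = {b. \<exists>a :: nat \<Rightarrow> nat \<Rightarrow> real.
     has_L2_sum unit_meas2 (\<lambda>(j, k) z. a j k * (\<phi> j \<otimes>\<^sub>t \<phi> k) z) ({1..} \<times> {1..}) b \<and>
     (\<forall>j\<ge>1. \<forall>k\<ge>1. \<bar>a j k\<bar> \<le> C * real j powr (-\<gamma>) * real k powr (-\<beta>))}"

abbreviation obs_space :: "((real \<Rightarrow> real) \<times> (real \<Rightarrow> real)) measure" where
  "obs_space \<equiv> L2_borel unit_meas \<Otimes>\<^sub>M L2_borel unit_meas"

definition estimators ::
    "nat \<Rightarrow> ((nat \<Rightarrow> (real \<Rightarrow> real) \<times> (real \<Rightarrow> real)) \<Rightarrow> real \<times> real \<Rightarrow> real) set" where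
  "estimators n = (\<Pi>\<^sub>M i\<in>{1..n}. obs_space) \<rightarrow>\<^sub>M L2_borel unit_meas2"

text \<open>The joint law of \<open>n\<close> independent copies of \<open>(X, Y)\<close> when the regression function is \<open>b\<close>.\<close>

definition sample_law ::
    "'w measure \<Rightarrow> ('w \<Rightarrow> real \<Rightarrow> real) \<Rightarrow> ('w \<Rightarrow> real \<Rightarrow> real) \<Rightarrow> (real \<times> real \<Rightarrow> real) \<Rightarrow> nat
      \<Rightarrow> (nat \<Rightarrow> (real \<Rightarrow> real) \<times> (real \<Rightarrow> real)) measure" where
  "sample_law M X \<E> b n =
     (\<Pi>\<^sub>M i\<in>{1..n}. distr M obs_space (\<lambda>\<omega>. (X \<omega>, response b (X \<omega>) (\<E> \<omega>))))"

end

theory Submission imports Defs begin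

text \<open>
  The lower bound already holds on a hypercube inside the coefficient class. Its vertices are the kernels
  \<open>b\<^sub>S = \<phi>\<^sub>1 \<otimes> (\<Sum>k\<in>S. k powr (- \<beta>) \<phi>\<^sub>k)\<close> for subsets \<open>S\<close> of \<open>{m+1..2*m}\<close>, with \<open>m\<close> of order
  \<open>n powr (1 / (\<alpha> + 2 * \<beta>))\<close>; they lie in the class as the bound
  for the coefficient of \<open>\<phi>\<^sub>1 \<otimes> \<phi>\<^sub>k\<close> is a multiple \<open>C \<ge> 1\<close> of \<open>k powr (- \<beta>)\<close>. Neighbouring
  vertices, which differ in one coordinate \<open>k\<close>, shift the response by
  \<open>k powr (- \<beta>) \<langle>X, \<phi>\<^sub>k\<rangle> \<phi>\<^sub>1\<close>, of squared length at most \<open>3 * k powr (- (\<alpha> + 2 * \<beta>))\<close>. Over \<open>n\<close>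
  observations these add up to a bounded amount, so no test tells neighbours apart reliably, and
  any estimator gets a fixed fraction of the \<open>m\<close> coordinates wrong with probability bounded below
  (lemma \<open>Assouad\<close>). Every error costs at least a multiple of \<open>m powr (- 2 * \<beta>)\<close> in squared norm, in
  total a multiple of \<open>m powr (1 - 2 * \<beta>)\<close>, which is the claimed rate.

  Neighbouring vertices are compared through the inequality \<open>(\<integral>f dP)\<^sup>2 \<le> K \<integral>f\<^sup>2 dQ\<close>, a chi-square bound that
  is stable under products and mixtures (\<open>chi2_dominated_PiM\<close>, \<open>observation_chi2\<close>) and for two normal
  laws with variance \<open>v\<close> and means \<open>a\<close>, \<open>b\<close> holds with \<open>K = exp ((a - b)\<^sup>2 / v)\<close>
  (\<open>chi2_dominated_normal\<close>). Because the design is bounded in each coordinate, the constant is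
  deterministic.

  The reduction to one-dimensional normal laws rests on the structure of the noise: its first coordinate
  is independent of the remainder, so a shift along \<open>\<phi>\<^sub>1\<close> acts on this coordinate only (\<open>shift_chi2\<close>).
  To see this, the Borel sets of \<open>L\<^sup>2\<close> are described by coordinates (\<open>sets_L2_borel_coords\<close>). The
  covariances of the coordinates are obtained from the covariance function by Fubini's theorem
  (\<open>covariance_inner\<close>), after showing that the noise has a square-integrable norm
  (\<open>norm_E_square_integrable\<close>). Finally, uncorrelated coordinates are independent because
  their joint characteristic function factorises (\<open>indep_vars_of_char\<close>).
\<close>

section \<open>Square-integrable functions as a pre-Hilbert space\<close>

lemma L2_D:
  assumes "f \<in> L2 N"
  shows "f \<in> borel_measurable N" "integrable N (\<lambda>x. (f x)\<^sup>2)"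
  using assms by (auto simp: L2_def)

lemma L2_integrable_mult:
  assumes "f \<in> L2 N" "g \<in> L2 N"
  shows "integrable N (\<lambda>x. f x * g x)"
proof (rule Bochner_Integration.integrable_bound)
  show "integrable N (\<lambda>x. (f x)\<^sup>2 + (g x)\<^sup>2)"
    using assms by (intro Bochner_Integration.integrable_add L2_D)
  show "(\<lambda>x. f x * g x) \<in> borel_measurable N"
    using L2_D(1)[OF assms(1)] L2_D(1)[OF assms(2)] by measurable
  have "\<bar>f x * g x\<bar> \<le> (f x)\<^sup>2 + (g x)\<^sup>2" for x
  proof -
    have "2 * (\<bar>f x\<bar> * \<bar>g x\<bar>) \<le> (f x)\<^sup>2 + (g x)\<^sup>2"
      using sum_squares_bound[of "\<bar>f x\<bar>" "\<bar>g x\<bar>"] by (simp add: mult.assoc)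
    moreover have "0 \<le> \<bar>f x\<bar> * \<bar>g x\<bar>" by simp
    ultimately show ?thesis unfolding abs_mult by linarith
  qed
  then show "AE x in N. norm (f x * g x) \<le> norm ((f x)\<^sup>2 + (g x)\<^sup>2)"
    by simp
qed

lemma L2_add: "(\<lambda>x. f x + g x) \<in> L2 N" if "f \<in> L2 N" "g \<in> L2 N"
proof -
  have "(\<lambda>x. (f x + g x)\<^sup>2) = (\<lambda>x. (f x)\<^sup>2 + (g x)\<^sup>2 + 2 * (f x * g x))"
    by (simp add: power2_sum mult.assoc)
  moreover have "integrable N (\<lambda>x. (f x)\<^sup>2 + (g x)\<^sup>2 + 2 * (f x * g x))"
    using that by (intro Bochner_Integration.integrable_add L2_D integrable_mult_right L2_integrable_mult)
  ultimately show ?thesis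
    using L2_D(1)[OF that(1)] L2_D(1)[OF that(2)] by (simp add: L2_def)
qed

lemma L2_scale: "(\<lambda>x. c * f x) \<in> L2 N" if "f \<in> L2 N"
  using that by (auto simp: L2_def power_mult_distrib)

lemma L2_zero: "(\<lambda>x. 0) \<in> L2 N"
  by (auto simp: L2_def)

lemma L2_diff: "(\<lambda>x. f x - g x) \<in> L2 N" if "f \<in> L2 N" "g \<in> L2 N"
  using L2_add[OF that(1) L2_scale[OF that(2), of "-1"]] by simp

lemma L2_sum: "(\<lambda>x. \<Sum>i\<in>I. f i x) \<in> L2 N" if "\<And>i. i \<in> I \<Longrightarrow> f i \<in> L2 N"
  using that by (induction I rule: infinite_finite_induct) (auto intro: L2_zero L2_add)

lemma L2_inner_commute: "L2_inner N f g = L2_inner N g f"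
  by (simp add: L2_inner_def mult.commute)

lemma L2_inner_add_left:
  assumes "f \<in> L2 N" "g \<in> L2 N" "h \<in> L2 N"
  shows "L2_inner N (\<lambda>x. f x + g x) h = L2_inner N f h + L2_inner N g h"
  using assms by (simp add: L2_inner_def distrib_right L2_integrable_mult)

lemma L2_inner_diff_left:
  assumes "f \<in> L2 N" "g \<in> L2 N" "h \<in> L2 N"
  shows "L2_inner N (\<lambda>x. f x - g x) h = L2_inner N f h - L2_inner N g h"
  using assms by (simp add: L2_inner_def left_diff_distrib L2_integrable_mult)

lemma L2_inner_scale_left: "L2_inner N (\<lambda>x. c * f x) g = c * L2_inner N f g"
  by (simp add: L2_inner_def mult.assoc)

lemma L2_inner_zero_left: "L2_inner N (\<lambda>x. 0) g = 0"
  by (simp add: L2_inner_def)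

lemma L2_inner_sum_left:
  assumes "\<And>i. i \<in> I \<Longrightarrow> f i \<in> L2 N" "g \<in> L2 N"
  shows "L2_inner N (\<lambda>x. \<Sum>i\<in>I. f i x) g = (\<Sum>i\<in>I. L2_inner N (f i) g)"
  using assms by (induction I rule: infinite_finite_induct)
    (auto simp: L2_inner_zero_left L2_inner_add_left L2_sum)

lemma L2_inner_add_right:
  assumes "f \<in> L2 N" "g \<in> L2 N" "h \<in> L2 N"
  shows "L2_inner N h (\<lambda>x. f x + g x) = L2_inner N h f + L2_inner N h g"
  using L2_inner_add_left[OF assms] by (simp add: L2_inner_commute)

lemma L2_inner_scale_right: "L2_inner N g (\<lambda>x. c * f x) = c * L2_inner N g f"
  by (simp add: L2_inner_def mult.left_commute)

lemma L2_inner_self_nonneg: "0 \<le> L2_inner N f f"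
  by (simp add: L2_inner_def)

lemma L2_norm_nonneg: "0 \<le> L2_norm N f"
  by (simp add: L2_norm_def L2_inner_self_nonneg)

lemma L2_norm_square: "(L2_norm N f)\<^sup>2 = L2_inner N f f"
  by (simp add: L2_norm_def L2_inner_self_nonneg)

lemma L2_inner_quadratic:
  assumes "f \<in> L2 N" "g \<in> L2 N"
  shows "L2_inner N (\<lambda>x. f x + c * g x) (\<lambda>x. f x + c * g x)
      = L2_inner N f f + 2 * c * L2_inner N f g + c\<^sup>2 * L2_inner N g g"
  using assms L2_scale[OF assms(2), of c]
  by (simp add: L2_inner_add_left L2_inner_add_right L2_add L2_inner_scale_left L2_inner_scale_right
      power2_eq_square L2_inner_commute[of N g f] algebra_simps)

lemma L2_Cauchy_Schwarz:
  assumes "f \<in> L2 N" "g \<in> L2 N"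
  shows "\<bar>L2_inner N f g\<bar> \<le> L2_norm N f * L2_norm N g"
proof -
  let ?a = "L2_inner N f f" and ?b = "L2_inner N f g" and ?c = "L2_inner N g g"
  have nn: "0 \<le> ?a + 2 * t * ?b + t\<^sup>2 * ?c" for t
    using L2_inner_self_nonneg[of N "\<lambda>x. f x + t * g x"] L2_inner_quadratic[OF assms, of t] by simp
  have "?b\<^sup>2 \<le> ?a * ?c"
  proof (cases "?c = 0")
    case True
    have "?b = 0"
    proof (rule ccontr)
      assume "?b \<noteq> 0"
      then show False using nn[of "- (?a + 1) / (2 * ?b)"] True by (simp add: field_simps)
    qed
    then show ?thesis using True by simp
  next
    case False
    then have c: "?c > 0" using L2_inner_self_nonneg[of N g] by simp
    have "0 \<le> ?c * (?a + 2 * (- ?b / ?c) * ?b + (- ?b / ?c)\<^sup>2 * ?c)"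
      using nn[of "- ?b / ?c"] c by (intro mult_nonneg_nonneg) linarith+
    also have "\<dots> = ?a * ?c - ?b\<^sup>2"
      using c by (simp add: field_simps power2_eq_square)
    finally show ?thesis by simp
  qed
  then have "sqrt (?b\<^sup>2) \<le> sqrt (?a * ?c)" by (rule real_sqrt_le_mono)
  then show ?thesis by (simp add: L2_norm_def real_sqrt_mult)
qed

lemma L2_norm_triangle:
  assumes "f \<in> L2 N" "g \<in> L2 N"
  shows "L2_norm N (\<lambda>x. f x + g x) \<le> L2_norm N f + L2_norm N g"
proof (rule power2_le_imp_le)
  have "(L2_norm N (\<lambda>x. f x + g x))\<^sup>2 = (L2_norm N f)\<^sup>2 + 2 * L2_inner N f g + (L2_norm N g)\<^sup>2"
    using L2_inner_quadratic[OF assms, of 1] by (simp add: L2_norm_square)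
  also have "\<dots> \<le> (L2_norm N f + L2_norm N g)\<^sup>2"
    using L2_Cauchy_Schwarz[OF assms] by (simp add: power2_sum)
  finally show "(L2_norm N (\<lambda>x. f x + g x))\<^sup>2 \<le> (L2_norm N f + L2_norm N g)\<^sup>2" .
qed (simp add: L2_norm_nonneg)

lemma L2_norm_scale: "L2_norm N (\<lambda>x. c * f x) = \<bar>c\<bar> * L2_norm N f"
  by (simp add: L2_norm_def L2_inner_scale_left L2_inner_scale_right real_sqrt_mult flip: mult.assoc)

lemma L2_norm_minus_commute: "L2_norm N (\<lambda>x. f x - g x) = L2_norm N (\<lambda>x. g x - f x)"
  using L2_norm_scale[of N "-1" "\<lambda>x. f x - g x"] by simp

lemma L2_dist_triangle:
  assumes "f \<in> L2 N" "g \<in> L2 N" "h \<in> L2 N"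
  shows "L2_norm N (\<lambda>x. f x - h x) \<le> L2_norm N (\<lambda>x. f x - g x) + L2_norm N (\<lambda>x. g x - h x)"
  using L2_norm_triangle[OF L2_diff[OF assms(1,2)] L2_diff[OF assms(2,3)]] by simp

text \<open>
  Completing the square in each coordinate. With the Fourier coefficients for \<open>c\<close> this gives Bessel's
  inequality and Parseval's identity; with other values of \<open>c\<close> it describes the distance to a finite
  combination of basis vectors through the norm and the coordinates alone.
\<close>

lemma L2_norm_square_diff_expansion:
  assumes f: "f \<in> L2 N" and fin: "finite F" and e: "\<And>i. i \<in> F \<Longrightarrow> e i \<in> L2 N"
    and on: "\<And>i j. i \<in> F \<Longrightarrow> j \<in> F \<Longrightarrow> L2_inner N (e i) (e j) = (if i = j then 1 else 0)"
  shows "(L2_norm N (\<lambda>x. f x - (\<Sum>i\<in>F. c i * e i x)))\<^sup>2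
      = L2_inner N f f - (\<Sum>i\<in>F. (L2_inner N f (e i))\<^sup>2) + (\<Sum>i\<in>F. (L2_inner N f (e i) - c i)\<^sup>2)"
proof -
  let ?s = "\<lambda>x. \<Sum>i\<in>F. c i * e i x"
  have s: "?s \<in> L2 N" using e by (intro L2_sum L2_scale)
  have fs: "L2_inner N ?s h = (\<Sum>i\<in>F. c i * L2_inner N (e i) h)" if "h \<in> L2 N" for h
    using e that by (simp add: L2_inner_sum_left L2_scale L2_inner_scale_left)
  have fs': "L2_inner N h ?s = (\<Sum>i\<in>F. c i * L2_inner N h (e i))" if h: "h \<in> L2 N" for h
    unfolding L2_inner_commute[of N h ?s] fs[OF h]
    by (intro sum.cong refl) (subst L2_inner_commute, rule refl)
  have se: "L2_inner N (e i) ?s = c i" if i: "i \<in> F" for i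
  proof -
    have "L2_inner N (e i) ?s = (\<Sum>j\<in>F. if j = i then c j else 0)"
      unfolding fs'[OF e[OF i]] by (intro sum.cong refl) (simp add: on[OF i])
    then show ?thesis using fin i by simp
  qed
  have ss: "L2_inner N ?s ?s = (\<Sum>i\<in>F. (c i)\<^sup>2)"
    using fs[OF s] se by (simp add: power2_eq_square)
  have "(L2_norm N (\<lambda>x. f x - ?s x))\<^sup>2 = L2_inner N f f - 2 * L2_inner N f ?s + L2_inner N ?s ?s"
    using L2_inner_quadratic[OF f s, of "-1"] by (simp add: L2_norm_square)
  also have "\<dots> = L2_inner N f f + (\<Sum>i\<in>F. (c i)\<^sup>2 - 2 * (c i * L2_inner N f (e i)))"
    unfolding ss fs'[OF f] by (simp add: sum_subtractf sum_distrib_left)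
  also have "(\<Sum>i\<in>F. (c i)\<^sup>2 - 2 * (c i * L2_inner N f (e i)))
      = (\<Sum>i\<in>F. (L2_inner N f (e i) - c i)\<^sup>2 - (L2_inner N f (e i))\<^sup>2)"
    by (intro sum.cong) (auto simp: power2_diff)
  finally show ?thesis by (simp add: sum_subtractf)
qed

lemma L2_Bessel:
  assumes f: "f \<in> L2 N" and fin: "finite F" and e: "\<And>i. i \<in> F \<Longrightarrow> e i \<in> L2 N"
    and on: "\<And>i j. i \<in> F \<Longrightarrow> j \<in> F \<Longrightarrow> L2_inner N (e i) (e j) = (if i = j then 1 else 0)"
  shows "(\<Sum>i\<in>F. (L2_inner N f (e i))\<^sup>2) \<le> (L2_norm N f)\<^sup>2"
proof -
  have "0 \<le> L2_inner N (\<lambda>x. f x - (\<Sum>i\<in>F. L2_inner N f (e i) * e i x)) (\<lambda>x. f x - (\<Sum>i\<in>F. L2_inner N f (e i) * e i x))"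
    by (rule L2_inner_self_nonneg)
  then show ?thesis
    using L2_norm_square_diff_expansion[OF assms, of "\<lambda>i. L2_inner N f (e i)"] by (simp add: L2_norm_square)
qed

lemma tendsto_L2_inner:
  assumes lim: "((\<lambda>i. L2_norm N (\<lambda>x. f i x - g x)) \<longlongrightarrow> 0) F"
    and f: "\<forall>\<^sub>F i in F. f i \<in> L2 N" and g: "g \<in> L2 N" and h: "h \<in> L2 N"
  shows "((\<lambda>i. L2_inner N (f i) h) \<longlongrightarrow> L2_inner N g h) F"
proof (rule LIM_zero_cancel, rule Lim_null_comparison)
  show "\<forall>\<^sub>F i in F. norm (L2_inner N (f i) h - L2_inner N g h) \<le> L2_norm N (\<lambda>x. f i x - g x) * L2_norm N h"
    using f
  proof eventually_elim
    case (elim i)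
    then show ?case using L2_Cauchy_Schwarz[OF L2_diff[OF elim g] h] by (simp add: L2_inner_diff_left g h)
  qed
  show "((\<lambda>i. L2_norm N (\<lambda>x. f i x - g x) * L2_norm N h) \<longlongrightarrow> 0) F"
    using tendsto_mult_left_zero[OF lim] .
qed

text \<open>
  By continuity of the inner product, pairing an orthogonal expansion with a vector that sees only one
  of its terms isolates this term. It is applied both to the coordinates of the design and to the
  spectral expansion of the covariance function.
\<close>

lemma L2_inner_has_L2_sum:
  assumes s: "has_L2_sum N f A s" and h: "h \<in> L2 N" and k: "k \<in> A"
    and orth: "\<And>i. i \<in> A \<Longrightarrow> i \<noteq> k \<Longrightarrow> L2_inner N (f i) h = 0"
  shows "L2_inner N s h = L2_inner N (f k) h"
proof (rule tendsto_unique)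
  have f: "f i \<in> L2 N" if "i \<in> A" for i using s that by (auto simp: has_L2_sum_def)
  have sub: "\<forall>\<^sub>F F in finite_subsets_at_top A. finite F \<and> F \<subseteq> A \<and> k \<in> F"
    using eventually_finite_subsets_at_top[of _ A] k by (auto intro!: exI[of _ "{k}"])
  show "((\<lambda>F. L2_inner N (\<lambda>x. \<Sum>i\<in>F. f i x) h) \<longlongrightarrow> L2_inner N s h) (finite_subsets_at_top A)"
    using s sub by (intro tendsto_L2_inner h) (auto simp: has_L2_sum_def elim!: eventually_mono intro!: L2_sum)
  show "((\<lambda>F. L2_inner N (\<lambda>x. \<Sum>i\<in>F. f i x) h) \<longlongrightarrow> L2_inner N (f k) h) (finite_subsets_at_top A)"
  proof (rule tendsto_eventually)
    show "\<forall>\<^sub>F F in finite_subsets_at_top A. L2_inner N (\<lambda>x. \<Sum>i\<in>F. f i x) h = L2_inner N (f k) h"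
      using sub
    proof eventually_elim
      case (elim F)
      have "L2_inner N (\<lambda>x. \<Sum>i\<in>F. f i x) h = (\<Sum>i\<in>F. L2_inner N (f i) h)"
        using elim f h by (intro L2_inner_sum_left) auto
      also have "\<dots> = (\<Sum>i\<in>{k}. L2_inner N (f i) h)"
        using elim orth by (intro sum.mono_neutral_right) auto
      finally show ?case by simp
    qed
  qed
qed simp

section \<open>The Borel \<open>\<sigma>\<close>-algebra of \<open>L\<^sup>2\<close>\<close>

lemma L2_open_subset: "{G. L2_open N G} \<subseteq> Pow (L2 N)"
  by (auto simp: L2_open_def)

lemma space_L2_borel [simp]: "space (L2_borel N) = L2 N"
  unfolding L2_borel_def by (rule space_measure_of) (rule L2_open_subset)

lemma sets_L2_borel: "sets (L2_borel N) = sigma_sets (L2 N) {G. L2_open N G}"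
  unfolding L2_borel_def by (rule sets_measure_of) (rule L2_open_subset)

text \<open>
  The preimage of an open set under a Lipschitz functional is itself one of the generating sets.
\<close>

lemma L2_continuous_measurable:
  fixes \<Psi> :: "('a \<Rightarrow> real) \<Rightarrow> real"
  assumes "\<And>f g. f \<in> L2 N \<Longrightarrow> g \<in> L2 N \<Longrightarrow> \<bar>\<Psi> g - \<Psi> f\<bar> \<le> K * L2_norm N (\<lambda>x. g x - f x)"
  shows "\<Psi> \<in> borel_measurable (L2_borel N)"
proof (rule borel_measurableI)
  fix S :: "real set" assume S: "open S"
  have "L2_open N (\<Psi> -` S \<inter> L2 N)"
    unfolding L2_open_def
  proof (intro conjI ballI)
    fix f assume f: "f \<in> \<Psi> -` S \<inter> L2 N"
    then obtain e where e: "e > 0" "\<And>y. \<bar>y - \<Psi> f\<bar> < e \<Longrightarrow> y \<in> S"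
      using S by (auto simp: open_dist dist_real_def)
    have "\<forall>g\<in>L2 N. L2_norm N (\<lambda>x. g x - f x) < e / (\<bar>K\<bar> + 1) \<longrightarrow> g \<in> \<Psi> -` S \<inter> L2 N"
    proof (intro ballI impI)
      fix g assume g: "g \<in> L2 N" "L2_norm N (\<lambda>x. g x - f x) < e / (\<bar>K\<bar> + 1)"
      have "\<bar>\<Psi> g - \<Psi> f\<bar> \<le> K * L2_norm N (\<lambda>x. g x - f x)" using assms f g by auto
      also have "\<dots> \<le> (\<bar>K\<bar> + 1) * L2_norm N (\<lambda>x. g x - f x)"
        by (intro mult_right_mono) (auto simp: L2_norm_nonneg)
      also have "\<dots> < e" using g(2) by (simp add: field_simps)
      finally show "g \<in> \<Psi> -` S \<inter> L2 N" using e g by auto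
    qed
    then show "\<exists>e>0. \<forall>g\<in>L2 N. L2_norm N (\<lambda>x. g x - f x) < e \<longrightarrow> g \<in> \<Psi> -` S \<inter> L2 N"
      using e(1) by (intro exI[of _ "e / (\<bar>K\<bar> + 1)"]) auto
  qed auto
  then show "\<Psi> -` S \<inter> space (L2_borel N) \<in> sets (L2_borel N)"
    by (auto simp: sets_L2_borel)
qed

lemma measurable_L2_inner:
  assumes "h \<in> L2 N"
  shows "(\<lambda>f. L2_inner N f h) \<in> borel_measurable (L2_borel N)"
proof (rule L2_continuous_measurable)
  fix f g assume "f \<in> L2 N" "g \<in> L2 N"
  then show "\<bar>L2_inner N g h - L2_inner N f h\<bar> \<le> L2_norm N h * L2_norm N (\<lambda>x. g x - f x)"
    using L2_Cauchy_Schwarz[OF L2_diff assms] assms by (simp add: L2_inner_diff_left mult.commute)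
qed

lemma measurable_L2_dist:
  assumes "h \<in> L2 N"
  shows "(\<lambda>f. L2_norm N (\<lambda>x. f x - h x)) \<in> borel_measurable (L2_borel N)"
proof (rule L2_continuous_measurable)
  fix f g assume "f \<in> L2 N" "g \<in> L2 N"
  then show "\<bar>L2_norm N (\<lambda>x. g x - h x) - L2_norm N (\<lambda>x. f x - h x)\<bar> \<le> 1 * L2_norm N (\<lambda>x. g x - f x)"
    using L2_dist_triangle[of f N g h] L2_dist_triangle[of g N f h] assms
      L2_norm_minus_commute[of N f g] by simp
qed

section \<open>Coordinates with respect to an orthonormal basis\<close>

definition coords :: "'a measure \<Rightarrow> (nat \<Rightarrow> 'a \<Rightarrow> real) \<Rightarrow> ('a \<Rightarrow> real) \<Rightarrow> nat \<Rightarrow> real" where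
  "coords N \<phi> f = (\<lambda>k\<in>{1..}. L2_inner N f (\<phi> k))"

context
  fixes N :: "'a measure" and \<phi> :: "nat \<Rightarrow> 'a \<Rightarrow> real"
  assumes basis: "L2_orthonormal_basis N \<phi>"
begin

lemma basis_L2: "1 \<le> j \<Longrightarrow> \<phi> j \<in> L2 N"
  using basis by (auto simp: L2_orthonormal_basis_def)

lemma basis_inner: "1 \<le> j \<Longrightarrow> 1 \<le> k \<Longrightarrow> L2_inner N (\<phi> j) (\<phi> k) = (if j = k then 1 else 0)"
  using basis by (auto simp: L2_orthonormal_basis_def)

lemma filterlim_initial_segments:
  "filterlim (\<lambda>n. {1..n}) (finite_subsets_at_top {1..}) (sequentially :: nat filter)"
  unfolding filterlim_finite_subsets_at_top
proof safe
  fix X :: "nat set" assume X: "finite X" "X \<subseteq> {1..}"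
  show "\<forall>\<^sub>F n in sequentially. finite {1..n} \<and> X \<subseteq> {1..n} \<and> {1..n} \<subseteq> {1..}"
    using eventually_ge_at_top[of "Max (insert 0 X)"]
    by eventually_elim (use X in auto)
qed

lemma basis_expansion:
  assumes f: "f \<in> L2 N"
  shows "(\<lambda>n. L2_norm N (\<lambda>x. f x - (\<Sum>k\<in>{1..n}. L2_inner N f (\<phi> k) * \<phi> k x))) \<longlonglongrightarrow> 0"
proof -
  have "((\<lambda>F. L2_norm N (\<lambda>x. (\<Sum>k\<in>F. L2_inner N f (\<phi> k) * \<phi> k x) - f x)) \<longlongrightarrow> 0) (finite_subsets_at_top {1..})"
    using basis f by (simp add: L2_orthonormal_basis_def has_L2_sum_def)
  from filterlim_compose[OF this filterlim_initial_segments] show ?thesis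
    by (subst L2_norm_minus_commute) 
qed

lemma Parseval:
  assumes f: "f \<in> L2 N"
  shows "(\<lambda>n. \<Sum>k\<in>{1..n}. (L2_inner N f (\<phi> k))\<^sup>2) \<longlonglongrightarrow> L2_inner N f f"
proof -
  have eq: "(L2_norm N (\<lambda>x. f x - (\<Sum>k\<in>{1..n}. L2_inner N f (\<phi> k) * \<phi> k x)))\<^sup>2
      = L2_inner N f f - (\<Sum>k\<in>{1..n}. (L2_inner N f (\<phi> k))\<^sup>2)" for n
    by (subst L2_norm_square_diff_expansion) (auto simp: f basis_L2 basis_inner)
  have "(\<lambda>n. L2_inner N f f - (\<Sum>k\<in>{1..n}. (L2_inner N f (\<phi> k))\<^sup>2)) \<longlonglongrightarrow> 0"
    using tendsto_power[OF basis_expansion[OF f], of 2] unfolding eq by simp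
  from tendsto_diff[OF tendsto_const this] show ?thesis
    by (metis (no_types, lifting) diff_zero add_diff_cancel_left' diff_add_cancel diff_diff_eq2 ext)
qed

definition rational_combination :: "rat list \<Rightarrow> 'a \<Rightarrow> real" where
  "rational_combination q x = (\<Sum>k\<in>{1..length q}. of_rat (q ! (k - 1)) * \<phi> k x)"

lemma rational_combination_L2: "rational_combination q \<in> L2 N"
  unfolding rational_combination_def[abs_def] by (intro L2_sum L2_scale basis_L2) auto

text \<open>
  Truncating the expansion costs less than \<open>r / 2\<close>. Rounding each of the \<open>n\<close> remaining
  coefficients by less than \<open>r / (2 (n + 1))\<close> costs at most \<open>r / 2\<close>.
\<close>

lemma rational_combination_dense:
  assumes f: "f \<in> L2 N" and r: "r > 0"
  shows "\<exists>q. L2_norm N (\<lambda>x. f x - rational_combination q x) < r"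
proof -
  obtain n where n: "L2_norm N (\<lambda>x. f x - (\<Sum>k\<in>{1..n}. L2_inner N f (\<phi> k) * \<phi> k x)) < r / 2"
    using order_tendstoD(2)[OF basis_expansion[OF f], of "r / 2"] r
    by (auto simp: eventually_sequentially)
  have "\<exists>p. \<bar>L2_inner N f (\<phi> k) - of_rat p\<bar> < r / (2 * (real n + 1))" for k
  proof -
    let ?e = "r / (2 * (real n + 1))"
    have "0 < ?e" using r by simp
    then have "L2_inner N f (\<phi> k) - ?e < L2_inner N f (\<phi> k) + ?e" by linarith
    from of_rat_dense[OF this] show ?thesis by (metis abs_minus_commute abs_diff_less_iff)
  qed
  then obtain p where p: "\<And>k. \<bar>L2_inner N f (\<phi> k) - of_rat (p k)\<bar> < r / (2 * (real n + 1))" by metis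
  define q where "q = map (\<lambda>i. p (Suc i)) [0..<n]"
  have q: "rational_combination q x = (\<Sum>k\<in>{1..n}. of_rat (p k) * \<phi> k x)" for x
    unfolding rational_combination_def q_def by (intro sum.cong) (auto)
  let ?g = "\<lambda>x. \<Sum>k\<in>{1..n}. L2_inner N f (\<phi> k) * \<phi> k x"
  have g: "?g \<in> L2 N" by (intro L2_sum L2_scale basis_L2) auto
  have gq: "L2_norm N (\<lambda>x. ?g x - rational_combination q x) \<le> r / 2"
  proof (rule power2_le_imp_le)
    have "(L2_norm N (\<lambda>x. ?g x - rational_combination q x))\<^sup>2
        = (L2_norm N (\<lambda>x. 0 - (\<Sum>k\<in>{1..n}. (of_rat (p k) - L2_inner N f (\<phi> k)) * \<phi> k x)))\<^sup>2"
      by (simp add: q sum_subtractf left_diff_distrib)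
    also have "\<dots> = (\<Sum>k\<in>{1..n}. (of_rat (p k) - L2_inner N f (\<phi> k))\<^sup>2)"
      by (subst L2_norm_square_diff_expansion)
        (auto simp: L2_zero basis_L2 basis_inner L2_inner_zero_left intro!: sum.cong power2_commute)
    also have "\<dots> \<le> (\<Sum>k\<in>{1..n}. (r / (2 * (real n + 1)))\<^sup>2)"
      using p by (intro sum_mono) (metis abs_ge_zero abs_minus_commute less_imp_le power2_abs power_mono)
    also have "\<dots> = (r / 2)\<^sup>2 * (real n / (real n + 1)\<^sup>2)" 
      by (simp add: power_divide power_mult_distrib power2_eq_square field_simps)
    also have "\<dots> \<le> (r / 2)\<^sup>2 * 1"
      by (intro mult_left_mono) (auto simp: divide_le_eq_1 power2_eq_square algebra_simps)
    finally show "(L2_norm N (\<lambda>x. ?g x - rational_combination q x))\<^sup>2 \<le> (r / 2)\<^sup>2" by simp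
  qed (use r in simp)
  have "L2_norm N (\<lambda>x. f x - rational_combination q x) < r"
    using L2_dist_triangle[OF f g rational_combination_L2, of q] n gq by linarith
  then show ?thesis by blast
qed

lemma coords_space: "coords N \<phi> \<in> L2 N \<rightarrow> space (\<Pi>\<^sub>M k\<in>{1..}. borel)"
  by (auto simp: coords_def space_PiM)

lemma measurable_coords: "coords N \<phi> \<in> L2_borel N \<rightarrow>\<^sub>M (\<Pi>\<^sub>M k\<in>{1..}. borel)"
  unfolding coords_def[abs_def]
  by (rule measurable_restrict) (auto intro!: measurable_L2_inner basis_L2)

text \<open>
  Every open set is a countable union of balls with rational radius around rational combinations of
  basis vectors, and by Parseval's identity membership in such a ball is a measurable condition on the
  sequence of coordinates. Measurability and independence of \<open>L\<^sup>2\<close>-valued maps thereby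
  become statements about sequences of real random variables.
\<close>

lemma sets_L2_borel_coords:
  "sets (L2_borel N) = sets (vimage_algebra (L2 N) (coords N \<phi>) (\<Pi>\<^sub>M k\<in>{1..}. borel))" (is "_ = sets ?V")
proof
  show "sets ?V \<subseteq> sets (L2_borel N)"
    using measurable_sets[OF measurable_coords]
    unfolding sets_vimage_algebra2[OF coords_space] by fastforce
  have inner: "(\<lambda>f. L2_inner N f (\<phi> k)) \<in> borel_measurable ?V" if "1 \<le> k" for k
  proof -
    have "(\<lambda>f. coords N \<phi> f k) \<in> borel_measurable ?V"
      using measurable_compose[OF measurable_vimage_algebra1[OF coords_space] measurable_component_singleton] that
      by auto
    then show ?thesis using that by (simp add: coords_def)
  qed
  have dist: "(\<lambda>f. (L2_norm N (\<lambda>x. f x - rational_combination q x))\<^sup>2) \<in> borel_measurable ?V" for q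
  proof -
    have "(\<lambda>f. L2_inner N f f) \<in> borel_measurable ?V"
    proof (rule borel_measurable_LIMSEQ_metric)
      show "(\<lambda>n. \<Sum>k\<in>{1..n}. (L2_inner N f (\<phi> k))\<^sup>2) \<longlonglongrightarrow> L2_inner N f f" if "f \<in> space ?V" for f
        using Parseval that by simp
      show "(\<lambda>f. \<Sum>k\<in>{1..n}. (L2_inner N f (\<phi> k))\<^sup>2) \<in> borel_measurable ?V" for n
        by (intro borel_measurable_sum borel_measurable_power inner) simp
    qed
    then have quad: "(\<lambda>f. L2_inner N f f - (\<Sum>k\<in>{1..length q}. (L2_inner N f (\<phi> k))\<^sup>2)
        + (\<Sum>k\<in>{1..length q}. (L2_inner N f (\<phi> k) - of_rat (q ! (k - 1)))\<^sup>2)) \<in> borel_measurable ?V"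
      using inner by auto
    have eq: "(L2_norm N (\<lambda>x. f x - rational_combination q x))\<^sup>2
        = L2_inner N f f - (\<Sum>k\<in>{1..length q}. (L2_inner N f (\<phi> k))\<^sup>2)
        + (\<Sum>k\<in>{1..length q}. (L2_inner N f (\<phi> k) - of_rat (q ! (k - 1)))\<^sup>2)" if "f \<in> L2 N" for f
      unfolding rational_combination_def
      by (subst L2_norm_square_diff_expansion) (auto simp: that basis_L2 basis_inner)
    show ?thesis
      by (rule measurable_cong[THEN iffD2, OF _ quad]) (rule eq, simp)
  qed
  have ball: "{f \<in> L2 N. L2_norm N (\<lambda>x. f x - rational_combination q x) < of_rat r} \<in> sets ?V" if "0 < r" for q r
  proof -
    have "{f \<in> space ?V. (L2_norm N (\<lambda>x. f x - rational_combination q x))\<^sup>2 < (of_rat r)\<^sup>2} \<in> sets ?V"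
      using dist[of q] by measurable
    also have "{f \<in> space ?V. (L2_norm N (\<lambda>x. f x - rational_combination q x))\<^sup>2 < (of_rat r)\<^sup>2}
        = {f \<in> L2 N. L2_norm N (\<lambda>x. f x - rational_combination q x) < of_rat r}"
    proof -
      have "(L2_norm N h)\<^sup>2 < (real_of_rat r)\<^sup>2 \<longleftrightarrow> L2_norm N h < of_rat r" for h :: "'a \<Rightarrow> real"
        using power_mono_iff[of "real_of_rat r" "L2_norm N h" 2] that L2_norm_nonneg[of N h]
        by (simp flip: not_le)
      then show ?thesis by simp
    qed
    finally show ?thesis .
  qed
  have "G \<in> sets ?V" if G: "L2_open N G" for G
  proof -
    \<comment> \<open>There are only countably many pairs \<open>(q, r)\<close>, so this union may range over all suitable ones.\<close>
    let ?B = "\<lambda>(q, r). {f \<in> L2 N. L2_norm N (\<lambda>x. f x - rational_combination q x) < real_of_rat r}"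
    let ?I = "{p. 0 < snd p \<and> ?B p \<subseteq> G}"
    have "G = (\<Union>p\<in>?I. ?B p)"
    proof
      show "G \<subseteq> (\<Union>p\<in>?I. ?B p)"
      proof
        fix f assume f: "f \<in> G"
        then have f2: "f \<in> L2 N" using G by (auto simp: L2_open_def)
        obtain e where e: "e > 0" "\<And>g. g \<in> L2 N \<Longrightarrow> L2_norm N (\<lambda>x. g x - f x) < e \<Longrightarrow> g \<in> G"
          using G f by (auto simp: L2_open_def)
        obtain r where r: "0 < real_of_rat r" "real_of_rat r < e / 2"
          using of_rat_dense[of 0 "e / 2"] e by auto
        obtain q where q: "L2_norm N (\<lambda>x. f x - rational_combination q x) < of_rat r"
          using rational_combination_dense[OF f2 r(1)] by blast
        have "g \<in> G" if g: "g \<in> ?B (q, r)" for g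
        proof (rule e(2))
          show "L2_norm N (\<lambda>x. g x - f x) < e"
            using L2_dist_triangle[OF _ rational_combination_L2 f2, of g q] g q r
              L2_norm_minus_commute[of N f "rational_combination q"] by auto
        qed (use g in simp)
        then have "(q, r) \<in> ?I" using r by auto
        moreover have "f \<in> ?B (q, r)" using f2 q by simp
        ultimately show "f \<in> (\<Union>p\<in>?I. ?B p)" by blast
      qed
    qed auto
    moreover have "(\<Union>p\<in>?I. ?B p) \<in> sets ?V"
      by (rule sets.countable_UN') (auto intro: ball simp del: One_nat_def)
    ultimately show ?thesis by simp
  qed
  then show "sets (L2_borel N) \<subseteq> sets ?V"
    unfolding sets_L2_borel using sets.sigma_sets_subset[of "{G. L2_open N G}" ?V] by auto
qed

lemma measurable_L2_borelI:
  assumes "\<And>\<omega>. \<omega> \<in> space M \<Longrightarrow> Z \<omega> \<in> L2 N"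
    and "\<And>k. 1 \<le> k \<Longrightarrow> (\<lambda>\<omega>. L2_inner N (Z \<omega>) (\<phi> k)) \<in> borel_measurable M"
  shows "Z \<in> M \<rightarrow>\<^sub>M L2_borel N"
proof -
  have "Z \<in> M \<rightarrow>\<^sub>M vimage_algebra (L2 N) (coords N \<phi>) (\<Pi>\<^sub>M k\<in>{1..}. borel)"
  proof (rule measurable_vimage_algebra2)
    show "(\<lambda>\<omega>. coords N \<phi> (Z \<omega>)) \<in> M \<rightarrow>\<^sub>M (\<Pi>\<^sub>M k\<in>{1..}. borel)"
      unfolding coords_def by (rule measurable_restrict) (use assms in auto)
  qed (use assms in auto)
  then show ?thesis
    by (rule measurable_cong_sets[THEN equalityD1, THEN subsetD, OF refl, rotated])
      (simp add: sets_L2_borel_coords)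
qed

lemma sets_L2_borel_imp_coords:
  assumes "A \<in> sets (L2_borel N)"
  obtains A' where "A' \<in> sets (\<Pi>\<^sub>M k\<in>{1::nat..}. borel)" "A = {f \<in> L2 N. coords N \<phi> f \<in> A'}"
  using assms unfolding sets_L2_borel_coords sets_vimage_algebra2[OF coords_space] by blast

end

section \<open>The chi-square comparison of measures\<close>

text \<open>
  For probability measures this says that \<open>1 + \<chi>\<^sup>2(P \<parallel> Q)\<close> is at most \<open>K\<close>, since the optimal
  \<open>f\<close> is the density of \<open>P\<close> with respect to \<open>Q\<close>. The form without densities passes
  to products and to mixtures by iterated integration.
\<close>

definition chi2_dominated :: "real \<Rightarrow> 'a measure \<Rightarrow> 'a measure \<Rightarrow> bool" where
  "chi2_dominated K P Q \<longleftrightarrow> sets P = sets Q \<and>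
     (\<forall>f\<in>borel_measurable P. (\<integral>\<^sup>+x. f x \<partial>P)\<^sup>2 \<le> ennreal K * (\<integral>\<^sup>+x. (f x)\<^sup>2 \<partial>Q))"

lemma chi2_dominated_measure:
  assumes "chi2_dominated K P Q" "A \<in> sets P" "prob_space P" "prob_space Q" "0 \<le> K"
  shows "(measure P A)\<^sup>2 \<le> K * measure Q A"
proof -
  interpret P: prob_space P by fact
  interpret Q: prob_space Q by fact
  have sets: "sets P = sets Q" using assms by (simp add: chi2_dominated_def)
  have "indicator A \<in> borel_measurable P" using assms(2) by simp
  then have "(\<integral>\<^sup>+x. indicator A x \<partial>P)\<^sup>2 \<le> ennreal K * (\<integral>\<^sup>+x. (indicator A x)\<^sup>2 \<partial>Q)"
    using assms(1) unfolding chi2_dominated_def by blast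
  also have "(\<lambda>x. (indicator A x :: ennreal)\<^sup>2) = indicator A"
    by (auto simp: indicator_def)
  finally have "ennreal ((measure P A)\<^sup>2) \<le> ennreal (K * measure Q A)"
    using assms(2,5) sets
    by (simp add: P.emeasure_eq_measure Q.emeasure_eq_measure ennreal_power ennreal_mult)
  then show ?thesis using assms(5) by (subst (asm) ennreal_le_iff) auto
qed

text \<open>
  A mixture of laws is compared by comparing its components and applying this inequality to the mixing
  measure.
\<close>

lemma nn_integral_square_le:
  assumes "prob_space P" "f \<in> borel_measurable P"
  shows "(\<integral>\<^sup>+x. f x \<partial>P)\<^sup>2 \<le> (\<integral>\<^sup>+x. (f x)\<^sup>2 \<partial>P)"
  using Cauchy_Schwarz_nn_integral[OF assms(2), of "\<lambda>_. 1"] prob_space.emeasure_space_1[OF assms(1)]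
  by simp

text \<open>
  After splitting off one factor, the comparison for the remaining factors is applied to the function
  that integrates this factor out, and the comparison for one factor to its values. So the constants
  multiply.
\<close>

lemma chi2_dominated_PiM:
  fixes P Q :: "'a measure"
  assumes PQ: "chi2_dominated K P Q" and K: "0 \<le> K" and P: "prob_space P" and Q: "prob_space Q"
    and I: "finite I"
  shows "chi2_dominated (K ^ card I) (\<Pi>\<^sub>M i\<in>I. P) (\<Pi>\<^sub>M i\<in>I. Q)"
proof -
  interpret P: prob_space P by fact
  interpret Q: prob_space Q by fact
  interpret PP: product_sigma_finite "\<lambda>_. P" by unfold_locales
  interpret QQ: product_sigma_finite "\<lambda>_. Q" by unfold_locales
  have sets: "sets P = sets Q" using PQ by (simp add: chi2_dominated_def)
  have setsI: "sets (\<Pi>\<^sub>M i\<in>I. P) = sets (\<Pi>\<^sub>M i\<in>I. Q)" for I :: "'i set"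
    by (rule sets_PiM_cong) (auto simp: sets)
  have "(\<integral>\<^sup>+x. f x \<partial>(\<Pi>\<^sub>M i\<in>I. P))\<^sup>2 \<le> ennreal (K ^ card I) * (\<integral>\<^sup>+x. (f x)\<^sup>2 \<partial>(\<Pi>\<^sub>M i\<in>I. Q))"
    if "f \<in> borel_measurable (\<Pi>\<^sub>M i\<in>I. P)" for f
    using I that
  proof (induction I arbitrary: f rule: finite_induct)
    case empty
    then show ?case by (simp add: PP.nn_integral_empty QQ.nn_integral_empty)
  next
    case (insert i I)
    have fP [measurable]: "f \<in> borel_measurable (\<Pi>\<^sub>M i\<in>insert i I. P)" by fact
    have fQ [measurable]: "f \<in> borel_measurable (\<Pi>\<^sub>M i\<in>insert i I. Q)"
      using fP measurable_cong_sets[OF setsI refl] by blast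
    have upd: "(\<lambda>(x, y). x(i := y)) \<in> (\<Pi>\<^sub>M i\<in>I. P) \<Otimes>\<^sub>M P \<rightarrow>\<^sub>M (\<Pi>\<^sub>M i\<in>insert i I. P)"
      by (rule measurable_add_dim)
    have fx: "(\<lambda>y. f (x(i := y))) \<in> borel_measurable P" if "x \<in> space (\<Pi>\<^sub>M i\<in>I. P)" for x
      using measurable_compose[OF measurable_compose[OF measurable_Pair1'[OF that] upd] fP] by simp
    have gP: "(\<lambda>x. \<integral>\<^sup>+y. f (x(i := y)) \<partial>P) \<in> borel_measurable (\<Pi>\<^sub>M i\<in>I. P)"
      using measurable_compose[OF upd fP] by (intro P.borel_measurable_nn_integral) (simp add: case_prod_beta')
    have updQ: "(\<lambda>(x, y). x(i := y)) \<in> (\<Pi>\<^sub>M i\<in>I. Q) \<Otimes>\<^sub>M Q \<rightarrow>\<^sub>M (\<Pi>\<^sub>M i\<in>insert i I. Q)"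
      by (rule measurable_add_dim)
    have gQ: "(\<lambda>x. \<integral>\<^sup>+y. (f (x(i := y)))\<^sup>2 \<partial>Q) \<in> borel_measurable (\<Pi>\<^sub>M i\<in>I. Q)"
      using measurable_compose[OF updQ fQ] by (intro Q.borel_measurable_nn_integral) (simp add: case_prod_beta')
    have "(\<integral>\<^sup>+x. f x \<partial>(\<Pi>\<^sub>M i\<in>insert i I. P))\<^sup>2 = (\<integral>\<^sup>+x. (\<integral>\<^sup>+y. f (x(i := y)) \<partial>P) \<partial>(\<Pi>\<^sub>M i\<in>I. P))\<^sup>2"
      using insert by (subst PP.product_nn_integral_insert) auto
    also have "\<dots> \<le> ennreal (K ^ card I) * (\<integral>\<^sup>+x. (\<integral>\<^sup>+y. f (x(i := y)) \<partial>P)\<^sup>2 \<partial>(\<Pi>\<^sub>M i\<in>I. Q))"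
      by (rule insert.IH[OF gP])
    also have "\<dots> \<le> ennreal (K ^ card I) * (\<integral>\<^sup>+x. ennreal K * (\<integral>\<^sup>+y. (f (x(i := y)))\<^sup>2 \<partial>Q) \<partial>(\<Pi>\<^sub>M i\<in>I. Q))"
      using PQ fx sets_eq_imp_space_eq[OF setsI]
      by (intro mult_left_mono nn_integral_mono) (auto simp: chi2_dominated_def)
    also have "\<dots> = ennreal (K ^ card I) * (ennreal K * (\<integral>\<^sup>+x. (f x)\<^sup>2 \<partial>(\<Pi>\<^sub>M i\<in>insert i I. Q)))"
      using insert by (subst nn_integral_cmult[OF gQ]) (simp add: QQ.product_nn_integral_insert)
    also have "\<dots> = ennreal (K ^ card (insert i I)) * (\<integral>\<^sup>+x. (f x)\<^sup>2 \<partial>(\<Pi>\<^sub>M i\<in>insert i I. Q))"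
      using insert K by (simp add: ennreal_mult ac_simps)
    finally show ?case .
  qed
  then show ?thesis using setsI by (auto simp: chi2_dominated_def)
qed

lemma normal_density_square_div:
  assumes "0 < \<sigma>"
  shows "(normal_density a \<sigma> x)\<^sup>2 / normal_density b \<sigma> x
    = exp ((a - b)\<^sup>2 / \<sigma>\<^sup>2) * normal_density (2 * a - b) \<sigma> x"
proof -
  let ?k = "1 / sqrt (2 * pi * \<sigma>\<^sup>2)"
  have k: "?k > 0" using assms by simp
  let ?e = "\<lambda>a. - (x - a)\<^sup>2 / (2 * \<sigma>\<^sup>2)"
  have e: "?e a + ?e a - ?e b = (a - b)\<^sup>2 / \<sigma>\<^sup>2 + ?e (2 * a - b)"
    using assms by (simp add: field_simps power2_eq_square)
  have "(normal_density a \<sigma> x)\<^sup>2 / normal_density b \<sigma> x = (?k * exp (?e a))\<^sup>2 / (?k * exp (?e b))"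
    unfolding normal_density_def ..
  also have "\<dots> = ?k * exp (?e a + ?e a - ?e b)"
  proof -
    have "(k * A)\<^sup>2 / (k * B) = k * (A * A / B)" if "k > 0" for k A B :: real
      using that by (simp add: power2_eq_square)
    from this[OF k] show ?thesis unfolding exp_diff exp_add .
  qed
  also have "\<dots> = ?k * exp ((a - b)\<^sup>2 / \<sigma>\<^sup>2 + ?e (2 * a - b))"
    unfolding e ..
  finally show ?thesis unfolding exp_add normal_density_def by simp
qed

text \<open>
  Cauchy-Schwarz for the functions \<open>f \<surd>q\<close> and \<open>p / \<surd>q\<close>, where \<open>p\<close> and \<open>q\<close> are the two
  densities. The quotient \<open>p\<^sup>2 / q\<close> is again a multiple of a normal density, now with mean
  \<open>2 * a - b\<close>.
\<close>

lemma chi2_dominated_normal: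
  assumes \<sigma>: "0 < \<sigma>"
  shows "chi2_dominated (exp ((a - b)\<^sup>2 / \<sigma>\<^sup>2))
    (density lborel (normal_density a \<sigma>)) (density lborel (normal_density b \<sigma>))"
  unfolding chi2_dominated_def
proof (intro conjI ballI)
  fix f :: "real \<Rightarrow> ennreal" assume "f \<in> borel_measurable (density lborel (normal_density a \<sigma>))"
  then have [measurable]: "f \<in> borel_measurable borel" by simp
  let ?p = "\<lambda>a. normal_density a \<sigma>"
  have pos: "?p c x > 0" for c x using \<sigma> by (rule normal_density_pos)
  have eq: "(\<integral>\<^sup>+x. f x \<partial>density lborel (?p a))
      = (\<integral>\<^sup>+x. (f x * ennreal (sqrt (?p b x))) * ennreal (?p a x / sqrt (?p b x)) \<partial>lborel)"
  proof (subst nn_integral_density, measurable, intro nn_integral_cong)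
    fix x :: real
    have "ennreal (?p a x) = ennreal (sqrt (?p b x)) * ennreal (?p a x / sqrt (?p b x))"
      using pos[of b x] pos[of a x] by (simp add: less_imp_le flip: ennreal_mult)
    then show "ennreal (?p a x) * f x
        = f x * ennreal (sqrt (?p b x)) * ennreal (?p a x / sqrt (?p b x))"
      by (simp add: ac_simps)
  qed
  have "(\<integral>\<^sup>+x. f x \<partial>density lborel (?p a))\<^sup>2 \<le> (\<integral>\<^sup>+x. (f x * ennreal (sqrt (?p b x)))\<^sup>2 \<partial>lborel)
      * (\<integral>\<^sup>+x. (ennreal (?p a x / sqrt (?p b x)))\<^sup>2 \<partial>lborel)"
    unfolding eq by (rule Cauchy_Schwarz_nn_integral) auto
  also have "(\<integral>\<^sup>+x. (f x * ennreal (sqrt (?p b x)))\<^sup>2 \<partial>lborel) = (\<integral>\<^sup>+x. (f x)\<^sup>2 \<partial>density lborel (?p b))"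
    using less_imp_le[OF pos]
    by (subst nn_integral_density) (auto simp: power_mult_distrib ennreal_power ac_simps intro!: nn_integral_cong)
  also have "(\<integral>\<^sup>+x. (ennreal (?p a x / sqrt (?p b x)))\<^sup>2 \<partial>lborel)
      = (\<integral>\<^sup>+x. ennreal (exp ((a - b)\<^sup>2 / \<sigma>\<^sup>2)) * ennreal (?p (2 * a - b) x) \<partial>lborel)"
    using less_imp_le[OF pos]
    by (intro nn_integral_cong)
      (simp add: ennreal_power power_divide normal_density_square_div[OF \<sigma>] flip: ennreal_mult)
  also have "\<dots> = ennreal (exp ((a - b)\<^sup>2 / \<sigma>\<^sup>2))"
    using less_imp_le[OF pos] by (subst nn_integral_cmult)
      (auto simp: nn_integral_eq_integral integrable_normal_density[OF \<sigma>] integral_normal_density[OF \<sigma>])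
  finally show "(\<integral>\<^sup>+x. f x \<partial>density lborel (?p a))\<^sup>2
      \<le> ennreal (exp ((a - b)\<^sup>2 / \<sigma>\<^sup>2)) * (\<integral>\<^sup>+x. (f x)\<^sup>2 \<partial>density lborel (?p b))"
    by (simp add: mult.commute)
qed simp

section \<open>Independence from characteristic functions\<close>

lemma (in prob_space) distr_pair_indep:
  assumes [measurable]: "Z\<^sub>1 \<in> M \<rightarrow>\<^sub>M N\<^sub>1" "Z\<^sub>2 \<in> M \<rightarrow>\<^sub>M N\<^sub>2"
    and indep: "\<And>A B. A \<in> sets N\<^sub>1 \<Longrightarrow> B \<in> sets N\<^sub>2 \<Longrightarrow>
      prob (Z\<^sub>1 -` A \<inter> space M \<inter> (Z\<^sub>2 -` B \<inter> space M)) = prob (Z\<^sub>1 -` A \<inter> space M) * prob (Z\<^sub>2 -` B \<inter> space M)"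
  shows "distr M (N\<^sub>1 \<Otimes>\<^sub>M N\<^sub>2) (\<lambda>\<omega>. (Z\<^sub>1 \<omega>, Z\<^sub>2 \<omega>)) = distr M N\<^sub>1 Z\<^sub>1 \<Otimes>\<^sub>M distr M N\<^sub>2 Z\<^sub>2"
proof (rule sym, rule pair_measure_eqI)
  interpret D1: prob_space "distr M N\<^sub>1 Z\<^sub>1" by (rule prob_space_distr) simp
  interpret D2: prob_space "distr M N\<^sub>2 Z\<^sub>2" by (rule prob_space_distr) simp
  show "sigma_finite_measure (distr M N\<^sub>1 Z\<^sub>1)" "sigma_finite_measure (distr M N\<^sub>2 Z\<^sub>2)"
    by unfold_locales
  fix A B assume A: "A \<in> sets (distr M N\<^sub>1 Z\<^sub>1)" and B: "B \<in> sets (distr M N\<^sub>2 Z\<^sub>2)"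
  have "(\<lambda>\<omega>. (Z\<^sub>1 \<omega>, Z\<^sub>2 \<omega>)) -` (A \<times> B) \<inter> space M = Z\<^sub>1 -` A \<inter> space M \<inter> (Z\<^sub>2 -` B \<inter> space M)" by auto
  then show "emeasure (distr M N\<^sub>1 Z\<^sub>1) A * emeasure (distr M N\<^sub>2 Z\<^sub>2) B
      = emeasure (distr M (N\<^sub>1 \<Otimes>\<^sub>M N\<^sub>2) (\<lambda>\<omega>. (Z\<^sub>1 \<omega>, Z\<^sub>2 \<omega>))) (A \<times> B)"
    using A B indep[of A B] by (simp add: emeasure_distr emeasure_eq_measure ennreal_mult)
qed simp

text \<open>
  Adding a constant to \<open>g\<close> changes neither hypothesis nor conclusion, so \<open>g\<close> may be assumed
  positive and, after normalisation, the density of a second probability measure. The hypothesis says that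
  \<open>\<zeta>\<close> has the same characteristic function under both measures, and Levy's uniqueness theorem
  identifies its two laws.
\<close>

lemma (in prob_space) expectation_indicator_of_char_real:
  fixes g \<zeta> :: "'a \<Rightarrow> real"
  assumes g [measurable]: "g \<in> borel_measurable M" and bound: "\<And>\<omega>. \<bar>g \<omega>\<bar> \<le> C"
    and \<zeta> [measurable]: "\<zeta> \<in> borel_measurable M"
    and ch: "\<And>t. (\<integral>\<omega>. of_real (g \<omega>) * iexp (t * \<zeta> \<omega>) \<partial>M)
        = of_real (expectation g) * (\<integral>\<omega>. iexp (t * \<zeta> \<omega>) \<partial>M)"
    and A [measurable]: "A \<in> sets borel"
  shows "(\<integral>\<omega>. g \<omega> * indicator A (\<zeta> \<omega>) \<partial>M) = expectation g * prob (\<zeta> -` A \<inter> space M)"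
proof -
  define h where "h = (\<lambda>\<omega>. g \<omega> + (C + 1))"
  have h1: "1 \<le> h \<omega>" for \<omega> using bound[of \<omega>] by (simp add: h_def)
  have [measurable]: "h \<in> borel_measurable M" unfolding h_def by measurable
  have ig: "integrable M g" by (rule integrable_const_bound[of _ C]) (use bound in auto)
  have ih: "integrable M h" unfolding h_def using ig by simp
  define m where "m = expectation h"
  have m: "m = expectation g + (C + 1)" unfolding m_def h_def using ig by (simp add: prob_space)
  have m1: "1 \<le> m"
    unfolding m_def using integral_mono[OF _ ih, of "\<lambda>_. 1"] h1 by (simp add: prob_space)
  define Q where "Q = density M (\<lambda>\<omega>. ennreal (h \<omega> / m))"
  have nn: "0 \<le> h \<omega> / m" for \<omega> using h1[of \<omega>] m1 by simp
  have Q: "prob_space Q"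
  proof (rule prob_spaceI)
    have "emeasure Q (space Q) = (\<integral>\<^sup>+\<omega>. ennreal (h \<omega> / m) \<partial>M)"
      by (simp add: Q_def emeasure_density cong: nn_integral_cong)
    also have "\<dots> = ennreal (\<integral>\<omega>. h \<omega> / m \<partial>M)"
      using nn ih by (intro nn_integral_eq_integral) auto
    finally show "emeasure Q (space Q) = 1" using m1 by (simp add: m_def[symmetric])
  qed
  interpret Q: prob_space Q by fact
  have \<zeta>Q [measurable]: "\<zeta> \<in> borel_measurable Q" by (simp add: Q_def)
  have "distr Q borel \<zeta> = distr M borel \<zeta>"
  proof (rule Levy_uniqueness)
    show "real_distribution (distr Q borel \<zeta>)" by (rule Q.real_distribution_distr) simp
    show "real_distribution (distr M borel \<zeta>)" by (rule real_distribution_distr) simp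
    show "char (distr Q borel \<zeta>) = char (distr M borel \<zeta>)"
    proof
      fix t
      have i1: "integrable M (\<lambda>\<omega>. of_real (g \<omega>) * iexp (t * \<zeta> \<omega>))"
        by (rule integrable_const_bound[of _ C]) (use bound in \<open>auto simp: norm_mult\<close>)
      have i2: "integrable M (\<lambda>\<omega>. iexp (t * \<zeta> \<omega>))"
        by (rule integrable_const_bound[of _ 1]) auto
      have "char (distr Q borel \<zeta>) t = (\<integral>\<omega>. iexp (t * \<zeta> \<omega>) \<partial>Q)"
        unfolding char_def by (subst integral_distr) auto
      also have "\<dots> = (\<integral>\<omega>. (h \<omega> / m) *\<^sub>R iexp (t * \<zeta> \<omega>) \<partial>M)"
        unfolding Q_def by (rule integral_density) (use nn in auto)
      also have "\<dots> = (\<integral>\<omega>. (of_real (g \<omega>) * iexp (t * \<zeta> \<omega>) + of_real (C + 1) * iexp (t * \<zeta> \<omega>)) / of_real m \<partial>M)"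
        by (intro Bochner_Integration.integral_cong) (auto simp: h_def scaleR_conv_of_real add_divide_distrib distrib_right)
      also have "\<dots> = ((\<integral>\<omega>. of_real (g \<omega>) * iexp (t * \<zeta> \<omega>) \<partial>M) + of_real (C + 1) * (\<integral>\<omega>. iexp (t * \<zeta> \<omega>) \<partial>M)) / of_real m"
        using i1 i2 by simp
      also have "\<dots> = (\<integral>\<omega>. iexp (t * \<zeta> \<omega>) \<partial>M) * (of_real m / of_real m)"
      proof -
        have "of_real m = (of_real (expectation g) + of_real (C + 1) :: complex)"
          unfolding m by simp
        then show ?thesis
          unfolding ch by (simp only: distrib_right[symmetric] times_divide_eq_right) (simp only: mult.commute)
      qed
      also have "\<dots> = char (distr M borel \<zeta>) t"
        unfolding char_def using m1 by (subst integral_distr) auto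
      finally show "char (distr Q borel \<zeta>) t = char (distr M borel \<zeta>) t" .
    qed
  qed
  then have "(\<integral>x. indicator A x \<partial>distr Q borel \<zeta>) = (\<integral>x. indicator A x \<partial>distr M borel \<zeta> :: real)" by simp
  then have "(\<integral>\<omega>. indicator A (\<zeta> \<omega>) \<partial>Q) = (\<integral>\<omega>. indicator A (\<zeta> \<omega>) \<partial>M :: real)"
    by (subst (asm) (1 2) integral_distr) auto
  also have "(\<integral>\<omega>. indicator A (\<zeta> \<omega>) \<partial>Q) = (\<integral>\<omega>. (h \<omega> / m) *\<^sub>R indicator A (\<zeta> \<omega>) \<partial>M :: real)"
    unfolding Q_def by (rule integral_density) (use nn in auto)
  also have "\<dots> = (\<integral>\<omega>. (g \<omega> * indicator A (\<zeta> \<omega>) + (C + 1) * indicator A (\<zeta> \<omega>)) / m \<partial>M)"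
    by (intro Bochner_Integration.integral_cong) (auto simp: h_def field_simps)
  also have "\<dots> = ((\<integral>\<omega>. g \<omega> * indicator A (\<zeta> \<omega>) \<partial>M) + (C + 1) * (\<integral>\<omega>. indicator A (\<zeta> \<omega>) \<partial>M)) / m"
  proof -
    have "integrable M (\<lambda>\<omega>. g \<omega> * indicator A (\<zeta> \<omega>))"
      by (rule integrable_const_bound[of _ C]) (use bound order_trans[OF abs_ge_zero bound] in \<open>auto simp: indicator_def\<close>)
    moreover have "integrable M (\<lambda>\<omega>. indicator A (\<zeta> \<omega>) :: real)"
      by (rule integrable_const_bound[of _ 1]) (auto simp: indicator_def)
    ultimately show ?thesis by simp
  qed
  finally have "(\<integral>\<omega>. g \<omega> * indicator A (\<zeta> \<omega>) \<partial>M) = expectation g * (\<integral>\<omega>. indicator A (\<zeta> \<omega>) \<partial>M)"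
    using m1 unfolding m by (simp add: field_simps)
  also have "(\<integral>\<omega>. indicator A (\<zeta> \<omega>) \<partial>M) = (\<integral>\<omega>. indicator (\<zeta> -` A \<inter> space M) \<omega> \<partial>M :: real)"
    by (intro Bochner_Integration.integral_cong) (auto simp: indicator_def)
  also have "\<dots> = prob (\<zeta> -` A \<inter> space M)" by simp
  finally show ?thesis .
qed

lemma borel_measurable_cnj [measurable]: "cnj \<in> borel_measurable borel"
  by (intro borel_measurable_continuous_onI continuous_intros)

text \<open>
  The hypothesis holds for all \<open>t\<close>, hence also at \<open>- t\<close>, and conjugation transfers it from
  \<open>g\<close> to its conjugate. Real and imaginary part of \<open>g\<close> are combinations of these two functions.
\<close>

lemma (in prob_space) expectation_indicator_of_char:
  fixes g :: "'a \<Rightarrow> complex" and \<zeta> :: "'a \<Rightarrow> real"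
  assumes g [measurable]: "g \<in> borel_measurable M" and bound: "\<And>\<omega>. norm (g \<omega>) \<le> C"
    and \<zeta> [measurable]: "\<zeta> \<in> borel_measurable M"
    and ch: "\<And>t. (\<integral>\<omega>. g \<omega> * iexp (t * \<zeta> \<omega>) \<partial>M) = (\<integral>\<omega>. g \<omega> \<partial>M) * (\<integral>\<omega>. iexp (t * \<zeta> \<omega>) \<partial>M)"
    and A [measurable]: "A \<in> sets borel"
  shows "(\<integral>\<omega>. g \<omega> * indicator A (\<zeta> \<omega>) \<partial>M) = (\<integral>\<omega>. g \<omega> \<partial>M) * of_real (prob (\<zeta> -` A \<inter> space M))"
proof -
  have ig: "integrable M g" by (rule integrable_const_bound[of _ C]) (use bound in auto)
  have igt: "integrable M (\<lambda>\<omega>. g \<omega> * iexp (t * \<zeta> \<omega>))" for t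
    by (rule integrable_const_bound[of _ C]) (use bound in \<open>auto simp: norm_mult\<close>)
  have icgt: "integrable M (\<lambda>\<omega>. cnj (g \<omega>) * iexp (t * \<zeta> \<omega>))" for t
    by (rule integrable_const_bound[of _ C]) (use bound in \<open>auto simp: norm_mult\<close>)
  have chc: "(\<integral>\<omega>. cnj (g \<omega>) * iexp (t * \<zeta> \<omega>) \<partial>M) = cnj (\<integral>\<omega>. g \<omega> \<partial>M) * (\<integral>\<omega>. iexp (t * \<zeta> \<omega>) \<partial>M)" for t
  proof -
    have c: "iexp (t * x) = cnj (iexp (- t * x))" for x :: real by (simp add: exp_cnj)
    have "(\<integral>\<omega>. cnj (g \<omega>) * iexp (t * \<zeta> \<omega>) \<partial>M) = (\<integral>\<omega>. cnj (g \<omega> * iexp (- t * \<zeta> \<omega>)) \<partial>M)"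
      unfolding c complex_cnj_mult ..
    also have "\<dots> = cnj ((\<integral>\<omega>. g \<omega> \<partial>M) * (\<integral>\<omega>. iexp (- t * \<zeta> \<omega>) \<partial>M))"
      unfolding Bochner_Integration.integral_cnj ch ..
    also have "\<dots> = cnj (\<integral>\<omega>. g \<omega> \<partial>M) * (\<integral>\<omega>. iexp (t * \<zeta> \<omega>) \<partial>M)"
      unfolding c complex_cnj_mult Bochner_Integration.integral_cnj ..
    finally show ?thesis .
  qed
  have re: "(\<integral>\<omega>. Re (g \<omega>) * indicator A (\<zeta> \<omega>) \<partial>M) = (\<integral>\<omega>. Re (g \<omega>) \<partial>M) * prob (\<zeta> -` A \<inter> space M)"
  proof (rule expectation_indicator_of_char_real[where C = C])
    fix t
    have "(\<integral>\<omega>. of_real (Re (g \<omega>)) * iexp (t * \<zeta> \<omega>) \<partial>M)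
        = (\<integral>\<omega>. (g \<omega> * iexp (t * \<zeta> \<omega>) + cnj (g \<omega>) * iexp (t * \<zeta> \<omega>)) / 2 \<partial>M)"
      unfolding distrib_right[symmetric] complex_add_cnj by simp
    also have "\<dots> = ((\<integral>\<omega>. g \<omega> * iexp (t * \<zeta> \<omega>) \<partial>M) + (\<integral>\<omega>. cnj (g \<omega>) * iexp (t * \<zeta> \<omega>) \<partial>M)) / 2"
      using igt icgt by simp
    also have "\<dots> = ((\<integral>\<omega>. g \<omega> \<partial>M) + cnj (\<integral>\<omega>. g \<omega> \<partial>M)) / 2 * (\<integral>\<omega>. iexp (t * \<zeta> \<omega>) \<partial>M)"
      unfolding ch chc by (simp add: algebra_simps)
    also have "((\<integral>\<omega>. g \<omega> \<partial>M) + cnj (\<integral>\<omega>. g \<omega> \<partial>M)) / 2 = of_real (\<integral>\<omega>. Re (g \<omega>) \<partial>M)"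
      unfolding complex_add_cnj using integral_Re[OF ig] by simp
    finally show "(\<integral>\<omega>. of_real (Re (g \<omega>)) * iexp (t * \<zeta> \<omega>) \<partial>M)
        = of_real (\<integral>\<omega>. Re (g \<omega>) \<partial>M) * (\<integral>\<omega>. iexp (t * \<zeta> \<omega>) \<partial>M)" .
  qed (use order_trans[OF abs_Re_le_cmod bound] in auto)
  have im: "(\<integral>\<omega>. Im (g \<omega>) * indicator A (\<zeta> \<omega>) \<partial>M) = (\<integral>\<omega>. Im (g \<omega>) \<partial>M) * prob (\<zeta> -` A \<inter> space M)"
  proof (rule expectation_indicator_of_char_real[where C = C])
    fix t
    have "(\<integral>\<omega>. of_real (Im (g \<omega>)) * iexp (t * \<zeta> \<omega>) \<partial>M)
        = (\<integral>\<omega>. (g \<omega> * iexp (t * \<zeta> \<omega>) - cnj (g \<omega>) * iexp (t * \<zeta> \<omega>)) / (2 * \<i>) \<partial>M)"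
    proof (intro Bochner_Integration.integral_cong refl)
      fix \<omega>
      have eq: "z * w - cnj z * w = (of_real (Im z) * w) * (2 * \<i>)" for z w :: complex
        by (simp add: complex_eq_iff)
      show "of_real (Im (g \<omega>)) * iexp (t * \<zeta> \<omega>) = (g \<omega> * iexp (t * \<zeta> \<omega>) - cnj (g \<omega>) * iexp (t * \<zeta> \<omega>)) / (2 * \<i>)"
        unfolding eq by (rule nonzero_mult_div_cancel_right[symmetric]) simp
    qed
    also have "\<dots> = ((\<integral>\<omega>. g \<omega> * iexp (t * \<zeta> \<omega>) \<partial>M) - (\<integral>\<omega>. cnj (g \<omega>) * iexp (t * \<zeta> \<omega>) \<partial>M)) / (2 * \<i>)"
      using igt icgt by simp
    also have "\<dots> = ((\<integral>\<omega>. g \<omega> \<partial>M) - cnj (\<integral>\<omega>. g \<omega> \<partial>M)) / (2 * \<i>) * (\<integral>\<omega>. iexp (t * \<zeta> \<omega>) \<partial>M)"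
      unfolding ch chc by (simp add: left_diff_distrib diff_divide_distrib)
    also have "((\<integral>\<omega>. g \<omega> \<partial>M) - cnj (\<integral>\<omega>. g \<omega> \<partial>M)) / (2 * \<i>) = of_real (\<integral>\<omega>. Im (g \<omega>) \<partial>M)"
      unfolding complex_diff_cnj using integral_Im[OF ig] by (simp add: complex_eq_iff)
    finally show "(\<integral>\<omega>. of_real (Im (g \<omega>)) * iexp (t * \<zeta> \<omega>) \<partial>M)
        = of_real (\<integral>\<omega>. Im (g \<omega>) \<partial>M) * (\<integral>\<omega>. iexp (t * \<zeta> \<omega>) \<partial>M)" .
  qed (use order_trans[OF abs_Im_le_cmod bound] in auto)
  have igA: "integrable M (\<lambda>\<omega>. g \<omega> * indicator A (\<zeta> \<omega>))"
    by (rule integrable_const_bound[of _ C])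
      (use bound order_trans[OF norm_ge_zero bound] in \<open>auto simp: indicator_def\<close>)
  have [simp]: "Re (indicator B x) = indicator B x" "Im (indicator B x) = 0" for B and x :: real
    by (auto simp: indicator_def)
  show ?thesis
  proof (rule complex_eqI)
    show "Re (\<integral>\<omega>. g \<omega> * indicator A (\<zeta> \<omega>) \<partial>M) = Re ((\<integral>\<omega>. g \<omega> \<partial>M) * of_real (prob (\<zeta> -` A \<inter> space M)))"
      using integral_Re[OF igA] integral_Re[OF ig] re by simp
    show "Im (\<integral>\<omega>. g \<omega> * indicator A (\<zeta> \<omega>) \<partial>M) = Im ((\<integral>\<omega>. g \<omega> \<partial>M) * of_real (prob (\<zeta> -` A \<inter> space M)))"
      using integral_Im[OF igA] integral_Im[OF ig] im by simp
  qed
qed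

text \<open>
  The one-dimensional uniqueness theorem is applied one coordinate at a time. In the induction, the
  coordinates in \<open>K\<close> already appear through indicators and those in \<open>J\<close> still through
  exponentials; moving a coordinate from \<open>J\<close> to \<open>K\<close> is the preceding lemma, with all other
  factors in the role of \<open>g\<close>.
\<close>

lemma (in prob_space) indep_vars_of_char:
  fixes \<zeta> :: "'i \<Rightarrow> 'a \<Rightarrow> real"
  assumes meas: "\<And>i. i \<in> I \<Longrightarrow> \<zeta> i \<in> borel_measurable M"
    and ch: "\<And>J t. finite J \<Longrightarrow> J \<subseteq> I \<Longrightarrow>
      (\<integral>\<omega>. iexp (\<Sum>j\<in>J. t j * \<zeta> j \<omega>) \<partial>M) = (\<Prod>j\<in>J. \<integral>\<omega>. iexp (t j * \<zeta> j \<omega>) \<partial>M)"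
  shows "indep_vars (\<lambda>_. borel) \<zeta> I"
proof -
  let ?p = "\<lambda>A k. of_real (prob (\<zeta> k -` A k \<inter> space M)) :: complex"
  have main: "(\<integral>\<omega>. (\<Prod>k\<in>K. indicator (A k) (\<zeta> k \<omega>)) * iexp (\<Sum>j\<in>J. t j * \<zeta> j \<omega>) \<partial>M)
      = (\<Prod>k\<in>K. ?p A k) * (\<Prod>j\<in>J. \<integral>\<omega>. iexp (t j * \<zeta> j \<omega>) \<partial>M)"
    if "finite K" "K \<subseteq> I" "finite J" "J \<subseteq> I" "K \<inter> J = {}" "\<And>k. k \<in> K \<Longrightarrow> A k \<in> sets borel" for K J A t
    using that
  proof (induction K arbitrary: J t rule: finite_induct)
    case empty
    then show ?case using ch[of J t] by simp
  next
    case (insert k K)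
    have [measurable]: "\<zeta> k \<in> borel_measurable M" "A k \<in> sets borel" using insert meas by auto
    have [measurable]: "\<zeta> j \<in> borel_measurable M" if "j \<in> J" for j using insert that meas by auto
    have [measurable]: "\<zeta> j \<in> borel_measurable M" "A j \<in> sets borel" if "j \<in> K" for j using insert that meas by auto
    let ?g = "\<lambda>\<omega>. (\<Prod>k\<in>K. indicator (A k) (\<zeta> k \<omega>)) * iexp (\<Sum>j\<in>J. t j * \<zeta> j \<omega>)"
    have IH: "(\<integral>\<omega>. ?g \<omega> \<partial>M) = (\<Prod>k\<in>K. ?p A k) * (\<Prod>j\<in>J. \<integral>\<omega>. iexp (t j * \<zeta> j \<omega>) \<partial>M)"
      using insert by (intro insert.IH) auto
    have "(\<integral>\<omega>. ?g \<omega> * indicator (A k) (\<zeta> k \<omega>) \<partial>M) = (\<integral>\<omega>. ?g \<omega> \<partial>M) * ?p A k"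
    proof (rule expectation_indicator_of_char[where C = 1])
      show "?g \<in> borel_measurable M" by measurable
      show "norm (?g \<omega>) \<le> 1" for \<omega>
        unfolding norm_mult norm_exp_i_times prod_norm[symmetric] mult_1_right
        by (rule prod_le_1) (auto simp: indicator_def)
      fix s
      let ?t = "t(k := s)"
      have kJ: "k \<notin> J" using insert by auto
      have eq: "(\<Sum>j\<in>insert k J. ?t j * \<zeta> j \<omega>) = s * \<zeta> k \<omega> + (\<Sum>j\<in>J. t j * \<zeta> j \<omega>)" for \<omega>
        using kJ insert.prems by (subst sum.insert) (auto intro!: sum.cong)
      have "(\<integral>\<omega>. ?g \<omega> * iexp (s * \<zeta> k \<omega>) \<partial>M)
          = (\<integral>\<omega>. (\<Prod>k\<in>K. indicator (A k) (\<zeta> k \<omega>)) * iexp (\<Sum>j\<in>insert k J. ?t j * \<zeta> j \<omega>) \<partial>M)"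
        unfolding eq by (simp add: exp_add distrib_left ac_simps)
      also have "\<dots> = (\<Prod>k\<in>K. ?p A k) * (\<Prod>j\<in>insert k J. \<integral>\<omega>. iexp (?t j * \<zeta> j \<omega>) \<partial>M)"
        using insert by (intro insert.IH) auto
      also have "(\<Prod>j\<in>insert k J. \<integral>\<omega>. iexp (?t j * \<zeta> j \<omega>) \<partial>M)
          = (\<integral>\<omega>. iexp (s * \<zeta> k \<omega>) \<partial>M) * (\<Prod>j\<in>J. \<integral>\<omega>. iexp (t j * \<zeta> j \<omega>) \<partial>M)"
        using kJ insert.prems by (subst prod.insert) (auto intro!: prod.cong)
      finally show "(\<integral>\<omega>. ?g \<omega> * iexp (s * \<zeta> k \<omega>) \<partial>M) = (\<integral>\<omega>. ?g \<omega> \<partial>M) * (\<integral>\<omega>. iexp (s * \<zeta> k \<omega>) \<partial>M)"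
        unfolding IH by (simp add: ac_simps)
    qed auto
    then show ?case
      using insert.hyps unfolding IH by (simp add: ac_simps)
  qed
  show ?thesis
    unfolding indep_vars_def2
  proof (intro conjI ballI)
    show "indep_sets (\<lambda>i. {\<zeta> i -` A \<inter> space M |A. A \<in> sets borel}) I"
    proof (rule indep_setsI)
      fix i assume "i \<in> I"
      then show "{\<zeta> i -` A \<inter> space M |A. A \<in> sets borel} \<subseteq> events"
        using meas by (auto intro: measurable_sets)
    next
      fix B J assume J: "J \<noteq> {}" "J \<subseteq> I" "finite J"
        and B: "\<forall>j\<in>J. B j \<in> {\<zeta> j -` A \<inter> space M |A. A \<in> sets borel}"
      obtain A where A: "\<And>j. j \<in> J \<Longrightarrow> A j \<in> sets borel" "\<And>j. j \<in> J \<Longrightarrow> B j = \<zeta> j -` A j \<inter> space M"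
        using B by simp metis
      have eq: "(\<Prod>k\<in>J. indicator (A k) (\<zeta> k \<omega>)) = (indicator (\<Inter>j\<in>J. B j) \<omega> :: complex)" if "\<omega> \<in> space M" for \<omega>
        using that A(2) J by (auto simp: indicator_def intro!: prod.neutral)
      have Bm: "(\<Inter>j\<in>J. B j) \<in> events"
        using J A meas by (intro sets.finite_INT) (auto intro!: measurable_sets[of _ _ borel])
      have "of_real (prob (\<Inter>j\<in>J. B j)) = (\<integral>\<omega>. indicator (\<Inter>j\<in>J. B j) \<omega> \<partial>M :: complex)"
      proof -
        have "(\<integral>\<omega>. indicator (\<Inter>j\<in>J. B j) \<omega> \<partial>M :: complex) = (\<integral>\<omega>. of_real (indicator (\<Inter>j\<in>J. B j) \<omega>) \<partial>M)"
          by (intro Bochner_Integration.integral_cong) (auto simp: indicator_def)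
        also have "\<dots> = of_real (\<integral>\<omega>. indicator (\<Inter>j\<in>J. B j) \<omega> \<partial>M)" by (rule integral_complex_of_real)
        also have "(\<integral>\<omega>. indicator (\<Inter>j\<in>J. B j) \<omega> \<partial>M) = prob (\<Inter>j\<in>J. B j)"
          using sets.sets_into_space[OF Bm]
          by (subst Bochner_Integration.integral_indicator) (simp add: Int_absorb2)
        finally show ?thesis ..
      qed
      also have "\<dots> = (\<integral>\<omega>. (\<Prod>k\<in>J. indicator (A k) (\<zeta> k \<omega>)) * iexp (\<Sum>j\<in>{}. 0 * \<zeta> j \<omega>) \<partial>M)"
        by (intro Bochner_Integration.integral_cong) (auto simp: eq)
      also have "\<dots> = (\<Prod>k\<in>J. ?p A k)" using main[of J "{}" A] J A by simp
      finally have "prob (\<Inter>j\<in>J. B j) = (\<Prod>k\<in>J. prob (\<zeta> k -` A k \<inter> space M))"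
        by (simp flip: of_real_prod)
      then show "prob (\<Inter>j\<in>J. B j) = (\<Prod>j\<in>J. prob (B j))" using A by simp
    qed
  qed (use meas in auto)
qed

section \<open>Tensor products\<close>

lemma (in pair_sigma_finite) product_of_integrable:
  fixes f :: "'a \<Rightarrow> real" and g :: "'b \<Rightarrow> real"
  assumes f: "integrable M1 f" and g: "integrable M2 g"
  shows "integrable (M1 \<Otimes>\<^sub>M M2) (\<lambda>(s, t). f s * g t)"
    and "(\<integral>z. (case z of (s, t) \<Rightarrow> f s * g t) \<partial>(M1 \<Otimes>\<^sub>M M2)) = (\<integral>s. f s \<partial>M1) * (\<integral>t. g t \<partial>M2)"
proof -
  have [measurable]: "f \<in> borel_measurable M1" "g \<in> borel_measurable M2" using f g by auto
  show int: "integrable (M1 \<Otimes>\<^sub>M M2) (\<lambda>(s, t). f s * g t)"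
    by (rule Fubini_integrable) (use f g in \<open>auto simp: abs_mult\<close>)
  show "(\<integral>z. (case z of (s, t) \<Rightarrow> f s * g t) \<partial>(M1 \<Otimes>\<^sub>M M2)) = (\<integral>s. f s \<partial>M1) * (\<integral>t. g t \<partial>M2)"
    using integral_fst'[OF int] by simp
qed

lemma (in pair_sigma_finite) tensor_L2:
  assumes "f \<in> L2 M1" "g \<in> L2 M2"
  shows "f \<otimes>\<^sub>t g \<in> L2 (M1 \<Otimes>\<^sub>M M2)"
proof -
  have [measurable]: "f \<in> borel_measurable M1" "g \<in> borel_measurable M2" using assms by (auto simp: L2_def)
  have "integrable (M1 \<Otimes>\<^sub>M M2) (\<lambda>(s, t). (f s)\<^sup>2 * (g t)\<^sup>2)"
    using assms by (intro product_of_integrable L2_D)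
  moreover have "f \<otimes>\<^sub>t g \<in> borel_measurable (M1 \<Otimes>\<^sub>M M2)" unfolding tensor_def by measurable
  ultimately show ?thesis by (simp add: L2_def tensor_def case_prod_beta' power_mult_distrib)
qed

lemma (in pair_sigma_finite) tensor_inner:
  assumes "f \<in> L2 M1" "g \<in> L2 M2" "f' \<in> L2 M1" "g' \<in> L2 M2"
  shows "L2_inner (M1 \<Otimes>\<^sub>M M2) (f \<otimes>\<^sub>t g) (f' \<otimes>\<^sub>t g') = L2_inner M1 f f' * L2_inner M2 g g'"
proof -
  have "L2_inner (M1 \<Otimes>\<^sub>M M2) (f \<otimes>\<^sub>t g) (f' \<otimes>\<^sub>t g')
      = (\<integral>z. (case z of (s, t) \<Rightarrow> (f s * f' s) * (g t * g' t)) \<partial>(M1 \<Otimes>\<^sub>M M2))"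
    unfolding L2_inner_def tensor_def
    by (intro Bochner_Integration.integral_cong) auto
  also have "\<dots> = L2_inner M1 f f' * L2_inner M2 g g'"
    unfolding L2_inner_def using assms by (intro product_of_integrable L2_integrable_mult)
  finally show ?thesis .
qed

lemma sigma_finite_unit_meas: "sigma_finite_measure unit_meas"
  by (rule sigma_finite_measure_restrict_space) (auto intro: sigma_finite_lborel)

interpretation unit: sigma_finite_measure unit_meas
  by (rule sigma_finite_unit_meas)

interpretation unit2: pair_sigma_finite unit_meas unit_meas
  by unfold_locales

section \<open>Moments and characteristic function of a normal variable\<close>

lemma (in prob_space) normal_variable:
  fixes Z :: "'a \<Rightarrow> real"
  assumes Z [measurable]: "Z \<in> borel_measurable M" and \<sigma>: "\<sigma> > 0"
    and D: "distr M borel Z = density lborel (normal_density \<mu> \<sigma>)"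
  shows normal_integrable_power: "integrable M (\<lambda>\<omega>. (Z \<omega> - \<mu>) ^ k)"
    and normal_expectation: "expectation Z = \<mu>"
    and normal_square: "(\<integral>\<omega>. (Z \<omega> - \<mu>) ^ 2 \<partial>M) = \<sigma>\<^sup>2"
    and normal_fourth: "(\<integral>\<omega>. (Z \<omega> - \<mu>) ^ 4 \<partial>M) = 3 * \<sigma> ^ 4"
    and normal_char: "\<mu> = 0 \<Longrightarrow> (\<integral>\<omega>. iexp (t * Z \<omega>) \<partial>M) = of_real (exp (- (t\<^sup>2 * \<sigma>\<^sup>2) / 2))"
proof -
  have int: "(\<integral>\<omega>. g (Z \<omega>) \<partial>M) = (\<integral>x. normal_density \<mu> \<sigma> x * g x \<partial>lborel)"
    if [measurable]: "g \<in> borel_measurable borel" for g :: "real \<Rightarrow> real"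
  proof -
    have "(\<integral>\<omega>. g (Z \<omega>) \<partial>M) = (\<integral>x. g x \<partial>distr M borel Z)" by (simp add: Bochner_Integration.integral_distr)
    also have "\<dots> = (\<integral>x. normal_density \<mu> \<sigma> x *\<^sub>R g x \<partial>lborel)"
      unfolding D by (rule integral_density) auto
    finally show ?thesis by simp
  qed
  have "integrable (density lborel (normal_density \<mu> \<sigma>)) (\<lambda>x. (x - \<mu>) ^ k)"
    by (subst integrable_density) (auto intro: integrable_normal_moment \<sigma>)
  then show "integrable M (\<lambda>\<omega>. (Z \<omega> - \<mu>) ^ k)"
    unfolding D[symmetric] by (subst (asm) integrable_distr_eq) auto
  show "expectation Z = \<mu>"
    using int[of "\<lambda>x. x"] integral_normal_moment_nz_1[OF \<sigma>] by simp
  show "(\<integral>\<omega>. (Z \<omega> - \<mu>) ^ 2 \<partial>M) = \<sigma>\<^sup>2"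
  proof -
    have "(fact (2 * 1) :: real) / ((2 / \<sigma>\<^sup>2) ^ 1 * fact 1) = \<sigma>\<^sup>2" using \<sigma> by (simp add: field_simps)
    then show ?thesis using int[of "\<lambda>x. (x - \<mu>) ^ 2"] integral_normal_moment_even[OF \<sigma>, of \<mu> 1] by simp
  qed
  show "(\<integral>\<omega>. (Z \<omega> - \<mu>) ^ 4 \<partial>M) = 3 * \<sigma> ^ 4"
  proof -
    have "(fact (2 * 2) :: real) / ((2 / \<sigma>\<^sup>2) ^ 2 * fact 2) = 3 * \<sigma> ^ 4"
      using \<sigma> by (simp add: fact_numeral field_simps power2_eq_square power4_eq_xxxx)
    then show ?thesis using int[of "\<lambda>x. (x - \<mu>) ^ 4"] integral_normal_moment_even[OF \<sigma>, of \<mu> 2] by simp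
  qed
  show "(\<integral>\<omega>. iexp (t * Z \<omega>) \<partial>M) = of_real (exp (- (t\<^sup>2 * \<sigma>\<^sup>2) / 2))" if "\<mu> = 0"
  proof -
    have "distributed M lborel Z (normal_density 0 \<sigma>)"
      using D that by (simp add: distributed_def cong: distr_cong)
    then have "distributed M lborel (\<lambda>\<omega>. Z \<omega> / \<sigma>) std_normal_density"
      using normal_standard_normal_convert[OF \<sigma>, of Z 0] by simp
    then have S: "distr M borel (\<lambda>\<omega>. Z \<omega> / \<sigma>) = std_normal_distribution"
      by (simp add: distributed_def cong: distr_cong)
    have "(\<integral>\<omega>. iexp (t * Z \<omega>) \<partial>M) = (\<integral>\<omega>. iexp ((t * \<sigma>) * (Z \<omega> / \<sigma>)) \<partial>M)"
      using \<sigma> by simp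
    also have "\<dots> = char (distr M borel (\<lambda>\<omega>. Z \<omega> / \<sigma>)) (t * \<sigma>)"
      unfolding char_def by (subst Bochner_Integration.integral_distr) auto
    finally show ?thesis unfolding S char_std_normal_distribution by (simp add: power_mult_distrib)
  qed
qed

section \<open>The covariance operator of the noise\<close>

locale gaussian_noise = prob_space M
  for M :: "'w measure" +
  fixes E :: "'w \<Rightarrow> real \<Rightarrow> real" and R :: "real \<times> real \<Rightarrow> real"
    and lam :: "nat \<Rightarrow> real" and \<phi> :: "nat \<Rightarrow> real \<Rightarrow> real"
  assumes gaussian: "L2_gaussian M E"
    and centered: "\<And>f. f \<in> L2 unit_meas \<Longrightarrow> L2_norm unit_meas f = 1 \<Longrightarrow>
           (\<integral>\<omega>. L2_inner unit_meas f (E \<omega>) \<partial>M) = 0"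
    and nondegenerate: "\<And>f. f \<in> L2 unit_meas \<Longrightarrow> L2_norm unit_meas f = 1 \<Longrightarrow>
           (\<integral>\<omega>. (L2_inner unit_meas f (E \<omega>))\<^sup>2 \<partial>M) > 0"
    and covariance: "covariance_function M E R"
    and basis: "L2_orthonormal_basis unit_meas \<phi>"
    and lam_pos: "\<And>j. 1 \<le> j \<Longrightarrow> lam j > 0"
    and expansion: "has_L2_sum unit_meas2 (\<lambda>j z. lam j * (\<phi> j \<otimes>\<^sub>t \<phi> j) z) {1..} R"
begin

abbreviation ip :: "(real \<Rightarrow> real) \<Rightarrow> (real \<Rightarrow> real) \<Rightarrow> real" where
  "ip \<equiv> L2_inner unit_meas"

lemma E_measurable [measurable]: "E \<in> M \<rightarrow>\<^sub>M L2_borel unit_meas"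
  using gaussian by (simp add: L2_gaussian_def)

lemma E_L2: "\<omega> \<in> space M \<Longrightarrow> E \<omega> \<in> L2 unit_meas"
  using measurable_space[OF E_measurable] by simp

lemma \<phi>_L2: "1 \<le> j \<Longrightarrow> \<phi> j \<in> L2 unit_meas"
  by (rule basis_L2[OF basis])

lemma \<phi>_inner: "1 \<le> j \<Longrightarrow> 1 \<le> k \<Longrightarrow> ip (\<phi> j) (\<phi> k) = (if j = k then 1 else 0)"
  by (rule basis_inner[OF basis])

lemma ip_E_measurable: "f \<in> L2 unit_meas \<Longrightarrow> (\<lambda>\<omega>. ip (E \<omega>) f) \<in> borel_measurable M"
  by (rule measurable_compose[OF E_measurable measurable_L2_inner])

lemma ip_E_sum:
  assumes "J \<subseteq> {1..}" "\<omega> \<in> space M"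
  shows "ip (E \<omega>) (\<lambda>x. \<Sum>j\<in>J. t j * \<phi> j x) = (\<Sum>j\<in>J. t j * ip (E \<omega>) (\<phi> j))"
proof -
  have "ip (\<lambda>x. \<Sum>j\<in>J. t j * \<phi> j x) (E \<omega>) = (\<Sum>j\<in>J. ip (\<lambda>x. t j * \<phi> j x) (E \<omega>))"
    using assms by (intro L2_inner_sum_left L2_scale \<phi>_L2 E_L2) auto
  also have "\<dots> = (\<Sum>j\<in>J. t j * ip (E \<omega>) (\<phi> j))"
    unfolding L2_inner_scale_left L2_inner_commute[of unit_meas "E \<omega>"] ..
  finally show ?thesis unfolding L2_inner_commute[of unit_meas "E \<omega>" "\<lambda>x. \<Sum>j\<in>J. t j * \<phi> j x"] .
qed

text \<open>
  Rescaling \<open>f\<close> to norm one gives mean zero and positive variance; the latter excludes the point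
  masses admitted among the normal distributions.
\<close>

lemma ip_E_normal:
  assumes f: "f \<in> L2 unit_meas" and nz: "L2_norm unit_meas f \<noteq> 0"
  shows "\<exists>\<sigma>>0. distr M borel (\<lambda>\<omega>. ip (E \<omega>) f) = density lborel (normal_density 0 \<sigma>)"
proof -
  let ?Z = "\<lambda>\<omega>. ip (E \<omega>) f" and ?n = "L2_norm unit_meas f"
  have [measurable]: "?Z \<in> borel_measurable M" by (rule ip_E_measurable[OF f])
  let ?f1 = "\<lambda>x. (1 / ?n) * f x"
  have f1: "?f1 \<in> L2 unit_meas" "L2_norm unit_meas ?f1 = 1"
  proof -
    show "?f1 \<in> L2 unit_meas" by (rule L2_scale[OF f])
    show "L2_norm unit_meas ?f1 = 1"
      unfolding L2_norm_scale[of unit_meas "1 / ?n" f] using nz L2_norm_nonneg[of unit_meas f] by simp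
  qed
  have eq: "ip ?f1 (E \<omega>) = ?Z \<omega> / ?n" for \<omega>
    by (subst L2_inner_scale_left) (simp add: L2_inner_commute)
  have mean: "expectation ?Z = 0" using centered[OF f1] nz unfolding eq by simp
  have var: "(\<integral>\<omega>. (?Z \<omega>)\<^sup>2 \<partial>M) \<noteq> 0"
    using nondegenerate[OF f1] nz unfolding eq by (auto simp: power_divide)
  obtain \<mu> \<sigma> where \<sigma>: "0 \<le> \<sigma>" and D: "distr M borel ?Z =
        (if \<sigma> = 0 then return borel \<mu> else density lborel (normal_density \<mu> \<sigma>))"
    using gaussian f unfolding L2_gaussian_def normally_distributed_def
    by (metis (no_types, lifting) L2_inner_commute ext)
  have "\<sigma> \<noteq> 0"
  proof
    assume "\<sigma> = 0"
    then have D: "distr M borel ?Z = return borel \<mu>" using D by simp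
    have "expectation ?Z = (\<integral>x. x \<partial>distr M borel ?Z)" by (simp add: Bochner_Integration.integral_distr)
    also have "\<dots> = \<mu>" unfolding D by (simp add: integral_return)
    finally have "\<mu> = 0" using mean by simp
    have "(\<integral>\<omega>. (?Z \<omega>)\<^sup>2 \<partial>M) = (\<integral>x. x\<^sup>2 \<partial>distr M borel ?Z)" by (simp add: Bochner_Integration.integral_distr)
    also have "\<dots> = 0" unfolding D using \<open>\<mu> = 0\<close> by (simp add: integral_return)
    finally show False using var by simp
  qed
  then have D': "distr M borel ?Z = density lborel (normal_density \<mu> \<sigma>)" "\<sigma> > 0" using D \<sigma> by auto
  have "\<mu> = 0" using normal_expectation[OF _ D'(2,1)] mean by simp
  then show ?thesis using D' by blast
qed

lemma ip_E_null:
  assumes "f \<in> L2 unit_meas" "L2_norm unit_meas f = 0" "\<omega> \<in> space M"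
  shows "ip (E \<omega>) f = 0"
  using L2_Cauchy_Schwarz[OF E_L2[OF assms(3)] assms(1)] assms(2) by simp

lemma ip_E_square_integrable:
  assumes f: "f \<in> L2 unit_meas"
  shows "(\<lambda>\<omega>. ip (E \<omega>) f) \<in> L2 M"
proof (cases "L2_norm unit_meas f = 0")
  case True
  then have "integrable M (\<lambda>\<omega>. (ip (E \<omega>) f)\<^sup>2) \<longleftrightarrow> integrable M (\<lambda>\<omega>. 0 :: real)"
    by (intro Bochner_Integration.integrable_cong) (auto simp: ip_E_null f)
  then show ?thesis using ip_E_measurable[OF f] by (simp add: L2_def)
next
  case False
  then show ?thesis
    using ip_E_normal[OF f False] normal_integrable_power[OF ip_E_measurable[OF f], of _ 0 2] ip_E_measurable[OF f]
    by (auto simp: L2_def)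
qed

lemma ip_E_char:
  assumes f: "f \<in> L2 unit_meas"
  shows "(\<integral>\<omega>. iexp (ip (E \<omega>) f) \<partial>M) = of_real (exp (- (\<integral>\<omega>. (ip (E \<omega>) f)\<^sup>2 \<partial>M) / 2))"
proof (cases "L2_norm unit_meas f = 0")
  case True
  have "(\<integral>\<omega>. iexp (ip (E \<omega>) f) \<partial>M) = (\<integral>\<omega>. 1 \<partial>M)"
    by (intro Bochner_Integration.integral_cong) (auto simp: ip_E_null f True)
  moreover have "(\<integral>\<omega>. (ip (E \<omega>) f)\<^sup>2 \<partial>M) = (\<integral>\<omega>. 0 \<partial>M)"
    by (intro Bochner_Integration.integral_cong) (auto simp: ip_E_null f True)
  ultimately show ?thesis by (simp add: prob_space)
next
  case False
  obtain \<sigma> where \<sigma>: "\<sigma> > 0" "distr M borel (\<lambda>\<omega>. ip (E \<omega>) f) = density lborel (normal_density 0 \<sigma>)"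
    using ip_E_normal[OF f False] by blast
  show ?thesis
    using normal_char[OF ip_E_measurable[OF f] \<sigma>, of 1] normal_square[OF ip_E_measurable[OF f] \<sigma>] by simp
qed

lemma norm_E_measurable: "(\<lambda>\<omega>. ip (E \<omega>) (E \<omega>)) \<in> borel_measurable M"
proof -
  have "(\<lambda>\<omega>. L2_norm unit_meas (\<lambda>x. E \<omega> x - 0)) \<in> borel_measurable M"
    by (rule measurable_compose[OF E_measurable measurable_L2_dist[OF L2_zero]])
  then have "(\<lambda>\<omega>. (L2_norm unit_meas (\<lambda>x. E \<omega> x))\<^sup>2) \<in> borel_measurable M" by simp
  then show ?thesis by (simp add: L2_norm_square)
qed

lemma norm_E_bounded_with_high_probability:
  "\<exists>K\<ge>0. prob {\<omega> \<in> space M. \<not> ip (E \<omega>) (E \<omega>) \<le> K} \<le> 1 / 12"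
proof -
  have [measurable]: "(\<lambda>\<omega>. ip (E \<omega>) (E \<omega>)) \<in> borel_measurable M" by (rule norm_E_measurable)
  let ?A = "\<lambda>n. {\<omega> \<in> space M. ip (E \<omega>) (E \<omega>) \<le> real n}"
  have "(\<lambda>n. prob (?A n)) \<longlonglongrightarrow> prob (\<Union>n. ?A n)"
    by (rule finite_Lim_measure_incseq) (auto simp: incseq_def intro: order_trans)
  also have "(\<Union>n. ?A n) = space M" using real_arch_simple by auto
  finally have "(\<lambda>n. prob (?A n)) \<longlonglongrightarrow> 1" by (simp add: prob_space)
  from order_tendstoD(1)[OF this, of "11 / 12"] obtain n where n: "prob (?A n) > 11 / 12"
    by (auto simp: eventually_sequentially)
  have "{\<omega> \<in> space M. \<not> ip (E \<omega>) (E \<omega>) \<le> real n} = space M - ?A n" by auto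
  then have "prob {\<omega> \<in> space M. \<not> ip (E \<omega>) (E \<omega>) \<le> real n} = 1 - prob (?A n)" by (simp add: prob_compl)
  then show ?thesis using n by (intro exI[of _ "real n"]) auto
qed

text \<open>
  A centered normal variable with variance \<open>v\<close> has fourth moment \<open>3 v\<^sup>2\<close>, so by Cauchy-Schwarz
  an event of probability at most \<open>1 / 12\<close> carries at most \<open>\<surd>(3 / 12) v = v / 2\<close> of its second moment.
\<close>

lemma second_moment_le_restricted:
  assumes f: "f \<in> L2 unit_meas" and nz: "L2_norm unit_meas f \<noteq> 0"
    and B [measurable]: "B \<in> events" and small: "prob (space M - B) \<le> 1 / 12"
  shows "(\<integral>\<omega>. (ip (E \<omega>) f)\<^sup>2 \<partial>M) \<le> 2 * (\<integral>\<omega>. (ip (E \<omega>) f)\<^sup>2 * indicator B \<omega> \<partial>M)"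
proof -
  let ?Z = "\<lambda>\<omega>. ip (E \<omega>) f" and ?i = "\<lambda>\<omega>. indicator (space M - B) \<omega> :: real"
  have [measurable]: "?Z \<in> borel_measurable M" by (rule ip_E_measurable[OF f])
  obtain \<sigma> where \<sigma>: "\<sigma> > 0" "distr M borel ?Z = density lborel (normal_density 0 \<sigma>)"
    using ip_E_normal[OF f nz] by blast
  have m2: "(\<integral>\<omega>. (?Z \<omega>)\<^sup>2 \<partial>M) = \<sigma>\<^sup>2" using normal_square[OF _ \<sigma>] by simp
  have m4: "(\<integral>\<omega>. (?Z \<omega>)^4 \<partial>M) = 3 * \<sigma>^4" using normal_fourth[OF _ \<sigma>] by simp
  have Z2: "(\<lambda>\<omega>. (?Z \<omega>)\<^sup>2) \<in> L2 M"
    using normal_integrable_power[OF _ \<sigma>, of 4] by (simp add: L2_def flip: power_mult)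
  have i2: "integrable M (\<lambda>\<omega>. (?Z \<omega>)\<^sup>2)" using normal_integrable_power[OF _ \<sigma>, of 2] by simp
  have iL: "?i \<in> L2 M" 
  proof -
    have "(\<lambda>\<omega>. (?i \<omega>)\<^sup>2) = ?i" by (auto simp: indicator_def)
    moreover have "integrable M ?i" by (rule integrable_const_bound[of _ 1]) (auto simp: indicator_def)
    ultimately show ?thesis by (simp add: L2_def)
  qed
  have nZ: "L2_norm M (\<lambda>\<omega>. (?Z \<omega>)\<^sup>2) = sqrt 3 * \<sigma>\<^sup>2"
  proof -
    have "L2_inner M (\<lambda>\<omega>. (?Z \<omega>)\<^sup>2) (\<lambda>\<omega>. (?Z \<omega>)\<^sup>2) = 3 * (\<sigma>\<^sup>2)\<^sup>2"
      unfolding L2_inner_def[of M] using m4 by (simp flip: power_add power_mult)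
    then show ?thesis unfolding L2_norm_def by (simp only: real_sqrt_mult real_sqrt_abs) simp
  qed
  have ni: "L2_norm M ?i \<le> sqrt (1 / 12)"
    unfolding L2_norm_def L2_inner_def using small
    by (intro real_sqrt_le_mono) (simp flip: indicator_inter_arith)
  have "(\<integral>\<omega>. (?Z \<omega>)\<^sup>2 * ?i \<omega> \<partial>M) \<le> L2_norm M (\<lambda>\<omega>. (?Z \<omega>)\<^sup>2) * L2_norm M ?i"
    using L2_Cauchy_Schwarz[OF Z2 iL] by (simp add: L2_inner_def)
  also have "\<dots> \<le> (sqrt 3 * \<sigma>\<^sup>2) * sqrt (1 / 12)"
    unfolding nZ by (intro mult_left_mono ni) auto
  also have "\<dots> = \<sigma>\<^sup>2 * sqrt (3 * (1 / 12))" unfolding real_sqrt_mult by simp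
  also have "sqrt (3 * (1 / 12)) = 1 / 2" by (rule real_sqrt_unique) (auto simp: power2_eq_square)
  finally have le: "(\<integral>\<omega>. (?Z \<omega>)\<^sup>2 * ?i \<omega> \<partial>M) \<le> \<sigma>\<^sup>2 / 2" by simp
  have "\<sigma>\<^sup>2 = (\<integral>\<omega>. (?Z \<omega>)\<^sup>2 * indicator B \<omega> + (?Z \<omega>)\<^sup>2 * ?i \<omega> \<partial>M)"
    unfolding m2[symmetric] by (intro Bochner_Integration.integral_cong) (auto simp: indicator_def)
  also have "\<dots> = (\<integral>\<omega>. (?Z \<omega>)\<^sup>2 * indicator B \<omega> \<partial>M) + (\<integral>\<omega>. (?Z \<omega>)\<^sup>2 * ?i \<omega> \<partial>M)"
    using i2 by (intro Bochner_Integration.integral_add integrable_mult_indicator[where 'b = real, simplified mult.commute]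
      integrable_real_mult_indicator) auto
  finally show ?thesis unfolding m2 using le by simp
qed

text \<open>
  This is the part of Fernique's theorem needed for applying Fubini's theorem to the covariance function,
  whose diagonal is a null set and so says nothing about the variances of point values. On the event
  \<open>B\<close> that the squared norm is at most \<open>K\<close>, the squared coordinates sum to at most \<open>K\<close>; if
  \<open>B\<close> has probability at least \<open>11 / 12\<close>, it carries at least half of the second moment of each
  coordinate. Hence the total second moment is at most \<open>2 * K\<close>.
\<close>

lemma norm_E_square_integrable: "integrable M (\<lambda>\<omega>. ip (E \<omega>) (E \<omega>))"
proof -
  have [measurable]: "(\<lambda>\<omega>. ip (E \<omega>) (E \<omega>)) \<in> borel_measurable M" by (rule norm_E_measurable)
  have [measurable]: "(\<lambda>\<omega>. ip (E \<omega>) (\<phi> k)) \<in> borel_measurable M" if "1 \<le> k" for k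
    by (rule ip_E_measurable[OF \<phi>_L2[OF that]])
  obtain K where K: "K \<ge> 0" "prob {\<omega> \<in> space M. \<not> ip (E \<omega>) (E \<omega>) \<le> K} \<le> 1 / 12"
    using norm_E_bounded_with_high_probability by blast
  define B where "B = {\<omega> \<in> space M. ip (E \<omega>) (E \<omega>) \<le> K}"
  have B [measurable]: "B \<in> events" unfolding B_def by measurable
  have Bc: "space M - B = {\<omega> \<in> space M. \<not> ip (E \<omega>) (E \<omega>) \<le> K}" by (auto simp: B_def)
  have i2: "integrable M (\<lambda>\<omega>. (ip (E \<omega>) (\<phi> k))\<^sup>2)" if "1 \<le> k" for k
    using ip_E_square_integrable[OF \<phi>_L2[OF that]] by (simp add: L2_def)
  have bound: "(\<Sum>k\<in>{1..n}. \<integral>\<omega>. (ip (E \<omega>) (\<phi> k))\<^sup>2 \<partial>M) \<le> 2 * K" for n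
  proof -
    have nz: "L2_norm unit_meas (\<phi> k) \<noteq> 0" if "1 \<le> k" for k
      using \<phi>_inner[OF that that] by (simp add: L2_norm_def)
    have iB: "integrable M (\<lambda>\<omega>. (ip (E \<omega>) (\<phi> k))\<^sup>2 * indicator B \<omega>)" if "1 \<le> k" for k
      using i2[OF that] by (intro integrable_real_mult_indicator) auto
    have "(\<Sum>k\<in>{1..n}. \<integral>\<omega>. (ip (E \<omega>) (\<phi> k))\<^sup>2 \<partial>M)
        \<le> (\<Sum>k\<in>{1..n}. 2 * (\<integral>\<omega>. (ip (E \<omega>) (\<phi> k))\<^sup>2 * indicator B \<omega> \<partial>M))"
      using K Bc by (intro sum_mono second_moment_le_restricted) (auto simp: \<phi>_L2 nz)
    also have "\<dots> = 2 * (\<integral>\<omega>. (\<Sum>k\<in>{1..n}. (ip (E \<omega>) (\<phi> k))\<^sup>2 * indicator B \<omega>) \<partial>M)"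
      using iB by (subst Bochner_Integration.integral_sum) (auto simp: sum_distrib_left)
    also have "\<dots> \<le> 2 * (\<integral>\<omega>. K \<partial>M)"
    proof (intro mult_left_mono Bochner_Integration.integral_mono Bochner_Integration.integrable_sum iB)
      fix \<omega> assume \<omega>: "\<omega> \<in> space M"
      have "(\<Sum>k\<in>{1..n}. (ip (E \<omega>) (\<phi> k))\<^sup>2) \<le> ip (E \<omega>) (E \<omega>)"
        using L2_Bessel[OF E_L2[OF \<omega>], of "{1..n}" \<phi>] by (auto simp: \<phi>_L2 \<phi>_inner L2_norm_square)
      then show "(\<Sum>k\<in>{1..n}. (ip (E \<omega>) (\<phi> k))\<^sup>2 * indicator B \<omega>) \<le> K"
        using K(1) by (auto simp: B_def indicator_def simp flip: sum_distrib_right)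
    qed auto
    finally show ?thesis by (simp add: prob_space)
  qed
  have "(\<integral>\<^sup>+\<omega>. ennreal (ip (E \<omega>) (E \<omega>)) \<partial>M)
      = (\<integral>\<^sup>+\<omega>. liminf (\<lambda>n. ennreal (\<Sum>k\<in>{1..n}. (ip (E \<omega>) (\<phi> k))\<^sup>2)) \<partial>M)"
    using Parseval[OF basis E_L2]
    by (intro nn_integral_cong) (auto intro!: lim_imp_Liminf[symmetric] tendsto_ennrealI)
  also have "\<dots> \<le> liminf (\<lambda>n. \<integral>\<^sup>+\<omega>. ennreal (\<Sum>k\<in>{1..n}. (ip (E \<omega>) (\<phi> k))\<^sup>2) \<partial>M)"
    by (rule nn_integral_liminf) measurable
  also have "(\<lambda>n. \<integral>\<^sup>+\<omega>. ennreal (\<Sum>k\<in>{1..n}. (ip (E \<omega>) (\<phi> k))\<^sup>2) \<partial>M)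
      = (\<lambda>n. ennreal (\<Sum>k\<in>{1..n}. \<integral>\<omega>. (ip (E \<omega>) (\<phi> k))\<^sup>2 \<partial>M))"
    using i2 by (intro ext) (subst nn_integral_eq_integral, auto intro!: sum_nonneg AE_I2)
  also have "liminf \<dots> \<le> liminf (\<lambda>n. ennreal (2 * K))"
    using bound by (intro Liminf_mono always_eventually allI ennreal_leI)
  also have "\<dots> < \<infinity>" by (simp add: Liminf_const)
  finally show ?thesis
    by (intro integrableI_bounded) (auto simp: L2_inner_self_nonneg)
qed

text \<open>
  Fubini's theorem for the kernel \<open>V \<omega> s * f s * V \<omega> t * g t\<close> with a jointly measurable
  version \<open>V\<close> of the noise. The kernel is integrable because for fixed \<open>\<omega>\<close> the integral of
  its absolute value is at most the squared norm of the noise times the norms of \<open>f\<close> and \<open>g\<close>.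
\<close>

lemma covariance_inner:
  assumes f: "f \<in> L2 unit_meas" and g: "g \<in> L2 unit_meas"
  shows "(\<integral>\<omega>. ip (E \<omega>) f * ip (E \<omega>) g \<partial>M) = L2_inner unit_meas2 R (f \<otimes>\<^sub>t g)"
proof -
  obtain V where V [measurable]: "(\<lambda>(\<omega>, t). V \<omega> t) \<in> borel_measurable (M \<Otimes>\<^sub>M unit_meas)"
    and VE: "AE \<omega> in M. AE t in unit_meas. V \<omega> t = E \<omega> t"
    and VR: "AE (s, t) in unit_meas2. has_bochner_integral M (\<lambda>\<omega>. V \<omega> s * V \<omega> t) (R (s, t))"
    using covariance unfolding covariance_function_def by blast
  have [measurable]: "f \<in> borel_measurable unit_meas" "g \<in> borel_measurable unit_meas"
    using f g by (auto simp: L2_def)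
  interpret P: pair_sigma_finite M unit_meas2
    by unfold_locales
  let ?H = "\<lambda>\<omega> z. (V \<omega> (fst z) * f (fst z)) * (V \<omega> (snd z) * g (snd z))"
  have V1: "(\<lambda>p. V (fst p) (fst (snd p))) \<in> borel_measurable (M \<Otimes>\<^sub>M unit_meas2)"
    using measurable_compose[of "\<lambda>p. (fst p, fst (snd p))" "M \<Otimes>\<^sub>M unit_meas2" _ _ _, OF _ V] by simp
  have V2: "(\<lambda>p. V (fst p) (snd (snd p))) \<in> borel_measurable (M \<Otimes>\<^sub>M unit_meas2)"
    using measurable_compose[of "\<lambda>p. (fst p, snd (snd p))" "M \<Otimes>\<^sub>M unit_meas2" _ _ _, OF _ V] by simp
  have H: "(\<lambda>(\<omega>, z). ?H \<omega> z) \<in> borel_measurable (M \<Otimes>\<^sub>M unit_meas2)"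
    using V1 V2 by (simp add: case_prod_beta')
  have Vw: "V \<omega> \<in> borel_measurable unit_meas" if "\<omega> \<in> space M" for \<omega>
    using measurable_compose[OF measurable_Pair1'[OF that] V] by simp
  have AEV: "AE \<omega> in M. V \<omega> \<in> L2 unit_meas \<and> ip (V \<omega>) f = ip (E \<omega>) f \<and> ip (V \<omega>) g = ip (E \<omega>) g
      \<and> ip (V \<omega>) (V \<omega>) = ip (E \<omega>) (E \<omega>)"
    using VE AE_space
  proof eventually_elim
    case (elim \<omega>)
    have [measurable]: "V \<omega> \<in> borel_measurable unit_meas" by (rule Vw[OF elim(2)])
    have [measurable]: "E \<omega> \<in> borel_measurable unit_meas" using E_L2[OF elim(2)] by (simp add: L2_def)
    have "integrable unit_meas (\<lambda>t. (V \<omega> t)\<^sup>2) \<longleftrightarrow> integrable unit_meas (\<lambda>t. (E \<omega> t)\<^sup>2)"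
      by (rule Bochner_Integration.integrable_cong_AE) (use elim(1) in auto)
    then have "V \<omega> \<in> L2 unit_meas" using E_L2[OF elim(2)] by (simp add: L2_def)
    moreover have "ip (V \<omega>) h = ip (E \<omega>) h" if "h \<in> borel_measurable unit_meas" for h
      unfolding L2_inner_def
      by (rule Bochner_Integration.integral_cong_AE) (use elim(1) that in auto)
    moreover have "ip (V \<omega>) (V \<omega>) = ip (E \<omega>) (E \<omega>)"
      unfolding L2_inner_def
      by (rule Bochner_Integration.integral_cong_AE) (use elim(1) in auto)
    ultimately show ?case by auto
  qed
  have absL2: "(\<lambda>x. \<bar>h x\<bar>) \<in> L2 unit_meas" if "h \<in> L2 unit_meas" for h :: "real \<Rightarrow> real"
    using that by (auto simp: L2_def)
  have Hw: "integrable unit_meas2 (?H \<omega>)" "(\<integral>z. ?H \<omega> z \<partial>unit_meas2) = ip (V \<omega>) f * ip (V \<omega>) g"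
      "(\<integral>z. norm (?H \<omega> z) \<partial>unit_meas2) \<le> ip (V \<omega>) (V \<omega>) * (L2_norm unit_meas f * L2_norm unit_meas g)"
    if Vw: "V \<omega> \<in> L2 unit_meas" for \<omega>
  proof -
    note iV = L2_integrable_mult[OF Vw f] L2_integrable_mult[OF Vw g]
    show "integrable unit_meas2 (?H \<omega>)" "(\<integral>z. ?H \<omega> z \<partial>unit_meas2) = ip (V \<omega>) f * ip (V \<omega>) g"
      using unit2.product_of_integrable[OF iV] by (auto simp: case_prod_beta' L2_inner_def)
    have le: "(\<integral>t. \<bar>V \<omega> t * h t\<bar> \<partial>unit_meas) \<le> L2_norm unit_meas (V \<omega>) * L2_norm unit_meas h"
      if "h \<in> L2 unit_meas" for h
      using L2_Cauchy_Schwarz[OF absL2[OF Vw] absL2[OF that]]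
      by (simp add: L2_norm_def L2_inner_def abs_mult abs_mult_self_eq)
    have "(\<integral>z. norm (?H \<omega> z) \<partial>unit_meas2)
        = (\<integral>t. \<bar>V \<omega> t * f t\<bar> \<partial>unit_meas) * (\<integral>t. \<bar>V \<omega> t * g t\<bar> \<partial>unit_meas)"
      using unit2.product_of_integrable(2)[OF integrable_abs[OF iV(1)] integrable_abs[OF iV(2)]]
      by (simp add: case_prod_beta' abs_mult)
    also have "\<dots> \<le> (L2_norm unit_meas (V \<omega>) * L2_norm unit_meas f) * (L2_norm unit_meas (V \<omega>) * L2_norm unit_meas g)"
      by (intro mult_mono le f g mult_nonneg_nonneg L2_norm_nonneg Bochner_Integration.integral_nonneg) auto
    also have "\<dots> = ip (V \<omega>) (V \<omega>) * (L2_norm unit_meas f * L2_norm unit_meas g)"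
      unfolding L2_norm_square[symmetric] by (simp add: power2_eq_square)
    finally show "(\<integral>z. norm (?H \<omega> z) \<partial>unit_meas2) \<le> ip (V \<omega>) (V \<omega>) * (L2_norm unit_meas f * L2_norm unit_meas g)" .
  qed
  have int: "integrable (M \<Otimes>\<^sub>M unit_meas2) (\<lambda>(\<omega>, z). ?H \<omega> z)"
  proof (rule P.Fubini_integrable[OF H])
    show "integrable M (\<lambda>\<omega>. \<integral>z. norm (case (\<omega>, z) of (\<omega>, z) \<Rightarrow> ?H \<omega> z) \<partial>unit_meas2)"
    proof (rule Bochner_Integration.integrable_bound)
      show "integrable M (\<lambda>\<omega>. ip (E \<omega>) (E \<omega>) * (L2_norm unit_meas f * L2_norm unit_meas g))"
        using norm_E_square_integrable by simp
      show "(\<lambda>\<omega>. \<integral>z. norm (case (\<omega>, z) of (\<omega>, z) \<Rightarrow> ?H \<omega> z) \<partial>unit_meas2) \<in> borel_measurable M"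
        using H by (intro unit2.P.borel_measurable_lebesgue_integral) (simp add: case_prod_beta')
      show "AE \<omega> in M. norm (\<integral>z. norm (case (\<omega>, z) of (\<omega>, z) \<Rightarrow> ?H \<omega> z) \<partial>unit_meas2)
          \<le> norm (ip (E \<omega>) (E \<omega>) * (L2_norm unit_meas f * L2_norm unit_meas g))"
        using AEV
      proof eventually_elim
        case (elim \<omega>)
        then show ?case using Hw(3)[of \<omega>]
          by (auto simp: L2_inner_self_nonneg L2_norm_nonneg abs_mult
              intro: order_trans[OF eq_refl[OF abs_of_nonneg[OF Bochner_Integration.integral_nonneg]]])
      qed
    qed
    show "AE \<omega> in M. integrable unit_meas2 (\<lambda>z. case (\<omega>, z) of (\<omega>, z) \<Rightarrow> ?H \<omega> z)"
      using AEV by eventually_elim (use Hw(1) in auto)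
  qed
  have "(\<integral>\<omega>. ip (E \<omega>) f * ip (E \<omega>) g \<partial>M) = (\<integral>\<omega>. \<integral>z. ?H \<omega> z \<partial>unit_meas2 \<partial>M)"
  proof (rule Bochner_Integration.integral_cong_AE)
    show "(\<lambda>\<omega>. ip (E \<omega>) f * ip (E \<omega>) g) \<in> borel_measurable M"
      using ip_E_measurable f g by (intro borel_measurable_times)
    show "(\<lambda>\<omega>. \<integral>z. ?H \<omega> z \<partial>unit_meas2) \<in> borel_measurable M"
      using H by (intro unit2.P.borel_measurable_lebesgue_integral)
    show "AE \<omega> in M. ip (E \<omega>) f * ip (E \<omega>) g = (\<integral>z. ?H \<omega> z \<partial>unit_meas2)"
      using AEV by eventually_elim (use Hw(2) in auto)
  qed
  also have "\<dots> = (\<integral>z. \<integral>\<omega>. ?H \<omega> z \<partial>M \<partial>unit_meas2)"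
    by (rule P.Fubini_integral[OF int, symmetric])
  also have "\<dots> = L2_inner unit_meas2 R (f \<otimes>\<^sub>t g)"
    unfolding L2_inner_def
  proof (rule Bochner_Integration.integral_cong_AE)
    show "(\<lambda>z. \<integral>\<omega>. ?H \<omega> z \<partial>M) \<in> borel_measurable unit_meas2"
      using P.integrable_snd[OF int] by auto
    have "R \<in> borel_measurable unit_meas2" using expansion by (auto simp: has_L2_sum_def L2_def)
    moreover have "f \<otimes>\<^sub>t g \<in> borel_measurable unit_meas2" unfolding tensor_def by measurable
    ultimately show "(\<lambda>z. R z * (f \<otimes>\<^sub>t g) z) \<in> borel_measurable unit_meas2" by measurable
    show "AE z in unit_meas2. (\<integral>\<omega>. ?H \<omega> z \<partial>M) = R z * (f \<otimes>\<^sub>t g) z"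
      using VR
    proof eventually_elim
      case (elim z)
      then have "(\<integral>\<omega>. V \<omega> (fst z) * V \<omega> (snd z) \<partial>M) = R z"
        by (auto simp: case_prod_beta' dest: has_bochner_integral_integral_eq)
      moreover have "(\<integral>\<omega>. ?H \<omega> z \<partial>M) = (\<integral>\<omega>. V \<omega> (fst z) * V \<omega> (snd z) * (f (fst z) * g (snd z)) \<partial>M)"
        by (simp add: ac_simps)
      ultimately show ?case by (simp add: tensor_def case_prod_beta')
    qed
  qed
  finally show ?thesis .
qed

end

section \<open>The noise along its first eigenfunction\<close>

(* Facts about basis functions assume an index 1 \<le> j; keeping the numeral lets them apply to \<phi> 1. *)
declare One_nat_def [simp del]

context gaussian_noise
begin

lemma covariance_coords:
  assumes i: "1 \<le> i" and k: "1 \<le> k"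
  shows "(\<integral>\<omega>. ip (E \<omega>) (\<phi> i) * ip (E \<omega>) (\<phi> k) \<partial>M) = (if i = k then lam i else 0)"
proof -
  have inner: "L2_inner unit_meas2 (\<lambda>z. lam j * (\<phi> j \<otimes>\<^sub>t \<phi> j) z) (\<phi> i \<otimes>\<^sub>t \<phi> k)
      = (if j = i \<and> j = k then lam j else 0)" if "1 \<le> j" for j
    using that i k by (simp add: L2_inner_scale_left unit2.tensor_inner \<phi>_L2 \<phi>_inner)
  have "(\<integral>\<omega>. ip (E \<omega>) (\<phi> i) * ip (E \<omega>) (\<phi> k) \<partial>M) = L2_inner unit_meas2 R (\<phi> i \<otimes>\<^sub>t \<phi> k)"
    by (rule covariance_inner[OF \<phi>_L2[OF i] \<phi>_L2[OF k]])
  also have "\<dots> = L2_inner unit_meas2 (\<lambda>z. lam i * (\<phi> i \<otimes>\<^sub>t \<phi> i) z) (\<phi> i \<otimes>\<^sub>t \<phi> k)"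
    by (rule L2_inner_has_L2_sum[OF expansion]) (use i k inner in \<open>auto intro: unit2.tensor_L2 \<phi>_L2\<close>)
  finally show ?thesis using inner[OF i] by simp
qed

lemma coords_second_moment:
  assumes J: "finite J" "J \<subseteq> {1..}"
  shows "(\<integral>\<omega>. (ip (E \<omega>) (\<lambda>x. \<Sum>j\<in>J. t j * \<phi> j x))\<^sup>2 \<partial>M) = (\<Sum>j\<in>J. (t j)\<^sup>2 * lam j)"
proof -
  have int: "integrable M (\<lambda>\<omega>. ip (E \<omega>) (\<phi> i) * ip (E \<omega>) (\<phi> k))" if "i \<in> J" "k \<in> J" for i k
    using that J by (intro L2_integrable_mult ip_E_square_integrable \<phi>_L2) auto
  have "(\<integral>\<omega>. (ip (E \<omega>) (\<lambda>x. \<Sum>j\<in>J. t j * \<phi> j x))\<^sup>2 \<partial>M)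
      = (\<integral>\<omega>. (\<Sum>i\<in>J. \<Sum>k\<in>J. (t i * t k) * (ip (E \<omega>) (\<phi> i) * ip (E \<omega>) (\<phi> k))) \<partial>M)"
  proof (rule Bochner_Integration.integral_cong)
    fix \<omega> assume "\<omega> \<in> space M"
    then have "ip (E \<omega>) (\<lambda>x. \<Sum>j\<in>J. t j * \<phi> j x) = (\<Sum>j\<in>J. t j * ip (E \<omega>) (\<phi> j))"
      by (intro ip_E_sum J(2))
    then show "(ip (E \<omega>) (\<lambda>x. \<Sum>j\<in>J. t j * \<phi> j x))\<^sup>2
        = (\<Sum>i\<in>J. \<Sum>k\<in>J. (t i * t k) * (ip (E \<omega>) (\<phi> i) * ip (E \<omega>) (\<phi> k)))"
      by (simp add: power2_eq_square sum_product ac_simps)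
  qed simp
  also have "\<dots> = (\<Sum>i\<in>J. \<Sum>k\<in>J. (t i * t k) * (if i = k then lam i else 0))"
    using J int by (simp add: Bochner_Integration.integral_sum Bochner_Integration.integrable_sum
        covariance_coords subset_eq)
  also have "\<dots> = (\<Sum>i\<in>J. (t i)\<^sup>2 * lam i)"
    using J by (intro sum.cong) (auto simp: power2_eq_square if_distrib[where f = "\<lambda>x. _ * x"] sum.delta cong: if_cong)
  finally show ?thesis .
qed

text \<open>
  A finite combination of coordinates is itself a centered normal variable, and its variance is the
  sum of the variances because the covariances vanish. So the joint characteristic function factorises.
\<close>

lemma coords_independent: "indep_vars (\<lambda>_. borel) (\<lambda>j \<omega>. ip (E \<omega>) (\<phi> j)) {1..}"
proof (rule indep_vars_of_char)
  fix i :: nat assume "i \<in> {1..}"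
  then show "(\<lambda>\<omega>. ip (E \<omega>) (\<phi> i)) \<in> borel_measurable M" by (auto intro: ip_E_measurable \<phi>_L2)
next
  fix J :: "nat set" and t :: "nat \<Rightarrow> real" assume J: "finite J" "J \<subseteq> {1..}"
  have char: "(\<integral>\<omega>. iexp (\<Sum>j\<in>J. t j * ip (E \<omega>) (\<phi> j)) \<partial>M)
      = of_real (exp (- (\<Sum>j\<in>J. (t j)\<^sup>2 * lam j) / 2))"
    if J: "finite J" "J \<subseteq> {1..}" for J
  proof -
    let ?f = "\<lambda>x. \<Sum>j\<in>J. t j * \<phi> j x"
    have f: "?f \<in> L2 unit_meas" using J by (intro L2_sum L2_scale \<phi>_L2) auto
    have "(\<integral>\<omega>. iexp (\<Sum>j\<in>J. t j * ip (E \<omega>) (\<phi> j)) \<partial>M) = (\<integral>\<omega>. iexp (ip (E \<omega>) ?f) \<partial>M)"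
      using J by (intro Bochner_Integration.integral_cong) (auto simp: ip_E_sum)
    also have "\<dots> = of_real (exp (- (\<Sum>j\<in>J. (t j)\<^sup>2 * lam j) / 2))"
      unfolding ip_E_char[OF f] coords_second_moment[OF J] ..
    finally show ?thesis .
  qed
  have single: "(\<integral>\<omega>. iexp (t j * ip (E \<omega>) (\<phi> j)) \<partial>M) = of_real (exp (- ((t j)\<^sup>2 * lam j) / 2))" if "j \<in> J" for j
    using char[of "{j}"] that J by auto
  have "(\<Prod>j\<in>J. \<integral>\<omega>. iexp (t j * ip (E \<omega>) (\<phi> j)) \<partial>M) = of_real (\<Prod>j\<in>J. exp (- ((t j)\<^sup>2 * lam j) / 2))"
    by (simp only: single of_real_prod cong: prod.cong)
  also have "(\<Prod>j\<in>J. exp (- ((t j)\<^sup>2 * lam j) / 2)) = exp (\<Sum>j\<in>J. - ((t j)\<^sup>2 * lam j) / 2)"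
    using J by (simp add: exp_sum)
  also have "(\<Sum>j\<in>J. - ((t j)\<^sup>2 * lam j) / 2) = - (\<Sum>j\<in>J. (t j)\<^sup>2 * lam j) / 2"
    by (simp add: sum_negf flip: sum_divide_distrib)
  finally show "(\<integral>\<omega>. iexp (\<Sum>j\<in>J. t j * ip (E \<omega>) (\<phi> j)) \<partial>M)
      = (\<Prod>j\<in>J. \<integral>\<omega>. iexp (t j * ip (E \<omega>) (\<phi> j)) \<partial>M)"
    unfolding char[OF J] by simp
qed

lemma first_coord_distr:
  "distr M borel (\<lambda>\<omega>. ip (E \<omega>) (\<phi> 1)) = density lborel (normal_density 0 (sqrt (lam 1)))"
proof -
  have "L2_norm unit_meas (\<phi> 1) \<noteq> 0" using \<phi>_inner[of 1 1] by (simp add: L2_norm_def)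
  then obtain \<sigma> where \<sigma>: "\<sigma> > 0" "distr M borel (\<lambda>\<omega>. ip (E \<omega>) (\<phi> 1)) = density lborel (normal_density 0 \<sigma>)"
    using ip_E_normal[OF \<phi>_L2[of 1]] by auto
  have "\<sigma>\<^sup>2 = lam 1"
    using normal_square[OF ip_E_measurable[OF \<phi>_L2[of 1]] \<sigma>] covariance_coords[of 1 1]
    by (simp add: power2_eq_square)
  then have "\<sigma> = sqrt (lam 1)" using \<sigma>(1) by (simp add: real_sqrt_unique)
  then show ?thesis using \<sigma>(2) by simp
qed

definition residual :: "'w \<Rightarrow> real \<Rightarrow> real" where
  "residual \<omega> = (\<lambda>s. E \<omega> s - ip (E \<omega>) (\<phi> 1) * \<phi> 1 s)"

lemma residual_L2: "\<omega> \<in> space M \<Longrightarrow> residual \<omega> \<in> L2 unit_meas"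
  unfolding residual_def by (intro L2_diff L2_scale E_L2 \<phi>_L2) auto

lemma ip_residual:
  "\<omega> \<in> space M \<Longrightarrow> 1 \<le> k \<Longrightarrow> ip (residual \<omega>) (\<phi> k) = (if k = 1 then 0 else ip (E \<omega>) (\<phi> k))"
  unfolding residual_def
  by (subst L2_inner_diff_left) (auto intro: E_L2 \<phi>_L2 L2_scale simp: L2_inner_scale_left \<phi>_inner)

lemma residual_measurable [measurable]: "residual \<in> M \<rightarrow>\<^sub>M L2_borel unit_meas"
proof (rule measurable_L2_borelI[OF basis residual_L2])
  fix k :: nat assume k: "1 \<le> k"
  have "(\<lambda>\<omega>. if k = 1 then 0 else ip (E \<omega>) (\<phi> k)) \<in> borel_measurable M"
    using ip_E_measurable[OF \<phi>_L2[OF k]] by auto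
  then show "(\<lambda>\<omega>. ip (residual \<omega>) (\<phi> k)) \<in> borel_measurable M"
    by (rule measurable_cong[THEN iffD1, rotated]) (simp add: ip_residual k)
qed

text \<open>
  The coordinates of the residual are those of the noise with the first one replaced by zero. Hence
  the residual is a function of the coordinates from \<open>2\<close> on, which are independent of the first.
\<close>

lemma residual_indep:
  "distr M (L2_borel unit_meas \<Otimes>\<^sub>M borel) (\<lambda>\<omega>. (residual \<omega>, ip (E \<omega>) (\<phi> 1)))
    = distr M (L2_borel unit_meas) residual \<Otimes>\<^sub>M density lborel (normal_density 0 (sqrt (lam 1)))"
proof -
  let ?\<zeta> = "\<lambda>j \<omega>. ip (E \<omega>) (\<phi> j)"
  have [measurable]: "?\<zeta> 1 \<in> borel_measurable M" by (rule ip_E_measurable) (simp add: \<phi>_L2)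
  have ind: "indep_var (\<Pi>\<^sub>M i\<in>{2..}. borel) (\<lambda>\<omega>. \<lambda>i\<in>{2..}. ?\<zeta> i \<omega>) (\<Pi>\<^sub>M i\<in>{1}. borel) (\<lambda>\<omega>. \<lambda>i\<in>{1}. ?\<zeta> i \<omega>)"
    by (rule indep_var_restrict[OF coords_independent]) auto
  have "distr M (L2_borel unit_meas \<Otimes>\<^sub>M borel) (\<lambda>\<omega>. (residual \<omega>, ?\<zeta> 1 \<omega>))
      = distr M (L2_borel unit_meas) residual \<Otimes>\<^sub>M distr M borel (?\<zeta> 1)"
  proof (rule distr_pair_indep)
    fix A and B :: "real set" assume A: "A \<in> sets (L2_borel unit_meas)" and B: "B \<in> sets borel"
    obtain A' where A': "A' \<in> sets (\<Pi>\<^sub>M k\<in>{1::nat..}. borel)" "A = {f \<in> L2 unit_meas. coords unit_meas \<phi> f \<in> A'}"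
      using sets_L2_borel_imp_coords[OF basis A] by blast
    \<comment> \<open>The coordinates of the residual as a function of the coordinates of the noise from \<open>2\<close> on.\<close>
    let ?pad = "\<lambda>u. \<lambda>k\<in>{1::nat..}. if k = 1 then 0 else u k :: real"
    have pad: "?pad \<in> (\<Pi>\<^sub>M i\<in>{2..}. borel) \<rightarrow>\<^sub>M (\<Pi>\<^sub>M i\<in>{1..}. borel)"
    proof (rule measurable_restrict)
      fix k :: nat assume "k \<in> {1..}"
      show "(\<lambda>u. if k = 1 then 0 else u k :: real) \<in> (\<Pi>\<^sub>M i\<in>{2..}. borel) \<rightarrow>\<^sub>M borel"
      proof (cases "k = 1")
        case False
        then have "k \<in> {2..}" using \<open>k \<in> {1..}\<close> by auto
        then show ?thesis using False by (simp add: measurable_component_singleton)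
      qed simp
    qed
    let ?A2 = "?pad -` A' \<inter> space (\<Pi>\<^sub>M i\<in>{2::nat..}. borel)"
    let ?B2 = "(\<lambda>u. u 1) -` B \<inter> space (\<Pi>\<^sub>M i\<in>{1::nat}. borel)"
    have A2: "?A2 \<in> sets (\<Pi>\<^sub>M i\<in>{2..}. borel)" by (rule measurable_sets[OF pad A'(1)])
    have B2: "?B2 \<in> sets (\<Pi>\<^sub>M i\<in>{1}. borel)"
      by (rule measurable_sets[OF _ B]) (rule measurable_component_singleton, simp)
    have eA: "residual -` A \<inter> space M = (\<lambda>\<omega>. \<lambda>i\<in>{2..}. ?\<zeta> i \<omega>) -` ?A2 \<inter> space M"
    proof -
      have "coords unit_meas \<phi> (residual \<omega>) = ?pad (\<lambda>i\<in>{2..}. ?\<zeta> i \<omega>)" if "\<omega> \<in> space M" for \<omega>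
        unfolding coords_def using ip_residual[OF that] by (intro restrict_ext) auto
      then show ?thesis unfolding A'(2) using residual_L2 by (auto simp: space_PiM)
    qed
    have eB: "?\<zeta> 1 -` B \<inter> space M = (\<lambda>\<omega>. \<lambda>i\<in>{1}. ?\<zeta> i \<omega>) -` ?B2 \<inter> space M"
      by (auto simp: space_PiM)
    have "prob (residual -` A \<inter> space M \<inter> (?\<zeta> 1 -` B \<inter> space M))
        = prob ((\<lambda>\<omega>. (\<lambda>i\<in>{2..}. ?\<zeta> i \<omega>, \<lambda>i\<in>{1}. ?\<zeta> i \<omega>)) -` (?A2 \<times> ?B2) \<inter> space M)"
      unfolding eA eB by (intro arg_cong[where f = prob]) auto
    also have "\<dots> = prob (residual -` A \<inter> space M) * prob (?\<zeta> 1 -` B \<inter> space M)"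
      unfolding eA eB by (rule indep_varD[OF ind A2 B2])
    finally show "prob (residual -` A \<inter> space M \<inter> (?\<zeta> 1 -` B \<inter> space M))
        = prob (residual -` A \<inter> space M) * prob (?\<zeta> 1 -` B \<inter> space M)" .
  qed auto
  then show ?thesis unfolding first_coord_distr .
qed

lemma add_multiple_measurable:
  "(\<lambda>(e, z) s. e s + z * \<phi> 1 s) \<in> L2_borel unit_meas \<Otimes>\<^sub>M borel \<rightarrow>\<^sub>M L2_borel unit_meas"
proof (rule measurable_L2_borelI[OF basis])
  fix p :: "(real \<Rightarrow> real) \<times> real" assume "p \<in> space (L2_borel unit_meas \<Otimes>\<^sub>M borel)"
  then show "(case p of (e, z) \<Rightarrow> \<lambda>s. e s + z * \<phi> 1 s) \<in> L2 unit_meas"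
    by (auto simp: space_pair_measure intro!: L2_add L2_scale \<phi>_L2)
next
  fix k :: nat assume k: "1 \<le> k"
  have [measurable]: "(\<lambda>e. ip e (\<phi> k)) \<in> borel_measurable (L2_borel unit_meas)"
    by (rule measurable_L2_inner[OF \<phi>_L2[OF k]])
  have "(\<lambda>p. ip (fst p) (\<phi> k) + snd p * ip (\<phi> 1) (\<phi> k)) \<in> borel_measurable (L2_borel unit_meas \<Otimes>\<^sub>M borel)"
    by measurable
  then show "(\<lambda>p. ip (case p of (e, z) \<Rightarrow> \<lambda>s. e s + z * \<phi> 1 s) (\<phi> k)) \<in> borel_measurable (L2_borel unit_meas \<Otimes>\<^sub>M borel)"
    by (rule measurable_cong[THEN iffD1, rotated])
      (auto simp: space_pair_measure L2_inner_add_left L2_scale \<phi>_L2 k L2_inner_scale_left)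
qed

text \<open>
  Write the noise as residual plus first coordinate times \<open>\<phi> 1\<close>. A shift along \<open>\<phi> 1\<close> acts
  only on the first coordinate, where it moves the mean of a normal law; integrating over the residual
  afterwards yields the shifted noise as a mixture of one-dimensional normal families.
\<close>

lemma shift_nn_integral:
  assumes f [measurable]: "f \<in> borel_measurable (L2_borel unit_meas)"
  shows "(\<integral>\<^sup>+e. f (\<lambda>s. e s + a * \<phi> 1 s) \<partial>distr M (L2_borel unit_meas) E)
    = (\<integral>\<^sup>+e. \<integral>\<^sup>+z. f (\<lambda>s. e s + z * \<phi> 1 s) \<partial>density lborel (normal_density a (sqrt (lam 1)))
        \<partial>distr M (L2_borel unit_meas) residual)"
proof -
  let ?\<zeta> = "\<lambda>\<omega>. ip (E \<omega>) (\<phi> 1)" and ?N = "\<lambda>a. density lborel (normal_density a (sqrt (lam 1)))"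
  have [measurable]: "?\<zeta> \<in> borel_measurable M" by (rule ip_E_measurable) (simp add: \<phi>_L2)
  have \<sigma>: "sqrt (lam 1) > 0" using lam_pos[of 1] by simp
  interpret N: prob_space "?N 0" by (rule prob_space_normal_density[OF \<sigma>])
  have add: "(\<lambda>(e, z) s. e s + z * \<phi> 1 s) \<in> L2_borel unit_meas \<Otimes>\<^sub>M borel \<rightarrow>\<^sub>M L2_borel unit_meas"
    by (rule add_multiple_measurable)
  have shift: "(\<lambda>(e, z) s. e s + (z + a) * \<phi> 1 s) \<in> L2_borel unit_meas \<Otimes>\<^sub>M borel \<rightarrow>\<^sub>M L2_borel unit_meas"
    using measurable_compose[of "\<lambda>p. (fst p, snd p + a)", OF _ add] by (simp add: case_prod_beta')
  have shift1: "(\<lambda>e s. e s + a * \<phi> 1 s) \<in> L2_borel unit_meas \<rightarrow>\<^sub>M L2_borel unit_meas"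
    using measurable_compose[of "\<lambda>e. (e, a)", OF _ add] by simp
  have "(\<integral>\<^sup>+e. f (\<lambda>s. e s + a * \<phi> 1 s) \<partial>distr M (L2_borel unit_meas) E)
      = (\<integral>\<^sup>+\<omega>. f (\<lambda>s. E \<omega> s + a * \<phi> 1 s) \<partial>M)"
    by (rule nn_integral_distr) (use measurable_compose[OF shift1 f] in auto)
  also have "\<dots> = (\<integral>\<^sup>+\<omega>. (case (residual \<omega>, ?\<zeta> \<omega>) of (e, z) \<Rightarrow> f (\<lambda>s. e s + (z + a) * \<phi> 1 s)) \<partial>M)"
    by (simp add: residual_def algebra_simps)
  also have "\<dots> = (\<integral>\<^sup>+p. (case p of (e, z) \<Rightarrow> f (\<lambda>s. e s + (z + a) * \<phi> 1 s))
      \<partial>distr M (L2_borel unit_meas \<Otimes>\<^sub>M borel) (\<lambda>\<omega>. (residual \<omega>, ?\<zeta> \<omega>)))"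
    by (rule nn_integral_distr[symmetric]) (use measurable_compose[OF shift f] in \<open>auto simp: case_prod_beta'\<close>)
  also have "\<dots> = (\<integral>\<^sup>+e. \<integral>\<^sup>+z. f (\<lambda>s. e s + (z + a) * \<phi> 1 s) \<partial>?N 0 \<partial>distr M (L2_borel unit_meas) residual)"
    unfolding residual_indep
    by (subst N.nn_integral_fst[symmetric])
      (use measurable_compose[OF shift f] in \<open>auto simp: case_prod_beta' cong: measurable_cong_sets sets_pair_measure_cong\<close>)
  also have "\<dots> = (\<integral>\<^sup>+e. \<integral>\<^sup>+z. f (\<lambda>s. e s + z * \<phi> 1 s) \<partial>?N a \<partial>distr M (L2_borel unit_meas) residual)"
  proof (intro nn_integral_cong)
    fix e assume "e \<in> space (distr M (L2_borel unit_meas) residual)"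
    then have e: "e \<in> space (L2_borel unit_meas)" by simp
    have g [measurable]: "(\<lambda>z. f (\<lambda>s. e s + z * \<phi> 1 s)) \<in> borel_measurable borel"
      using measurable_compose[OF measurable_compose[OF measurable_Pair1'[OF e] add] f] by simp
    have "(\<integral>\<^sup>+z. f (\<lambda>s. e s + z * \<phi> 1 s) \<partial>?N a)
        = (\<integral>\<^sup>+z. ennreal (normal_density a (sqrt (lam 1)) z) * f (\<lambda>s. e s + z * \<phi> 1 s) \<partial>lborel)"
      by (subst nn_integral_density) auto
    also have "\<dots> = (\<integral>\<^sup>+z. ennreal (normal_density a (sqrt (lam 1)) (a + 1 * z)) * f (\<lambda>s. e s + (a + 1 * z) * \<phi> 1 s) \<partial>lborel)"
      by (subst nn_integral_real_affine[where c = 1 and t = a]) auto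
    also have "\<dots> = (\<integral>\<^sup>+z. ennreal (normal_density 0 (sqrt (lam 1)) z) * f (\<lambda>s. e s + (z + a) * \<phi> 1 s) \<partial>lborel)"
      by (simp add: normal_density_def add.commute)
    also have "\<dots> = (\<integral>\<^sup>+z. f (\<lambda>s. e s + (z + a) * \<phi> 1 s) \<partial>?N 0)"
      using measurable_compose[of "\<lambda>z. z + a" borel borel, OF _ g] by (subst nn_integral_density) auto
    finally show "(\<integral>\<^sup>+z. f (\<lambda>s. e s + (z + a) * \<phi> 1 s) \<partial>?N 0) = (\<integral>\<^sup>+z. f (\<lambda>s. e s + z * \<phi> 1 s) \<partial>?N a)" by simp
  qed
  finally show ?thesis .
qed

text \<open>
  In both mixtures the same law of the residual mixes the components, and these satisfy the comparison of
  two normal laws with a constant that does not depend on the residual.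
\<close>

lemma shift_chi2:
  assumes f [measurable]: "f \<in> borel_measurable (L2_borel unit_meas)"
  shows "(\<integral>\<^sup>+e. f (\<lambda>s. e s + a * \<phi> 1 s) \<partial>distr M (L2_borel unit_meas) E)\<^sup>2
    \<le> ennreal (exp ((a - b)\<^sup>2 / lam 1)) *
       (\<integral>\<^sup>+e. (f (\<lambda>s. e s + b * \<phi> 1 s))\<^sup>2 \<partial>distr M (L2_borel unit_meas) E)"
proof -
  let ?N = "\<lambda>a. density lborel (normal_density a (sqrt (lam 1)))"
  let ?\<mu> = "distr M (L2_borel unit_meas) residual"
  have \<sigma>: "sqrt (lam 1) > 0" "(sqrt (lam 1))\<^sup>2 = lam 1" using lam_pos[of 1] by simp_all
  have \<mu>: "prob_space ?\<mu>" by (rule prob_space_distr) simp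
  interpret Na: prob_space "?N a" by (rule prob_space_normal_density[OF \<sigma>(1)])
  interpret Nb: prob_space "?N b" by (rule prob_space_normal_density[OF \<sigma>(1)])
  have add: "(\<lambda>p. f (\<lambda>s. fst p s + snd p * \<phi> 1 s)) \<in> borel_measurable (L2_borel unit_meas \<Otimes>\<^sub>M borel)"
    using measurable_compose[OF add_multiple_measurable f] by (simp add: case_prod_beta')
  have g: "(\<lambda>z. f (\<lambda>s. e s + z * \<phi> 1 s)) \<in> borel_measurable borel" if "e \<in> L2 unit_meas" for e
    using measurable_compose[OF measurable_Pair1' add, of e] that by simp
  have Ga: "(\<lambda>e. \<integral>\<^sup>+z. f (\<lambda>s. e s + z * \<phi> 1 s) \<partial>?N a) \<in> borel_measurable ?\<mu>"
    using add by (intro Na.borel_measurable_nn_integral)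
      (simp add: case_prod_beta' cong: measurable_cong_sets sets_pair_measure_cong)
  have Gb: "(\<lambda>e. \<integral>\<^sup>+z. (f (\<lambda>s. e s + z * \<phi> 1 s))\<^sup>2 \<partial>?N b) \<in> borel_measurable ?\<mu>"
    using add by (intro Nb.borel_measurable_nn_integral)
      (simp add: case_prod_beta' cong: measurable_cong_sets sets_pair_measure_cong)
  have "(\<integral>\<^sup>+e. f (\<lambda>s. e s + a * \<phi> 1 s) \<partial>distr M (L2_borel unit_meas) E)\<^sup>2
      \<le> (\<integral>\<^sup>+e. (\<integral>\<^sup>+z. f (\<lambda>s. e s + z * \<phi> 1 s) \<partial>?N a)\<^sup>2 \<partial>?\<mu>)"
    unfolding shift_nn_integral[OF f] by (rule nn_integral_square_le[OF \<mu> Ga])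
  also have "\<dots> \<le> (\<integral>\<^sup>+e. ennreal (exp ((a - b)\<^sup>2 / lam 1)) * (\<integral>\<^sup>+z. (f (\<lambda>s. e s + z * \<phi> 1 s))\<^sup>2 \<partial>?N b) \<partial>?\<mu>)"
    using chi2_dominated_normal[OF \<sigma>(1), of a b] g
    by (intro nn_integral_mono) (auto simp: chi2_dominated_def \<sigma>(2))
  also have "\<dots> = ennreal (exp ((a - b)\<^sup>2 / lam 1)) * (\<integral>\<^sup>+e. (\<integral>\<^sup>+z. (f (\<lambda>s. e s + z * \<phi> 1 s))\<^sup>2 \<partial>?N b) \<partial>?\<mu>)"
    by (rule nn_integral_cmult[OF Gb])
  also have "(\<integral>\<^sup>+e. (\<integral>\<^sup>+z. (f (\<lambda>s. e s + z * \<phi> 1 s))\<^sup>2 \<partial>?N b) \<partial>?\<mu>)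
      = (\<integral>\<^sup>+e. (f (\<lambda>s. e s + b * \<phi> 1 s))\<^sup>2 \<partial>distr M (L2_borel unit_meas) E)"
    using shift_nn_integral[of "\<lambda>e. (f e)\<^sup>2" b] by simp
  finally show ?thesis .
qed

end

section \<open>The law of one observation\<close>

locale functional_linear_model = gaussian_noise M E R lam \<phi>
  for M :: "'w measure" and E R lam \<phi> +
  fixes X :: "'w \<Rightarrow> real \<Rightarrow> real" and U :: "nat \<Rightarrow> 'w \<Rightarrow> real" and \<alpha> :: real
  assumes U_uniform: "\<And>k. 1 \<le> k \<Longrightarrow> distr M borel (U k) = uniform_measure lborel {- sqrt 3..sqrt 3}"
    and U_E_indep: "indep_pair M (\<Pi>\<^sub>M k\<in>{1..}. borel) (\<lambda>\<omega>. \<lambda>k\<in>{1..}. U k \<omega>) (L2_borel unit_meas) E"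
    and X_measurable [measurable]: "X \<in> M \<rightarrow>\<^sub>M L2_borel unit_meas"
    and X_expansion: "AE \<omega> in M. has_L2_sum unit_meas
           (\<lambda>k t. real k powr (- \<alpha> / 2) * U k \<omega> * \<phi> k t) {1..} (X \<omega>)"
begin

lemma X_L2: "\<omega> \<in> space M \<Longrightarrow> X \<omega> \<in> L2 unit_meas"
  using measurable_space[OF X_measurable] by simp

lemma X_coords: "AE \<omega> in M. \<forall>k\<ge>1. ip (X \<omega>) (\<phi> k) = real k powr (- \<alpha> / 2) * U k \<omega>"
  using X_expansion
proof eventually_elim
  case (elim \<omega>)
  show ?case
  proof (intro allI impI)
    fix k :: nat assume k: "1 \<le> k"
    have "ip (X \<omega>) (\<phi> k) = ip (\<lambda>t. real k powr (- \<alpha> / 2) * U k \<omega> * \<phi> k t) (\<phi> k)"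
      by (rule L2_inner_has_L2_sum[OF elim \<phi>_L2[OF k]]) (use k in \<open>auto simp: L2_inner_scale_left \<phi>_inner\<close>)
    then show "ip (X \<omega>) (\<phi> k) = real k powr (- \<alpha> / 2) * U k \<omega>"
      using k by (simp add: L2_inner_scale_left \<phi>_inner)
  qed
qed

lemma U_sequence_measurable: "(\<lambda>\<omega>. \<lambda>k\<in>{1..}. U k \<omega>) \<in> M \<rightarrow>\<^sub>M (\<Pi>\<^sub>M k\<in>{1..}. borel)"
  using U_E_indep by (simp add: indep_pair_def)

lemma U_bounded:
  assumes k: "1 \<le> k"
  shows "AE \<omega> in M. \<bar>U k \<omega>\<bar> \<le> sqrt 3"
proof -
  have "(\<lambda>\<omega>. (\<lambda>k\<in>{1..}. U k \<omega>) k) \<in> M \<rightarrow>\<^sub>M borel"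
    by (rule measurable_compose[OF U_sequence_measurable measurable_component_singleton]) (use k in simp)
  then have U: "U k \<in> M \<rightarrow>\<^sub>M borel" using k by simp
  have "AE x in uniform_measure lborel {- sqrt 3..sqrt 3}. \<bar>x\<bar> \<le> sqrt 3"
    by (rule AE_uniform_measureI) auto
  then have "AE x in distr M borel (U k). \<bar>x\<bar> \<le> sqrt 3" unfolding U_uniform[OF k] .
  then show ?thesis using AE_distrD[OF U] by blast
qed

text \<open>
  The bound is deterministic because the uniform variables are bounded. This keeps the chi-square constant
  of an observation finite.
\<close>

lemma X_coord_bounded:
  assumes k: "1 \<le> k"
  shows "AE \<omega> in M. (ip (X \<omega>) (\<phi> k))\<^sup>2 \<le> 3 * real k powr (- \<alpha>)"
  using X_coords U_bounded[OF k]
proof eventually_elim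
  case (elim \<omega>)
  have "(U k \<omega>)\<^sup>2 \<le> (sqrt 3)\<^sup>2" using elim(2) by (metis abs_ge_zero power2_abs power_mono)
  moreover have "(real k powr (- \<alpha> / 2))\<^sup>2 = real k powr (- \<alpha>)"
    by (simp add: power2_eq_square flip: powr_add)
  ultimately show ?case using elim(1) k by (simp add: power_mult_distrib mult.commute mult_left_mono)
qed

text \<open>
  An event about \<open>X\<close> is an event about its coordinates, and these agree almost surely with a
  measurable function of the variables \<open>U k\<close>.
\<close>

lemma X_E_indep: "distr M obs_space (\<lambda>\<omega>. (X \<omega>, E \<omega>)) = distr M (L2_borel unit_meas) X \<Otimes>\<^sub>M distr M (L2_borel unit_meas) E"
proof (rule distr_pair_indep)
  fix A B assume A: "A \<in> sets (L2_borel unit_meas)" and B: "B \<in> sets (L2_borel unit_meas)"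
  obtain A' where A': "A' \<in> sets (\<Pi>\<^sub>M k\<in>{1::nat..}. borel)" "A = {f \<in> L2 unit_meas. coords unit_meas \<phi> f \<in> A'}"
    using sets_L2_borel_imp_coords[OF basis A] by blast
  let ?U = "\<lambda>\<omega>. \<lambda>k\<in>{1..}. U k \<omega>"
  let ?scale = "\<lambda>u. \<lambda>k\<in>{1::nat..}. real k powr (- \<alpha> / 2) * u k :: real"
  have scale: "?scale \<in> (\<Pi>\<^sub>M k\<in>{1..}. borel) \<rightarrow>\<^sub>M (\<Pi>\<^sub>M k\<in>{1..}. borel)"
    by (rule measurable_restrict) (intro borel_measurable_times borel_measurable_const measurable_component_singleton)
  let ?A2 = "?scale -` A' \<inter> space (\<Pi>\<^sub>M k\<in>{1::nat..}. borel)"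
  have A2: "?A2 \<in> sets (\<Pi>\<^sub>M k\<in>{1..}. borel)" by (rule measurable_sets[OF scale A'(1)])
  have XA [measurable]: "X -` A \<inter> space M \<in> events" by (rule measurable_sets[OF X_measurable A])
  have EB [measurable]: "E -` B \<inter> space M \<in> events" by (rule measurable_sets[OF E_measurable B])
  have UA [measurable]: "?U -` ?A2 \<inter> space M \<in> events" by (rule measurable_sets[OF U_sequence_measurable A2])
  have ae: "AE \<omega> in M. \<omega> \<in> X -` A \<longleftrightarrow> \<omega> \<in> ?U -` ?A2"
    using X_coords AE_space
  proof eventually_elim
    case (elim \<omega>)
    have "coords unit_meas \<phi> (X \<omega>) = ?scale (?U \<omega>)"
      unfolding coords_def using elim(1) by (intro restrict_ext) auto
    then show ?case unfolding A'(2) using X_L2[OF elim(2)] by (auto simp: space_PiM)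
  qed
  have "prob (X -` A \<inter> space M \<inter> (E -` B \<inter> space M)) = prob ((?U -` ?A2 \<inter> space M) \<inter> (E -` B \<inter> space M))"
    by (rule finite_measure_eq_AE[OF _ sets.Int[OF XA EB] sets.Int[OF UA EB]])
      (rule eventually_mono[OF ae], blast)
  also have "\<dots> = prob (?U -` ?A2 \<inter> space M) * prob (E -` B \<inter> space M)"
  proof (rule indep_setD)
    show "indep_set {?U -` A \<inter> space M |A. A \<in> sets (\<Pi>\<^sub>M k\<in>{1..}. borel)}
        {E -` A \<inter> space M |A. A \<in> sets (L2_borel unit_meas)}"
      using U_E_indep unfolding indep_pair_def by blast
    show "?U -` ?A2 \<inter> space M \<in> {?U -` A \<inter> space M |A. A \<in> sets (\<Pi>\<^sub>M k\<in>{1..}. borel)}"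
      using A2 by blast
    show "E -` B \<inter> space M \<in> {E -` A \<inter> space M |A. A \<in> sets (L2_borel unit_meas)}"
      using B by blast
  qed
  also have "prob (?U -` ?A2 \<inter> space M) = prob (X -` A \<inter> space M)"
    by (rule finite_measure_eq_AE[OF _ UA XA]) (rule eventually_mono[OF ae], blast)
  finally show "prob (X -` A \<inter> space M \<inter> (E -` B \<inter> space M)) = prob (X -` A \<inter> space M) * prob (E -` B \<inter> space M)" .
qed auto

abbreviation observation_law :: "(real \<times> real \<Rightarrow> real) \<Rightarrow> ((real \<Rightarrow> real) \<times> (real \<Rightarrow> real)) measure" where
  "observation_law b \<equiv> distr M obs_space (\<lambda>\<omega>. (X \<omega>, response b (X \<omega>) (E \<omega>)))"

lemma response_tensor: "response (\<phi> 1 \<otimes>\<^sub>t h) x e = (\<lambda>s. e s + ip h x * \<phi> 1 s)"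
proof
  fix s
  have "(\<integral>t. \<phi> 1 s * h t * x t \<partial>unit_meas) = \<phi> 1 s * ip h x"
    unfolding L2_inner_def mult.assoc by (rule integral_mult_right_zero)
  then show "response (\<phi> 1 \<otimes>\<^sub>t h) x e s = e s + ip h x * \<phi> 1 s"
    by (simp add: response_def tensor_def mult.commute)
qed

lemma shifted_pair_measurable:
  assumes h: "h \<in> L2 unit_meas"
  shows "(\<lambda>(x, e). (x, \<lambda>s. e s + ip h x * \<phi> 1 s)) \<in> obs_space \<rightarrow>\<^sub>M obs_space"
proof -
  have [measurable]: "(\<lambda>x. ip h x) \<in> borel_measurable (L2_borel unit_meas)"
    using measurable_L2_inner[OF h] by (simp add: L2_inner_commute)
  have "(\<lambda>p. (snd p, ip h (fst p))) \<in> obs_space \<rightarrow>\<^sub>M L2_borel unit_meas \<Otimes>\<^sub>M borel" by measurable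
  from measurable_compose[OF this add_multiple_measurable]
  have [measurable]: "(\<lambda>p s. snd p s + ip h (fst p) * \<phi> 1 s) \<in> obs_space \<rightarrow>\<^sub>M L2_borel unit_meas"
    by simp
  show ?thesis unfolding case_prod_beta' by measurable
qed

lemma observation_measurable:
  assumes h: "h \<in> L2 unit_meas"
  shows "(\<lambda>\<omega>. (X \<omega>, response (\<phi> 1 \<otimes>\<^sub>t h) (X \<omega>) (E \<omega>))) \<in> M \<rightarrow>\<^sub>M obs_space"
proof -
  have "(\<lambda>\<omega>. (X \<omega>, E \<omega>)) \<in> M \<rightarrow>\<^sub>M obs_space" by measurable
  from measurable_compose[OF this shifted_pair_measurable[OF h]] show ?thesis
    by (simp add: response_tensor)
qed

lemma observation_nn_integral:
  assumes h: "h \<in> L2 unit_meas" and f [measurable]: "f \<in> borel_measurable obs_space"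
  shows "(\<integral>\<^sup>+p. f p \<partial>observation_law (\<phi> 1 \<otimes>\<^sub>t h))
    = (\<integral>\<^sup>+x. \<integral>\<^sup>+e. f (x, \<lambda>s. e s + ip h x * \<phi> 1 s) \<partial>distr M (L2_borel unit_meas) E \<partial>distr M (L2_borel unit_meas) X)"
proof -
  interpret DE: prob_space "distr M (L2_borel unit_meas) E" by (rule prob_space_distr) simp
  have fm: "(\<lambda>p. f (fst p, \<lambda>s. snd p s + ip h (fst p) * \<phi> 1 s)) \<in> borel_measurable obs_space"
    using measurable_compose[OF shifted_pair_measurable[OF h] f] by (simp add: case_prod_beta')
  have "(\<integral>\<^sup>+p. f p \<partial>observation_law (\<phi> 1 \<otimes>\<^sub>t h)) = (\<integral>\<^sup>+\<omega>. f (X \<omega>, \<lambda>s. E \<omega> s + ip h (X \<omega>) * \<phi> 1 s) \<partial>M)"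
    by (subst nn_integral_distr[OF observation_measurable[OF h]]) (auto simp: response_tensor)
  also have "\<dots> = (\<integral>\<^sup>+p. f (fst p, \<lambda>s. snd p s + ip h (fst p) * \<phi> 1 s) \<partial>distr M obs_space (\<lambda>\<omega>. (X \<omega>, E \<omega>)))"
    by (subst nn_integral_distr) (use fm in auto)
  also have "\<dots> = (\<integral>\<^sup>+x. \<integral>\<^sup>+e. f (x, \<lambda>s. e s + ip h x * \<phi> 1 s) \<partial>distr M (L2_borel unit_meas) E \<partial>distr M (L2_borel unit_meas) X)"
    unfolding X_E_indep
    by (subst DE.nn_integral_fst[symmetric]) (use fm in \<open>auto cong: measurable_cong_sets sets_pair_measure_cong\<close>)
  finally show ?thesis .
qed

text \<open>
  Given the design \<open>x\<close>, two responses differ by a shift of the noise along \<open>\<phi> 1\<close>, by the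
  amount \<open>ip h x - ip g x\<close>. The conditional comparison is uniform in \<open>x\<close>, and the law of the
  design is the same for both slopes.
\<close>

lemma observation_chi2:
  assumes h: "h \<in> L2 unit_meas" and g: "g \<in> L2 unit_meas"
    and B: "AE \<omega> in M. (ip h (X \<omega>) - ip g (X \<omega>))\<^sup>2 \<le> B"
  shows "chi2_dominated (exp (B / lam 1)) (observation_law (\<phi> 1 \<otimes>\<^sub>t h)) (observation_law (\<phi> 1 \<otimes>\<^sub>t g))"
  unfolding chi2_dominated_def
proof (intro conjI ballI)
  fix f :: "(real \<Rightarrow> real) \<times> (real \<Rightarrow> real) \<Rightarrow> ennreal"
  assume "f \<in> borel_measurable (observation_law (\<phi> 1 \<otimes>\<^sub>t h))"
  then have f [measurable]: "f \<in> borel_measurable obs_space" by simp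
  let ?DX = "distr M (L2_borel unit_meas) X" and ?DE = "distr M (L2_borel unit_meas) E"
  interpret DE: prob_space ?DE by (rule prob_space_distr) simp
  have DX: "prob_space ?DX" by (rule prob_space_distr) simp
  have fm: "(\<lambda>p. f (fst p, \<lambda>s. snd p s + ip h (fst p) * \<phi> 1 s)) \<in> borel_measurable obs_space" if "h \<in> L2 unit_meas" for h
    using measurable_compose[OF shifted_pair_measurable[OF that] f] by (simp add: case_prod_beta')
  have G1: "(\<lambda>x. \<integral>\<^sup>+e. f (x, \<lambda>s. e s + ip h x * \<phi> 1 s) \<partial>?DE) \<in> borel_measurable ?DX"
    using fm[OF h] by (intro DE.borel_measurable_nn_integral)
      (simp add: case_prod_beta' cong: measurable_cong_sets sets_pair_measure_cong)
  have G2: "(\<lambda>x. \<integral>\<^sup>+e. (f (x, \<lambda>s. e s + ip g x * \<phi> 1 s))\<^sup>2 \<partial>?DE) \<in> borel_measurable ?DX"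
    using fm[OF g] by (intro DE.borel_measurable_nn_integral)
      (simp add: case_prod_beta' cong: measurable_cong_sets sets_pair_measure_cong)
  have [measurable]: "(\<lambda>x. ip h x) \<in> borel_measurable (L2_borel unit_meas)" "(\<lambda>x. ip g x) \<in> borel_measurable (L2_borel unit_meas)"
    using measurable_L2_inner[OF h] measurable_L2_inner[OF g] by (simp_all add: L2_inner_commute)
  have BX: "AE x in ?DX. (ip h x - ip g x)\<^sup>2 \<le> B"
  proof (rule AE_distr_iff[THEN iffD2])
    show "AE \<omega> in M. (ip h (X \<omega>) - ip g (X \<omega>))\<^sup>2 \<le> B" by (rule B)
    show "X \<in> M \<rightarrow>\<^sub>M L2_borel unit_meas" by (rule X_measurable)
    show "{x \<in> space (L2_borel unit_meas). (ip h x - ip g x)\<^sup>2 \<le> B} \<in> sets (L2_borel unit_meas)"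
      by measurable
  qed
  have "(\<integral>\<^sup>+p. f p \<partial>observation_law (\<phi> 1 \<otimes>\<^sub>t h))\<^sup>2 \<le> (\<integral>\<^sup>+x. (\<integral>\<^sup>+e. f (x, \<lambda>s. e s + ip h x * \<phi> 1 s) \<partial>?DE)\<^sup>2 \<partial>?DX)"
    unfolding observation_nn_integral[OF h f] by (rule nn_integral_square_le[OF DX G1])
  also have "\<dots> \<le> (\<integral>\<^sup>+x. ennreal (exp (B / lam 1)) * (\<integral>\<^sup>+e. (f (x, \<lambda>s. e s + ip g x * \<phi> 1 s))\<^sup>2 \<partial>?DE) \<partial>?DX)"
  proof (intro nn_integral_mono_AE)
    show "AE x in ?DX. (\<integral>\<^sup>+e. f (x, \<lambda>s. e s + ip h x * \<phi> 1 s) \<partial>?DE)\<^sup>2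
        \<le> ennreal (exp (B / lam 1)) * (\<integral>\<^sup>+e. (f (x, \<lambda>s. e s + ip g x * \<phi> 1 s))\<^sup>2 \<partial>?DE)"
      using BX AE_space
    proof eventually_elim
      case (elim x)
      then have "(\<lambda>e. f (x, e)) \<in> borel_measurable (L2_borel unit_meas)"
        using measurable_compose[OF measurable_Pair1' f] by simp
      from shift_chi2[OF this, of "ip h x" "ip g x"]
      have "(\<integral>\<^sup>+e. f (x, \<lambda>s. e s + ip h x * \<phi> 1 s) \<partial>?DE)\<^sup>2
        \<le> ennreal (exp ((ip h x - ip g x)\<^sup>2 / lam 1)) * (\<integral>\<^sup>+e. (f (x, \<lambda>s. e s + ip g x * \<phi> 1 s))\<^sup>2 \<partial>?DE)" .
      also have "\<dots> \<le> ennreal (exp (B / lam 1)) * (\<integral>\<^sup>+e. (f (x, \<lambda>s. e s + ip g x * \<phi> 1 s))\<^sup>2 \<partial>?DE)"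
        using elim(1) lam_pos[of 1] by (intro mult_right_mono ennreal_leI) (auto simp: divide_right_mono)
      finally show ?case .
    qed
  qed
  also have "\<dots> = ennreal (exp (B / lam 1)) * (\<integral>\<^sup>+x. (\<integral>\<^sup>+e. (f (x, \<lambda>s. e s + ip g x * \<phi> 1 s))\<^sup>2 \<partial>?DE) \<partial>?DX)"
    by (rule nn_integral_cmult[OF G2])
  also have "\<dots> = ennreal (exp (B / lam 1)) * (\<integral>\<^sup>+p. (f p)\<^sup>2 \<partial>observation_law (\<phi> 1 \<otimes>\<^sub>t g))"
    using observation_nn_integral[OF g, of "\<lambda>p. (f p)\<^sup>2"] by simp
  finally show "(\<integral>\<^sup>+p. f p \<partial>observation_law (\<phi> 1 \<otimes>\<^sub>t h))\<^sup>2
      \<le> ennreal (exp (B / lam 1)) * (\<integral>\<^sup>+p. (f p)\<^sup>2 \<partial>observation_law (\<phi> 1 \<otimes>\<^sub>t g))" .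
qed simp

end

section \<open>Assouad's lemma in probability\<close>

text \<open>
  Here \<open>D\<close> is the event that a test decides for \<open>Q\<close>. Either it has probability at least one half
  under \<open>P\<close>, or its complement has; in the latter case the comparison gives the complement
  probability at least \<open>1 / (4 * K)\<close> under \<open>Q\<close>.
\<close>

lemma two_point_error:
  assumes chi2: "chi2_dominated K P Q" and P: "prob_space P" and Q: "prob_space Q"
    and D: "D \<in> sets P" and K: "1 \<le> K"
  shows "1 / (4 * K) \<le> measure P D + measure Q (space P - D)"
proof -
  interpret P: prob_space P by fact
  let ?q = "measure P (space P - D)" and ?r = "measure Q (space P - D)"
  have sq: "?q\<^sup>2 \<le> K * ?r"
    using K by (intro chi2_dominated_measure[OF chi2 _ P Q]) (use D in auto)
  have q: "measure P D = 1 - ?q" using P.prob_compl[OF D] by simp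
  show ?thesis
  proof (cases "?q \<le> 1 / 2")
    case True
    have "1 / (4 * K) \<le> 1 / 2" using K by (simp add: field_simps)
    then show ?thesis using True q measure_nonneg[of Q "space P - D"] by linarith
  next
    case False
    then have "(1 / 2)\<^sup>2 \<le> ?q\<^sup>2" by (intro power_mono) auto
    with sq have "1 / 4 \<le> K * ?r" by (simp add: power2_eq_square)
    then have "1 / (4 * K) \<le> ?r" using K by (simp add: field_simps)
    then show ?thesis using measure_nonneg[of P D] by linarith
  qed
qed

text \<open>
  The vertices of a hypercube are encoded as subsets of \<open>K\<close>, and \<open>D k\<close> is the event that an
  estimator assigns \<open>k\<close> to the subset. Pairing each vertex with its neighbour in direction \<open>k\<close>
  shows that, averaged over all vertices, coordinate \<open>k\<close> is wrong with probability at least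
  \<open>\<kappa> / 2\<close>. So some vertex has at least \<open>\<kappa> / 2 * card K\<close> expected errors. As the number of
  errors never exceeds \<open>card K\<close>, it is at least half its expectation with probability \<open>\<kappa> / 4\<close>.
\<close>

lemma Assouad:
  fixes Q :: "'k set \<Rightarrow> 'z measure"
  assumes K: "finite K" "K \<noteq> {}" and \<kappa>: "0 \<le> \<kappa>"
    and Q: "\<And>S. S \<subseteq> K \<Longrightarrow> prob_space (Q S)" and sets: "\<And>S. S \<subseteq> K \<Longrightarrow> sets (Q S) = sets N"
    and D: "\<And>k. k \<in> K \<Longrightarrow> D k \<in> sets N"
    and two: "\<And>k S. k \<in> K \<Longrightarrow> S \<subseteq> K - {k} \<Longrightarrow>
      \<kappa> \<le> measure (Q S) (D k) + measure (Q (insert k S)) (space N - D k)"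
  shows "\<exists>S\<subseteq>K. \<kappa> / 4 \<le> measure (Q S) {z \<in> space N. \<kappa> / 4 * real (card K) \<le> real (card {k \<in> K. (z \<in> D k) \<noteq> (k \<in> S)})}"
proof -
  define W where "W S k = (if k \<in> S then space N - D k else D k)" for S k
  have Wm: "W S k \<in> sets N" if "k \<in> K" for S k using D[OF that] by (auto simp: W_def)
  have W_iff: "z \<in> W S k \<longleftrightarrow> (z \<in> D k) \<noteq> (k \<in> S)" if "z \<in> space N" for z S k
    using that by (auto simp: W_def)
  have coord: "2 ^ (card K - 1) * \<kappa> \<le> (\<Sum>S\<in>Pow K. measure (Q S) (W S k))" if k: "k \<in> K" for k
  proof -
    let ?K' = "K - {k}"
    have fin: "finite (Pow ?K')" using K by simp
    have Pow: "Pow K = Pow ?K' \<union> insert k ` Pow ?K'"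
      using Pow_insert[of k ?K'] k by (simp add: insert_absorb)
    have inj: "inj_on (insert k) (Pow ?K')" by (auto simp: inj_on_def)
    have "2 ^ (card K - 1) * \<kappa> = (\<Sum>S\<in>Pow ?K'. \<kappa>)"
      using K k by (simp add: card_Pow card_Diff_singleton)
    also have "\<dots> \<le> (\<Sum>S\<in>Pow ?K'. measure (Q S) (W S k) + measure (Q (insert k S)) (W (insert k S) k))"
      using two[OF k] by (intro sum_mono) (auto simp: W_def)
    also have "\<dots> = (\<Sum>S\<in>Pow K. measure (Q S) (W S k))"
      unfolding Pow using fin
      by (subst sum.union_disjoint) (auto simp: sum.distrib sum.reindex[OF inj])
    finally show ?thesis .
  qed
  have "\<exists>S\<in>Pow K. real (card K) * (\<kappa> / 2) \<le> (\<Sum>k\<in>K. measure (Q S) (W S k))"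
  proof (rule ccontr)
    assume "\<not> ?thesis"
    then have "(\<Sum>S\<in>Pow K. \<Sum>k\<in>K. measure (Q S) (W S k)) < (\<Sum>S\<in>Pow K. real (card K) * (\<kappa> / 2))"
      using K by (intro sum_strict_mono) (auto simp: not_le)
    also have "\<dots> = (\<Sum>k\<in>K. 2 ^ (card K - 1) * \<kappa>)"
      using K by (cases "card K") (auto simp: card_Pow)
    also have "\<dots> \<le> (\<Sum>k\<in>K. \<Sum>S\<in>Pow K. measure (Q S) (W S k))"
      by (intro sum_mono coord)
    also have "\<dots> = (\<Sum>S\<in>Pow K. \<Sum>k\<in>K. measure (Q S) (W S k))" by (rule sum.swap)
    finally show False by simp
  qed
  then obtain S where S: "S \<subseteq> K" "real (card K) * (\<kappa> / 2) \<le> (\<Sum>k\<in>K. measure (Q S) (W S k))" by auto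
  interpret QS: prob_space "Q S" by (rule Q[OF S(1)])
  have sp: "space (Q S) = space N" using sets_eq_imp_space_eq[OF sets[OF S(1)]] .
  define G where "G = {z \<in> space N. \<kappa> / 4 * real (card K) \<le> real (card {k \<in> K. (z \<in> D k) \<noteq> (k \<in> S)})}"
  have card: "real (card {k \<in> K. (z \<in> D k) \<noteq> (k \<in> S)}) = (\<Sum>k\<in>K. indicator (W S k) z)" if "z \<in> space N" for z
  proof -
    have "(\<Sum>k\<in>K. indicator (W S k) z :: real) = (\<Sum>k\<in>K. if (z \<in> D k) \<noteq> (k \<in> S) then 1 else 0)"
      by (intro sum.cong) (auto simp: indicator_def W_iff[OF that])
    also have "\<dots> = real (card {k \<in> K. (z \<in> D k) \<noteq> (k \<in> S)})"
      using K by (simp add: sum.If_cases Int_def)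
    finally show ?thesis by simp
  qed
  have G_eq: "G = {z \<in> space N. \<kappa> / 4 * real (card K) \<le> (\<Sum>k\<in>K. indicator (W S k) z)}"
    unfolding G_def using card by auto
  have "(\<lambda>z. \<Sum>k\<in>K. indicator (W S k) z :: real) \<in> borel_measurable N"
    using Wm by (intro borel_measurable_sum borel_measurable_indicator)
  then have GN: "G \<in> sets N" unfolding G_eq by measurable
  have WQ: "W S k \<in> sets (Q S)" if "k \<in> K" for k using Wm[OF that] sets[OF S(1)] by simp
  have GQ: "G \<in> sets (Q S)" using GN sets[OF S(1)] by simp
  have int: "integrable (Q S) (indicator A :: _ \<Rightarrow> real)" if "A \<in> sets (Q S)" for A
    using that by (intro integrable_real_indicator) (auto simp: QS.emeasure_eq_measure)
  have ind: "(\<integral>z. indicator A z \<partial>Q S :: real) = measure (Q S) A" if "A \<in> sets (Q S)" for A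
    using sets.sets_into_space[OF that] by (simp add: Int_absorb2)
  have "real (card K) * (\<kappa> / 2) \<le> (\<integral>z. (\<Sum>k\<in>K. indicator (W S k) z) \<partial>Q S)"
    using S(2) int WQ by (subst Bochner_Integration.integral_sum) (auto simp: ind simp del: Bochner_Integration.integral_indicator)
  also have "\<dots> \<le> (\<integral>z. real (card K) * indicator G z + \<kappa> / 4 * real (card K) \<partial>Q S)"
  proof (rule Bochner_Integration.integral_mono)
    show "integrable (Q S) (\<lambda>z. \<Sum>k\<in>K. indicator (W S k) z :: real)"
      using int WQ by (intro Bochner_Integration.integrable_sum) auto
    show "integrable (Q S) (\<lambda>z. real (card K) * indicator G z + \<kappa> / 4 * real (card K))"
      using int[OF GQ] by simp
    fix z assume "z \<in> space (Q S)"
    then have z: "z \<in> space N" using sp by simp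
    show "(\<Sum>k\<in>K. indicator (W S k) z) \<le> real (card K) * indicator G z + \<kappa> / 4 * real (card K)"
    proof (cases "z \<in> G")
      case True
      have "(\<Sum>k\<in>K. indicator (W S k) z :: real) \<le> (\<Sum>k\<in>K. 1)" by (intro sum_mono) (auto simp: indicator_def)
      moreover have "0 \<le> \<kappa> / 4 * real (card K)" using \<kappa> by simp
      ultimately show ?thesis using True by simp
    next
      case False
      then show ?thesis using z by (auto simp: G_eq)
    qed
  qed
  also have "\<dots> = real (card K) * (measure (Q S) G + \<kappa> / 4)"
    using int[OF GQ] ind[OF GQ] by (simp add: QS.prob_space algebra_simps)
  finally have "real (card K) * (\<kappa> / 2) \<le> real (card K) * (measure (Q S) G + \<kappa> / 4)" .
  moreover have "0 < real (card K)" using K by (simp add: card_gt_0_iff)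
  ultimately have "\<kappa> / 2 \<le> measure (Q S) G + \<kappa> / 4" by (simp only: mult_le_cancel_left_pos)
  then have "\<kappa> / 4 \<le> measure (Q S) G" by simp
  then show ?thesis using S(1) unfolding G_def by blast
qed

section \<open>The minimax lower bound\<close>

lemma nat_ceiling_bounds:
  fixes x :: real
  assumes "1 \<le> x"
  shows "x \<le> real (nat \<lceil>x\<rceil>)" "real (nat \<lceil>x\<rceil>) \<le> 2 * x"
  using assms by linarith+

context functional_linear_model
begin

definition slope :: "real \<Rightarrow> nat set \<Rightarrow> real \<Rightarrow> real" where
  "slope \<beta> S t = (\<Sum>k\<in>S. real k powr (- \<beta>) * \<phi> k t)"

lemma slope_L2: "S \<subseteq> {1..} \<Longrightarrow> slope \<beta> S \<in> L2 unit_meas"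
  unfolding slope_def[abs_def] by (intro L2_sum L2_scale \<phi>_L2) auto

lemma ip_slope: "finite S \<Longrightarrow> S \<subseteq> {1..} \<Longrightarrow> f \<in> L2 unit_meas \<Longrightarrow>
    ip (slope \<beta> S) f = (\<Sum>k\<in>S. real k powr (- \<beta>) * ip (\<phi> k) f)"
  unfolding slope_def[abs_def]
  by (subst L2_inner_sum_left) (auto intro!: L2_scale \<phi>_L2 simp: L2_inner_scale_left)

lemma slope_in_coefficient_class:
  assumes S: "finite S" "S \<subseteq> {1..}" and C: "1 \<le> C"
  shows "\<phi> 1 \<otimes>\<^sub>t slope \<beta> S \<in> coefficient_class \<phi> \<beta> \<gamma> C"
proof -
  define a :: "nat \<Rightarrow> nat \<Rightarrow> real" where "a j k = (if j = 1 \<and> k \<in> S then real k powr (- \<beta>) else 0)" for j k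
  let ?f = "\<lambda>(j, k) z. a j k * (\<phi> j \<otimes>\<^sub>t \<phi> k) z"
  have "has_L2_sum unit_meas2 ?f ({1..} \<times> {1..}) (\<phi> 1 \<otimes>\<^sub>t slope \<beta> S)"
    unfolding has_L2_sum_def
  proof (intro conjI ballI)
    show "\<phi> 1 \<otimes>\<^sub>t slope \<beta> S \<in> L2 unit_meas2"
      using S by (intro unit2.tensor_L2 \<phi>_L2 slope_L2) auto
    show "?f i \<in> L2 unit_meas2" if "i \<in> {1..} \<times> {1..}" for i
      using that by (auto intro!: L2_scale unit2.tensor_L2 \<phi>_L2)
    show "((\<lambda>F. L2_norm unit_meas2 (\<lambda>x. (\<Sum>i\<in>F. ?f i x) - (\<phi> 1 \<otimes>\<^sub>t slope \<beta> S) x)) \<longlongrightarrow> 0)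
        (finite_subsets_at_top ({1..} \<times> {1..}))"
    proof (rule tendsto_eventually)
      have "\<forall>\<^sub>F F in finite_subsets_at_top ({1::nat..} \<times> {1..}). finite F \<and> {1} \<times> S \<subseteq> F \<and> F \<subseteq> {1..} \<times> {1..}"
        unfolding eventually_finite_subsets_at_top using S by (intro exI[of _ "{1} \<times> S"]) auto
      then show "\<forall>\<^sub>F F in finite_subsets_at_top ({1..} \<times> {1..}).
          L2_norm unit_meas2 (\<lambda>x. (\<Sum>i\<in>F. ?f i x) - (\<phi> 1 \<otimes>\<^sub>t slope \<beta> S) x) = 0"
      proof eventually_elim
        case (elim F)
        have "(\<Sum>i\<in>F. ?f i x) = (\<phi> 1 \<otimes>\<^sub>t slope \<beta> S) x" for x
        proof -
          have "(\<Sum>i\<in>F. ?f i x) = (\<Sum>i\<in>{1} \<times> S. ?f i x)"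
            using elim by (intro sum.mono_neutral_right) (auto simp: a_def split: if_splits)
          also have "\<dots> = (\<Sum>k\<in>S. a 1 k * (\<phi> 1 \<otimes>\<^sub>t \<phi> k) x)"
          proof -
            have "{1::nat} \<times> S = Pair 1 ` S" by auto
            then show ?thesis by (simp add: sum.reindex inj_on_def)
          qed
          also have "\<dots> = (\<phi> 1 \<otimes>\<^sub>t slope \<beta> S) x"
            by (cases x) (simp add: a_def tensor_def slope_def sum_distrib_left mult.left_commute cong: sum.cong)
          finally show ?thesis .
        qed
        then show ?case by (simp add: L2_norm_def L2_inner_def)
      qed
    qed
  qed
  moreover have "\<bar>a j k\<bar> \<le> C * real j powr (- \<gamma>) * real k powr (- \<beta>)" if "1 \<le> j" "1 \<le> k" for j k
  proof (cases "j = 1 \<and> k \<in> S")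
    case True
    then show ?thesis using C mult_right_mono[of 1 C "real k powr (- \<beta>)"] by (simp add: a_def)
  next
    case False
    then show ?thesis using C by (auto simp: a_def)
  qed
  ultimately show ?thesis unfolding coefficient_class_def by blast
qed

text \<open>
  Removing \<open>k\<close> from the subset changes the regression on the design \<open>x\<close> by \<open>k powr (- \<beta>)\<close>
  times the coordinate \<open>k\<close> of \<open>x\<close>, whose square is at most \<open>3 * k powr (- \<alpha>)\<close>.
\<close>

lemma sample_law_chi2:
  assumes S: "finite S" "S \<subseteq> {1..}" "k \<notin> S" "1 \<le> k"
  shows "chi2_dominated (exp (3 * real k powr (- (\<alpha> + 2 * \<beta>)) / lam 1) ^ n)
    (sample_law M X E (\<phi> 1 \<otimes>\<^sub>t slope \<beta> S) n) (sample_law M X E (\<phi> 1 \<otimes>\<^sub>t slope \<beta> (insert k S)) n)"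
proof -
  have L2: "slope \<beta> S \<in> L2 unit_meas" "slope \<beta> (insert k S) \<in> L2 unit_meas"
    using S by (auto intro: slope_L2)
  have "AE \<omega> in M. (ip (slope \<beta> S) (X \<omega>) - ip (slope \<beta> (insert k S)) (X \<omega>))\<^sup>2 \<le> 3 * real k powr (- (\<alpha> + 2 * \<beta>))"
    using X_coord_bounded[OF S(4)] AE_space
  proof eventually_elim
    case (elim \<omega>)
    have "ip (slope \<beta> S) (X \<omega>) - ip (slope \<beta> (insert k S)) (X \<omega>) = - (real k powr (- \<beta>) * ip (X \<omega>) (\<phi> k))"
      using S X_L2[OF elim(2)] by (simp add: ip_slope L2_inner_commute[of _ "\<phi> k"])
    then have "(ip (slope \<beta> S) (X \<omega>) - ip (slope \<beta> (insert k S)) (X \<omega>))\<^sup>2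
        = real k powr (- 2 * \<beta>) * (ip (X \<omega>) (\<phi> k))\<^sup>2"
      by (simp add: power_mult_distrib power2_eq_square flip: powr_add)
    also have "\<dots> \<le> real k powr (- 2 * \<beta>) * (3 * real k powr (- \<alpha>))"
      using elim(1) by (intro mult_left_mono) auto
    also have "\<dots> = 3 * real k powr (- (\<alpha> + 2 * \<beta>))"
      by (simp add: algebra_simps flip: powr_add)
    finally show ?case .
  qed
  note chi2 = observation_chi2[OF L2 this]
  have "chi2_dominated (exp (3 * real k powr (- (\<alpha> + 2 * \<beta>)) / lam 1) ^ card {1..n})
    (sample_law M X E (\<phi> 1 \<otimes>\<^sub>t slope \<beta> S) n) (sample_law M X E (\<phi> 1 \<otimes>\<^sub>t slope \<beta> (insert k S)) n)"
    unfolding sample_law_def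
    by (rule chi2_dominated_PiM[OF chi2])
      (simp_all add: prob_space_distr observation_measurable L2)
  then show ?thesis by simp
qed

text \<open>
  With \<open>m\<close> of order \<open>n powr (1 / (\<alpha> + 2 * \<beta>))\<close>, each of the \<open>m\<close> coordinates between
  \<open>m + 1\<close> and \<open>2 * m\<close> has a chi-square constant that stays bounded over \<open>n\<close> observations, so a fixed
  fraction of them is misjudged. Each misjudged coordinate costs at least a constant multiple of
  \<open>m powr (- 2 * \<beta>)\<close>, which adds up to the order \<open>m powr (1 - 2 * \<beta>)\<close>.
\<close>

lemma minimax_lower_bound:
  assumes \<alpha>: "\<alpha> > 1" and \<beta>: "\<beta> > 1/2" and C: "1 \<le> C"
  shows "\<exists>c>0. liminf (\<lambda>n. INF T\<in>estimators n. SUP b\<in>coefficient_class \<phi> \<beta> \<gamma> C.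
           emeasure (sample_law M X E b n)
             {z \<in> space (sample_law M X E b n).
                (L2_norm unit_meas2 (\<lambda>u. T z u - b u))\<^sup>2
                  \<ge> c * real n powr (- (2 * \<beta> - 1) / (\<alpha> + 2 * \<beta>))}) > 0"
proof -
  \<comment> \<open>\<open>exp (3 / lam 1)\<close> bounds the chi-square constant of neighbouring vertices for all \<open>n\<close>.\<close>
  define \<kappa> where "\<kappa> = 1 / (4 * exp (3 / lam 1))"
  have \<kappa>: "\<kappa> > 0" by (simp add: \<kappa>_def)
  define c where "c = \<kappa> / 16 * 2 powr (1 - 4 * \<beta>)"
  have c: "c > 0" using \<kappa> by (simp add: c_def)
  let ?rate = "\<lambda>n::nat. real n powr (- (2 * \<beta> - 1) / (\<alpha> + 2 * \<beta>))"
  let ?bad = "\<lambda>n T b. {z \<in> space (sample_law M X E b n). (L2_norm unit_meas2 (\<lambda>u. T z u - b u))\<^sup>2 \<ge> c * ?rate n}"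
  have bound: "ennreal (\<kappa> / 4) \<le> (SUP b\<in>coefficient_class \<phi> \<beta> \<gamma> C. emeasure (sample_law M X E b n) (?bad n T b))"
    if n: "1 \<le> n" and T: "T \<in> estimators n" for n T
  proof -
    define x where "x = real n powr (1 / (\<alpha> + 2 * \<beta>))"
    have x1: "1 \<le> x" unfolding x_def using n \<alpha> \<beta> by (intro ge_one_powr_ge_zero) auto
    define m where "m = nat \<lceil>x\<rceil>"
    have m: "x \<le> real m" "real m \<le> 2 * x" using nat_ceiling_bounds[OF x1] by (auto simp: m_def)
    have m0: "0 < real m" using m x1 by linarith
    let ?K = "{m+1..2*m}" and ?N = "\<Pi>\<^sub>M i\<in>{1..n}. obs_space"
    let ?b = "\<lambda>S. \<phi> 1 \<otimes>\<^sub>t slope \<beta> S"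
    let ?Q = "\<lambda>S. sample_law M X E (?b S) n"
    let ?e = "\<lambda>k. \<phi> 1 \<otimes>\<^sub>t \<phi> k"
    \<comment> \<open>Coordinate \<open>k\<close> of the slope is either \<open>0\<close> or \<open>k powr (- \<beta>)\<close>; decide by the midpoint, so
        that a wrong decision forces an error of at least half the gap.\<close>
    define D where "D k = {z \<in> space ?N. real k powr (- \<beta>) / 2 \<le> L2_inner unit_meas2 (T z) (?e k)}" for k
    have Tm: "T \<in> ?N \<rightarrow>\<^sub>M L2_borel unit_meas2" using T by (simp add: estimators_def)
    have e: "?e k \<in> L2 unit_meas2" if "1 \<le> k" for k using that by (intro unit2.tensor_L2 \<phi>_L2) auto
    have "?K \<subseteq> {1..}" by auto
    then have SK: "finite S" "S \<subseteq> {1..}" if "S \<subseteq> ?K" for S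
      using finite_subset[OF that] order_trans[OF that] by simp_all
    have sets: "sets (?Q S) = sets ?N" for S
      unfolding sample_law_def by (intro sets_PiM_cong) auto
    have prob: "prob_space (?Q S)" if "S \<subseteq> ?K" for S
      unfolding sample_law_def
      by (intro prob_space_PiM prob_space_distr observation_measurable slope_L2 SK[OF that])
    have Dm: "D k \<in> sets ?N" if "1 \<le> k" for k
    proof -
      have [measurable]: "(\<lambda>z. L2_inner unit_meas2 (T z) (?e k)) \<in> borel_measurable ?N"
        by (rule measurable_compose[OF Tm measurable_L2_inner[OF e[OF that]]])
      show ?thesis unfolding D_def by measurable
    qed
    have two: "\<kappa> \<le> measure (?Q S) (D k) + measure (?Q (insert k S)) (space ?N - D k)"
      if k: "k \<in> ?K" and S: "S \<subseteq> ?K - {k}" for k S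
    proof -
      let ?L = "exp (3 * real k powr (- (\<alpha> + 2 * \<beta>)) / lam 1) ^ n"
      have k1: "1 \<le> k" "real m \<le> real k" using k by auto
      have "real n = x powr (\<alpha> + 2 * \<beta>)"
        unfolding x_def powr_powr using \<alpha> \<beta> n by simp
      also have "\<dots> \<le> real k powr (\<alpha> + 2 * \<beta>)"
        using m k1 x1 \<alpha> \<beta> by (intro powr_mono2) auto
      finally have "real n * real k powr (- (\<alpha> + 2 * \<beta>)) \<le> real k powr (\<alpha> + 2 * \<beta>) * real k powr (- (\<alpha> + 2 * \<beta>))"
        by (intro mult_right_mono) auto
      also have "\<dots> = 1" using k1 by (simp flip: powr_add)
      finally have "real n * real k powr (- (\<alpha> + 2 * \<beta>)) \<le> 1" .
      then have "real n * (3 * real k powr (- (\<alpha> + 2 * \<beta>)) / lam 1) \<le> 3 / lam 1"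
        using lam_pos[of 1] by (simp add: field_simps)
      then have L: "?L \<le> exp (3 / lam 1)" by (simp flip: exp_of_nat_mult)
      have L1: "1 \<le> ?L"
        using lam_pos[of 1] by (intro one_le_power) simp
      have spQ: "space (?Q S) = space ?N" using sets_eq_imp_space_eq[OF sets] .
      have chi2: "chi2_dominated ?L (?Q S) (?Q (insert k S))"
        by (rule sample_law_chi2) (use SK[of S] S k1 in auto)
      have "1 / (4 * ?L) \<le> measure (?Q S) (D k) + measure (?Q (insert k S)) (space (?Q S) - D k)"
        by (rule two_point_error[OF chi2 prob prob _ L1]) (use S k k1 Dm sets in auto)
      moreover have "\<kappa> \<le> 1 / (4 * ?L)"
        unfolding \<kappa>_def using L L1 by (intro divide_left_mono) auto
      ultimately show ?thesis unfolding spQ by linarith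
    qed
    have "\<exists>S\<subseteq>?K. \<kappa> / 4 \<le> measure (?Q S) {z \<in> space ?N. \<kappa> / 4 * real (card ?K) \<le> real (card {k \<in> ?K. (z \<in> D k) \<noteq> (k \<in> S)})}"
    proof (rule Assouad)
      show "?K \<noteq> {}" using m0 by simp
      show "0 \<le> \<kappa>" using \<kappa> by simp
    qed (use prob sets Dm two in auto)
    then obtain S where S: "S \<subseteq> ?K" and
      G: "\<kappa> / 4 \<le> measure (?Q S) {z \<in> space ?N. \<kappa> / 4 * real (card ?K) \<le> real (card {k \<in> ?K. (z \<in> D k) \<noteq> (k \<in> S)})}"
      (is "_ \<le> measure _ ?G") by blast
    interpret QS: prob_space "?Q S" by (rule prob[OF S])
    have spQ: "space (?Q S) = space ?N" using sets_eq_imp_space_eq[OF sets] .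
    have bL2: "?b S \<in> L2 unit_meas2" using SK[OF S] by (intro unit2.tensor_L2 \<phi>_L2 slope_L2) auto
    have b_e: "L2_inner unit_meas2 (?b S) (?e k) = (if k \<in> S then real k powr (- \<beta>) else 0)" if "1 \<le> k" for k
    proof -
      have "ip (slope \<beta> S) (\<phi> k) = (\<Sum>j\<in>S. if j = k then real j powr (- \<beta>) else 0)"
        unfolding ip_slope[OF SK[OF S] \<phi>_L2[OF that]]
        using SK[OF S] that by (intro sum.cong) (auto simp: \<phi>_inner)
      also have "\<dots> = (if k \<in> S then real k powr (- \<beta>) else 0)" using SK[OF S] by simp
      finally show ?thesis using SK[OF S] that by (simp add: unit2.tensor_inner \<phi>_L2 slope_L2 \<phi>_inner)
    qed
    have loss: "c * ?rate n \<le> (L2_norm unit_meas2 (\<lambda>u. T z u - ?b S u))\<^sup>2" if z: "z \<in> ?G" for z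
    proof -
      let ?W = "{k \<in> ?K. (z \<in> D k) \<noteq> (k \<in> S)}"
      have zN: "z \<in> space ?N" using z by simp
      have Tz: "T z \<in> L2 unit_meas2" using measurable_space[OF Tm zN] by simp
      have dev: "((2 * real m) powr (- \<beta>) / 2)\<^sup>2 \<le> (L2_inner unit_meas2 (\<lambda>u. T z u - ?b S u) (?e k))\<^sup>2" if k: "k \<in> ?W" for k
      proof -
        have k1: "1 \<le> k" "real k \<le> 2 * real m" using k by auto
        have "(2 * real m) powr (- \<beta>) / 2 \<le> real k powr (- \<beta>) / 2"
          using k1 \<beta> by (intro divide_right_mono powr_mono2') auto
        also have "\<dots> \<le> \<bar>L2_inner unit_meas2 (\<lambda>u. T z u - ?b S u) (?e k)\<bar>"
        proof (cases "k \<in> S")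
          case True
          then have "L2_inner unit_meas2 (T z) (?e k) < real k powr (- \<beta>) / 2" using k zN by (auto simp: D_def)
          then show ?thesis
            unfolding L2_inner_diff_left[OF Tz bL2 e[OF k1(1)]] b_e[OF k1(1)]
            using True abs_ge_minus_self[of "L2_inner unit_meas2 (T z) (?e k) - real k powr (- \<beta>)"] by simp
        next
          case False
          then have "real k powr (- \<beta>) / 2 \<le> L2_inner unit_meas2 (T z) (?e k)" using k zN by (auto simp: D_def)
          then show ?thesis
            unfolding L2_inner_diff_left[OF Tz bL2 e[OF k1(1)]] b_e[OF k1(1)] using False by simp
        qed
        finally have "((2 * real m) powr (- \<beta>) / 2)\<^sup>2 \<le> \<bar>L2_inner unit_meas2 (\<lambda>u. T z u - ?b S u) (?e k)\<bar>\<^sup>2"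
          by (rule power_mono) simp
        then show ?thesis by (simp only: power2_abs)
      qed
      have "m powr (1 - 2 * \<beta>) \<ge> (2 * x) powr (1 - 2 * \<beta>)"
        using m m0 \<beta> by (intro powr_mono2') auto
      moreover have "(2 * x) powr (1 - 2 * \<beta>) = 2 powr (1 - 2 * \<beta>) * ?rate n"
        unfolding x_def using n by (simp add: powr_mult powr_powr)
      ultimately have mrate: "2 powr (1 - 2 * \<beta>) * ?rate n \<le> real m powr (1 - 2 * \<beta>)" by simp
      have "c * ?rate n = \<kappa> / 16 * 2 powr (- 2 * \<beta>) * (2 powr (1 - 2 * \<beta>) * ?rate n)"
        unfolding c_def by (simp flip: powr_add add: algebra_simps)
      also have "\<dots> \<le> \<kappa> / 16 * 2 powr (- 2 * \<beta>) * real m powr (1 - 2 * \<beta>)"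
        using \<kappa> by (intro mult_left_mono mrate) auto
      also have "\<dots> = \<kappa> / 4 * real m * ((2 * real m) powr (- \<beta>) / 2)\<^sup>2"
      proof -
        have "real m powr (1 - 2 * \<beta>) = real m * real m powr (- 2 * \<beta>)"
          using m0 by (simp add: powr_diff powr_minus divide_inverse)
        moreover have "((2 * real m) powr (- \<beta>) / 2)\<^sup>2 = 2 powr (- 2 * \<beta>) * real m powr (- 2 * \<beta>) / 4"
        proof -
          have half: "u powr (- 2 * \<beta>) = (u powr (- \<beta>))\<^sup>2" for u :: real
            by (simp add: power2_eq_square flip: powr_add)
          show ?thesis unfolding half using m0 by (simp add: powr_mult power_divide power_mult_distrib)
        qed
        ultimately show ?thesis by simp
      qed
      also have "\<dots> \<le> real (card ?W) * ((2 * real m) powr (- \<beta>) / 2)\<^sup>2"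
        using z by (intro mult_right_mono) auto
      also have "\<dots> = (\<Sum>k\<in>?W. ((2 * real m) powr (- \<beta>) / 2)\<^sup>2)" by simp
      also have "\<dots> \<le> (\<Sum>k\<in>?W. (L2_inner unit_meas2 (\<lambda>u. T z u - ?b S u) (?e k))\<^sup>2)"
        by (rule sum_mono) (rule dev)
      also have "\<dots> \<le> (L2_norm unit_meas2 (\<lambda>u. T z u - ?b S u))\<^sup>2"
        by (rule L2_Bessel) (auto intro: L2_diff Tz bL2 e simp: unit2.tensor_inner \<phi>_L2 \<phi>_inner)
      finally show ?thesis .
    qed
    have bad: "?bad n T (?b S) \<in> sets (?Q S)"
    proof -
      have "(\<lambda>z. L2_norm unit_meas2 (\<lambda>u. T z u - ?b S u)) \<in> borel_measurable ?N"
        by (rule measurable_compose[OF Tm measurable_L2_dist[OF bL2]])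
      then have [measurable]: "(\<lambda>z. L2_norm unit_meas2 (\<lambda>u. T z u - ?b S u)) \<in> borel_measurable (?Q S)"
        using measurable_cong_sets[OF sets refl] by blast
      show ?thesis by measurable
    qed
    have "ennreal (\<kappa> / 4) \<le> emeasure (?Q S) ?G"
      unfolding QS.emeasure_eq_measure using G by (rule ennreal_leI)
    also have "\<dots> \<le> emeasure (?Q S) (?bad n T (?b S))"
      using loss spQ by (intro emeasure_mono[OF _ bad]) auto
    also have "\<dots> \<le> (SUP b\<in>coefficient_class \<phi> \<beta> \<gamma> C. emeasure (sample_law M X E b n) (?bad n T b))"
      by (rule SUP_upper[OF slope_in_coefficient_class[OF SK[OF S] C]])
    finally show ?thesis .
  qed
  have "0 < ennreal (\<kappa> / 4)" using \<kappa> by simp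
  also have "\<dots> \<le> liminf (\<lambda>n. INF T\<in>estimators n. SUP b\<in>coefficient_class \<phi> \<beta> \<gamma> C.
      emeasure (sample_law M X E b n) (?bad n T b))"
    by (rule Liminf_bounded, rule eventually_mono[OF eventually_ge_at_top[of 1]], rule INF_greatest, rule bound)
  finally show ?thesis using c by blast
qed

end

theorem theorem3:
  fixes \<alpha> \<beta> \<gamma> C\<^sub>1 :: real
    and M :: "'w measure"
    and \<E> X :: "'w \<Rightarrow> real \<Rightarrow> real"
    and R :: "real \<times> real \<Rightarrow> real"
    and lam :: "nat \<Rightarrow> real"
    and \<phi> :: "nat \<Rightarrow> real \<Rightarrow> real"
    and U :: "nat \<Rightarrow> 'w \<Rightarrow> real"
  assumes "\<alpha> > 1" and "\<beta> > 1/2" and "\<gamma> > 1/2" and "C\<^sub>1 > 1"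
    and "prob_space M"
    and "L2_gaussian M \<E>"
    and "\<And>f. f \<in> L2 unit_meas \<Longrightarrow> L2_norm unit_meas f = 1 \<Longrightarrow>
           (\<integral>\<omega>. L2_inner unit_meas f (\<E> \<omega>) \<partial>M) = 0"
    and "\<And>f. f \<in> L2 unit_meas \<Longrightarrow> L2_norm unit_meas f = 1 \<Longrightarrow>
           (\<integral>\<omega>. (L2_inner unit_meas f (\<E> \<omega>))\<^sup>2 \<partial>M) > 0"
    and "covariance_function M \<E> R"
    and "L2_orthonormal_basis unit_meas \<phi>"
    and "\<And>j k. 1 \<le> j \<Longrightarrow> j \<le> k \<Longrightarrow> lam k \<le> lam j"
    and "\<And>j. 1 \<le> j \<Longrightarrow> lam j > 0"
    and "has_L2_sum unit_meas2 (\<lambda>j z. lam j * (\<phi> j \<otimes>\<^sub>t \<phi> j) z) {1..} R"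
    and "prob_space.indep_vars M (\<lambda>_. borel) U {1..}"
    and "\<And>k. 1 \<le> k \<Longrightarrow> distr M borel (U k) = uniform_measure lborel {- sqrt 3..sqrt 3}"
    and "indep_pair M (\<Pi>\<^sub>M k\<in>{1..}. borel) (\<lambda>\<omega>. \<lambda>k\<in>{1..}. U k \<omega>)
           (L2_borel unit_meas) \<E>"
    and "X \<in> M \<rightarrow>\<^sub>M L2_borel unit_meas"
    and "AE \<omega> in M. has_L2_sum unit_meas
           (\<lambda>k t. real k powr (- \<alpha> / 2) * U k \<omega> * \<phi> k t) {1..} (X \<omega>)"
  shows "\<exists>c>0. liminf (\<lambda>n. INF T\<in>estimators n. SUP b\<in>coefficient_class \<phi> \<beta> \<gamma> C\<^sub>1.
           emeasure (sample_law M X \<E> b n)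
             {z \<in> space (sample_law M X \<E> b n).
                (L2_norm unit_meas2 (\<lambda>u. T z u - b u))\<^sup>2
                  \<ge> c * real n powr (- (2 * \<beta> - 1) / (\<alpha> + 2 * \<beta>))}) > 0"
proof -
  interpret functional_linear_model M \<E> R lam \<phi> X U \<alpha>
    by (intro functional_linear_model.intro gaussian_noise.intro gaussian_noise_axioms.intro
        functional_linear_model_axioms.intro) (fact assms)+
  have "1 \<le> C\<^sub>1" using assms by simp
  then show ?thesis by (rule minimax_lower_bound[OF assms(1,2)])
qed

end
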